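(* Let $\mathcal{X}$ be a separable (real) Hilbert space, let $\mu$ be a probability distribution on $\mathcal{X}$, and let $\mathbf{X}\sim\mu$ have the Karhunen–Loève expansion $\mathbf{X}=\mathbf{m}+\sum_{k=1}^\infty\lambda_kY_k\phi_k$, where the $Y_k$'s are uncorrelated random variables with zero means and unit variances, the $\lambda_k^2$'s and $\phi_k$'s are the eigenvalues and eigenfunctions of the covariance of $\mathbf{X}$, and $\{\phi_1,\phi_2,\ldots\}$ is an orthonormal basis of $\mathcal{X}$. Let $\mathbf{X}_1,\mathbf{X}_2,\ldots$ be i.i.d. with distribution $\mu$, let $\mathbf{u}\in\mathcal{X}$ with $\|\mathbf{u}\|<1$, and let $\mathcal{Z}_n=\mathrm{span}\{\phi_1,\ldots,\phi_{d(n)}\}$. Suppose that $\mu$ is nonatomic and not entirely supported on a line in $\mathcal{X}$, and that $\sup_{\mathbf{Q}\in\mathcal{Z}_n,\|\mathbf{Q}\|\le C}E\{\|\mathbf{Q}-\mathbf{X}^{(n)}\|^{-2}\}<\infty$ for each $C>0$ and all appropriately large $n$. Also assume that for some $\alpha\in(1/4,1/2]$, $d(n)/n^{1-2\alpha}$ tends to a positive constant, $\sqrt{n}\,\|\mathbf{u}-\mathbf{u}^{(n)}\|\to0$, $\sqrt{n}\,\|\mathbf{m}-\mathbf{m}^{(n)}\|\to0$ and $n\sum_{k>d(n)}\lambda_k^2\to0$ as $n\to\infty$. Then there exists a zero mean Gaussian random element $\mathbf{Z}_{\mathbf{u}}$ in $\mathcal{X}$ such that $\sqrt{n}(\widehat{\mathbf{Q}}(\mathbf{u})-\mathbf{Q}(\mathbf{u}))$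 converges weakly to $\mathbf{Z}_{\mathbf{u}}$ as $n\to\infty$. The covariance of $\mathbf{Z}_{\mathbf{u}}$ is $$V_{\mathbf{u}}=[\widetilde{J}_{\mathbf{Q}(\mathbf{u})}]^{-1}\Lambda_{\mathbf{u}}[\widetilde{J}_{\mathbf{Q}(\mathbf{u})}]^{-1},$$ where $\Lambda_{\mathbf{u}}:\mathcal{X}\to\mathcal{X}$ satisfies, for all $\mathbf{z},\mathbf{w}\in\mathcal{X}$, $$\langle\Lambda_{\mathbf{u}}(\mathbf{z}),\mathbf{w}\rangle=E\left\{\left\langle\frac{\mathbf{Q}(\mathbf{u})-\mathbf{X}}{\|\mathbf{Q}(\mathbf{u})-\mathbf{X}\|}-\mathbf{u},\mathbf{z}\right\rangle\left\langle\frac{\mathbf{Q}(\mathbf{u})-\mathbf{X}}{\|\mathbf{Q}(\mathbf{u})-\mathbf{X}\|}-\mathbf{u},\mathbf{w}\right\rangle\right\}.$$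
   Context: $d(n)$ is a positive integer depending on $n$; for $\mathbf{z}\in\mathcal{X}$, $\mathbf{z}^{(n)}$ is the orthogonal projection of $\mathbf{z}$ onto $\mathcal{Z}_n$ (so $\mathbf{u}^{(n)},\mathbf{m}^{(n)},\mathbf{X}^{(n)},\mathbf{X}_i^{(n)}$ are projections). $\mathcal{X}^*$ is identified with $\mathcal{X}$, so $\mathbf{u}(\mathbf{Q})=\langle\mathbf{u},\mathbf{Q}\rangle$. A line through $\mathbf{x}_1,\mathbf{x}_2$ is $\{a\mathbf{x}_1+(1-a)\mathbf{x}_2:a\in\mathbb{R}\}$. Nonatomic means every singleton has measure zero. Put $g(\mathbf{Q})=E\{\|\mathbf{Q}-\mathbf{X}\|-\|\mathbf{X}\|\}-\mathbf{u}(\mathbf{Q})$ for $\mathbf{Q}\in\mathcal{X}$. The spatial $\mathbf{u}$-quantile $\mathbf{Q}(\mathbf{u})$ is the minimizer of $g$ over $\mathcal{X}$. The sample spatial $\mathbf{u}$-quantile $\widehat{\mathbf{Q}}(\mathbf{u})$ is the minimizer over $\mathbf{Q}\in\mathcal{Z}_n$ of $n^{-1}\sum_{i=1}^n\{\|\mathbf{Q}-\mathbf{X}_i^{(n)}\|-\|\mathbf{X}_i^{(n)}\|\}-\mathbf{u}^{(n)}(\mathbf{Q})$. The Hessian $J_{\mathbf{Q}}$ of $g$ at $\mathbf{Q}$ is the symmetric bounded bilinear form on $\mathcal{X}\times\mathcal{X}$ satisfying, for every $\mathbf{h}\in\mathcal{X}$, $$\lim_{t\to0}\Bigl|g(\mathbf{Q}+t\mathbf{h})-g(\mathbf{Q})-t\Bigl\langle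 E\Bigl\{\tfrac{\mathbf{Q}-\mathbf{X}}{\|\mathbf{Q}-\mathbf{X}\|}-\mathbf{u}\Bigr\},\mathbf{h}\Bigr\rangle-\tfrac{t^2}{2}J_{\mathbf{Q}}(\mathbf{h},\mathbf{h})\Bigr|\Big/t^2=0,$$ and $\widetilde{J}_{\mathbf{Q}}:\mathcal{X}\to\mathcal{X}$ is the continuous linear operator with $\langle\widetilde{J}_{\mathbf{Q}}(\mathbf{h}),\mathbf{v}\rangle=J_{\mathbf{Q}}(\mathbf{h},\mathbf{v})$ for all $\mathbf{h},\mathbf{v}\in\mathcal{X}$. A random element $\mathbf{Z}$ of $\mathcal{X}$ is Gaussian with mean $\mathbf{m}$ and covariance $\mathbf{C}:\mathcal{X}\to\mathcal{X}$ if for any $\mathbf{l}\in\mathcal{X}$, $\langle\mathbf{l},\mathbf{Z}\rangle$ is Gaussian on $\mathbb{R}$ with mean $\langle\mathbf{l},\mathbf{m}\rangle$ and variance $\langle\mathbf{C}(\mathbf{l}),\mathbf{l}\rangle$. Weak convergence means convergence in distribution in $\mathcal{X}$ with its norm topology. *)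

theory Defs
  imports "HOL-Probability.Probability"
begin

definition orth_proj :: "'a::real_inner set \<Rightarrow> 'a \<Rightarrow> 'a" where
  "orth_proj S z = (THE y. y \<in> S \<and> (\<forall>s\<in>S. orthogonal (z - y) s))"

definition line_through :: "'a::real_vector \<Rightarrow> 'a \<Rightarrow> 'a set" where
  "line_through x y = range (\<lambda>a. a *\<^sub>R x + (1 - a) *\<^sub>R y)"

definition orthonormal_basis :: "(nat \<Rightarrow> 'a::real_inner) \<Rightarrow> bool" where
  "orthonormal_basis \<phi> \<longleftrightarrow>
     (\<forall>i j. \<phi> i \<bullet> \<phi> j = (if i = j then 1 else 0)) \<and> closure (span (range \<phi>)) = UNIV"

text \<open>Sequences are indexed from 0, so this is the span of the first \<open>k\<close> basis vectors.\<close>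

definition basis_span :: "(nat \<Rightarrow> 'a::real_vector) \<Rightarrow> nat \<Rightarrow> 'a set" where
  "basis_span \<phi> k = span (\<phi> ` {..<k})"

text \<open>The covariance operator \<open>E[(X - EX) \<otimes> (X - EX)]\<close> as a Bochner integral; it is used only
  for square-integrable \<open>X\<close>.\<close>

definition covariance_operator ::
  "'b measure \<Rightarrow> ('b \<Rightarrow> 'a::{real_inner, banach, second_countable_topology}) \<Rightarrow> 'a \<Rightarrow> 'a" where
  "covariance_operator P X v =
     (\<integral>\<omega>. ((X \<omega> - (\<integral>\<omega>'. X \<omega>' \<partial>P)) \<bullet> v) *\<^sub>R (X \<omega> - (\<integral>\<omega>'. X \<omega>' \<partial>P)) \<partial>P)"

text \<open>Square integrability of \<open>X\<close>, which the covariance presupposes, makes \<open>\<Sum>\<^sub>k (\<lambda>\<^sub>k)\<^sup>2\<close>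
  converge. Some \<open>\<lambda>\<^sub>k\<close> may vanish, in which case \<open>Y\<^sub>k\<close> need not be a function of \<open>X\<close>; hence
  everything lives on a probability space \<open>P\<close> rather than on the law of \<open>X\<close>.\<close>

definition karhunen_loeve ::
  "'b measure \<Rightarrow> ('b \<Rightarrow> 'a::{real_inner, banach, second_countable_topology}) \<Rightarrow> 'a \<Rightarrow>
   (nat \<Rightarrow> real) \<Rightarrow> (nat \<Rightarrow> 'b \<Rightarrow> real) \<Rightarrow> (nat \<Rightarrow> 'a) \<Rightarrow> bool" where
  "karhunen_loeve P X m lam Y \<phi> \<longleftrightarrow>
     prob_space P \<and> X \<in> borel_measurable P \<and> integrable P (\<lambda>\<omega>. (norm (X \<omega>))\<^sup>2) \<and>
     orthonormal_basis \<phi> \<and>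
     (\<forall>k. covariance_operator P X (\<phi> k) = (lam k)\<^sup>2 *\<^sub>R \<phi> k) \<and>
     (\<forall>k. Y k \<in> borel_measurable P \<and> integrable P (\<lambda>\<omega>. (Y k \<omega>)\<^sup>2) \<and>
          prob_space.expectation P (Y k) = 0 \<and> prob_space.variance P (Y k) = 1) \<and>
     (\<forall>j k. j \<noteq> k \<longrightarrow> prob_space.expectation P (\<lambda>\<omega>. Y j \<omega> * Y k \<omega>) = 0) \<and>
     (AE \<omega> in P. (\<lambda>k. (lam k * Y k \<omega>) *\<^sub>R \<phi> k) sums (X \<omega> - m))"

definition spatial_objective ::
  "'a::{real_inner, banach, second_countable_topology} measure \<Rightarrow> 'a \<Rightarrow> 'a \<Rightarrow> real" where
  "spatial_objective \<mu> u Q = (\<integral>x. norm (Q - x) - norm x \<partial>\<mu>) - u \<bullet> Q"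

definition is_spatial_quantile ::
  "'a::{real_inner, banach, second_countable_topology} measure \<Rightarrow> 'a \<Rightarrow> 'a \<Rightarrow> bool" where
  "is_spatial_quantile \<mu> u Q \<longleftrightarrow> is_arg_min (spatial_objective \<mu> u) (\<lambda>_. True) Q"

text \<open>The sample \<open>x\<^sub>1, \<dots>, x\<^sub>n\<close> is \<open>x 0, \<dots>, x (n - 1)\<close>; \<open>S\<close> is the subspace onto which the data and
  \<open>u\<close> are projected. A minimizer always exists for \<open>n \<ge> 1\<close>, finite-dimensional \<open>S\<close> and
  \<open>norm u < 1\<close>, but it need not be unique if the projected data lie on a line.\<close>

definition sample_objective ::
  "'a::real_inner set \<Rightarrow> nat \<Rightarrow> (nat \<Rightarrow> 'a) \<Rightarrow> 'a \<Rightarrow> 'a \<Rightarrow> real" where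
  "sample_objective S n x u Q =
     (\<Sum>i<n. norm (Q - orth_proj S (x i)) - norm (orth_proj S (x i))) / real n
       - orth_proj S u \<bullet> Q"

definition is_sample_quantile ::
  "'a::real_inner set \<Rightarrow> nat \<Rightarrow> (nat \<Rightarrow> 'a) \<Rightarrow> 'a \<Rightarrow> 'a \<Rightarrow> bool" where
  "is_sample_quantile S n x u Q \<longleftrightarrow> is_arg_min (sample_objective S n x u) (\<lambda>Q. Q \<in> S) Q"

text \<open>\<open>sgn z\<close> is \<open>z / norm z\<close>, with value 0 at \<open>z = 0\<close>. The form \<open>J\<close> is unique by polarization.\<close>

definition is_spatial_hessian ::
  "'a::{real_inner, banach, second_countable_topology} measure \<Rightarrow> 'a \<Rightarrow> 'a \<Rightarrow>
   ('a \<Rightarrow> 'a \<Rightarrow> real) \<Rightarrow> bool" where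
  "is_spatial_hessian \<mu> u Q J \<longleftrightarrow>
     bounded_bilinear J \<and> (\<forall>h v. J h v = J v h) \<and>
     (\<forall>h. ((\<lambda>t. \<bar>spatial_objective \<mu> u (Q + t *\<^sub>R h) - spatial_objective \<mu> u Q
               - t * ((\<integral>x. sgn (Q - x) - u \<partial>\<mu>) \<bullet> h) - t\<^sup>2 / 2 * J h h\<bar> / t\<^sup>2)
            \<longlongrightarrow> 0) (at 0))"

definition represents_form :: "('a::real_inner \<Rightarrow> 'a) \<Rightarrow> ('a \<Rightarrow> 'a \<Rightarrow> real) \<Rightarrow> bool" where
  "represents_form T J \<longleftrightarrow> bounded_linear T \<and> (\<forall>h v. T h \<bullet> v = J h v)"

text \<open>Variance 0 gives the degenerate Gaussian law, a point mass.\<close>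

definition normal_law :: "real \<Rightarrow> real \<Rightarrow> real measure" where
  "normal_law a v =
     (if v = 0 then return borel a else density lborel (\<lambda>x. ennreal (normal_density a (sqrt v) x)))"

text \<open>Nonnegativity of the variances is required explicitly because \<open>normal_density a (sqrt v)\<close> is
  a probability density for \<open>v < 0\<close> as well.\<close>

definition gaussian_element ::
  "'b measure \<Rightarrow> ('b \<Rightarrow> 'a::real_inner) \<Rightarrow> 'a \<Rightarrow> ('a \<Rightarrow> 'a) \<Rightarrow> bool" where
  "gaussian_element N Z m C \<longleftrightarrow>
     prob_space N \<and> Z \<in> borel_measurable N \<and>
     (\<forall>l. 0 \<le> C l \<bullet> l \<and> distr N borel (\<lambda>\<omega>. l \<bullet> Z \<omega>) = normal_law (l \<bullet> m) (C l \<bullet> l))"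

definition converges_weakly ::
  "'b measure \<Rightarrow> (nat \<Rightarrow> 'b \<Rightarrow> 'a::topological_space) \<Rightarrow> 'c measure \<Rightarrow> ('c \<Rightarrow> 'a) \<Rightarrow> bool" where
  "converges_weakly M W N Z \<longleftrightarrow>
     (\<forall>f :: 'a \<Rightarrow> real. continuous_on UNIV f \<and> bounded (range f) \<longrightarrow>
        (\<lambda>n. \<integral>\<omega>. f (W n \<omega>) \<partial>M) \<longlonglongrightarrow> (\<integral>\<omega>. f (Z \<omega>) \<partial>N))"

end

theory Submission
  imports Defs
begin

text \<open>
  Rescale by \<open>h = sqrt n (R - \<pi> Q)\<close>, where \<open>\<pi>\<close> projects onto the approximating subspace. Expanding the
  norm to second order with a cubic remainder \<open>norm h ^ 3 / norm z ^ 2\<close>, which is integrable by the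
  inverse moment condition, the rescaled sample objective is \<open>V\<^sub>n \<bullet> h + T h \<bullet> h / 2\<close> uniformly on
  bounded subsets of the subspace, up to an error whose expectation tends to 0; here \<open>V\<^sub>n\<close> is the
  normalized sum of \<open>sgn (Q - X\<^sub>i) - u\<close> and \<open>T\<close> is the Hessian operator. The fluctuation of the quadratic
  term is controlled in Hilbert-Schmidt norm, where \<open>d n / n \<longlonglongrightarrow> 0\<close> enters. By convexity
  \<open>sqrt n (Qhat - Q) = - T\<^sup>-\<^sup>1 V\<^sub>n + o(1)\<close> in probability, and the central limit theorem in Hilbert space
  applies to \<open>- T\<^sup>-\<^sup>1 V\<^sub>n\<close>. It is reduced by projection to finite dimensions, where convergence of
  characteristic functions suffices by the Stone-Weierstrass theorem.

  \<open>T\<close> is coercive because \<open>1 - (U \<bullet> U')\<^sup>2 \<le> 2 (1 - (U \<bullet> h)\<^sup>2) + 2 (1 - (U' \<bullet> h)\<^sup>2)\<close> for unit vectors: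
  averaging over independent copies bounds \<open>T h \<bullet> h\<close> below by a constant that vanishes only if \<open>\<mu>\<close>
  sits on a line.
\<close>

section \<open>Orthonormal bases\<close>

text \<open>The inverse moment hypothesis yields a finite supremum for each late \<open>n\<close>,
  but no bound uniform in \<open>n\<close>. Uniformity comes from monotonicity:
  \<open>norm (\<pi> d z)\<close> increases with \<open>d\<close>, so one finite moment at a fixed
  index controls the moments at all larger dimensions, and the unprojected one as well. The
  dimensions may stay bounded, so \<open>\<pi> (d n)\<close> need not approach the identity;
  residuals of \<open>u\<close>, \<open>Q\<close> and the data are small only because of the assumed
  rates. The rate for the data is quadratic: \<open>n\<close> times the mean squared residual tends
  to 0. A weighted AM-GM inequality against the inverse square moment turns it into
  \<open>sqrt n\<close> times the mean relative residual, the quantity by which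
  \<open>sgn (\<pi> z)\<close> and \<open>sgn z\<close> differ. The gradient equation, seen outside
  of the subspace, then gives the rate for \<open>Q\<close>. Consistency of the sample quantile is
  not proved beforehand: convexity localizes the minimizer directly. The Gaussian limit is
  constructed from white noise by a Cholesky factorization of its covariance.\<close>

definition coord_proj :: "(nat \<Rightarrow> 'a::real_inner) \<Rightarrow> nat \<Rightarrow> 'a \<Rightarrow> 'a" where
  "coord_proj \<phi> d z = (\<Sum>k<d. (z \<bullet> \<phi> k) *\<^sub>R \<phi> k)"

lemma bounded_linear_coord_proj: "bounded_linear (coord_proj \<phi> d)"
  unfolding coord_proj_def by (intro bounded_linear_intros)

lemma coord_proj_measurable [measurable]:
  fixes \<phi> :: "nat \<Rightarrow> 'a::{real_inner, second_countable_topology}"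
  shows "coord_proj \<phi> d \<in> borel_measurable borel"
  by (intro borel_measurable_continuous_onI linear_continuous_on bounded_linear_coord_proj)

locale onb =
  fixes \<phi> :: "nat \<Rightarrow> 'a::real_inner"
  assumes onb: "orthonormal_basis \<phi>"
begin

abbreviation "\<pi> \<equiv> coord_proj \<phi>"

lemma inner_basis: "\<phi> i \<bullet> \<phi> j = (if i = j then 1 else 0)"
  using onb by (simp add: orthonormal_basis_def)

lemma norm_basis [simp]: "norm (\<phi> i) = 1"
  by (simp add: norm_eq_sqrt_inner inner_basis)

lemmas proj_linear_simps =
  linear_diff[OF bounded_linear.linear[OF bounded_linear_coord_proj]]
  linear_add[OF bounded_linear.linear[OF bounded_linear_coord_proj]]
  linear_scale[OF bounded_linear.linear[OF bounded_linear_coord_proj]]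
  linear_0[OF bounded_linear.linear[OF bounded_linear_coord_proj]]

lemma proj_inner_basis: "\<pi> d z \<bullet> \<phi> j = (if j < d then z \<bullet> \<phi> j else 0)"
  by (simp add: coord_proj_def inner_sum_left inner_basis if_distrib sum.delta cong: if_cong)

lemma proj_self_adjoint: "\<pi> d x \<bullet> y = x \<bullet> \<pi> d y"
  by (simp add: coord_proj_def inner_sum_left inner_sum_right inner_commute mult.commute)

lemma proj_idem [simp]: "\<pi> d (\<pi> d z) = \<pi> d z"
  by (simp add: coord_proj_def[of \<phi> d "\<pi> d z"] proj_inner_basis) (simp add: coord_proj_def)

lemma proj_in_span: "\<pi> d z \<in> basis_span \<phi> d"
  unfolding coord_proj_def basis_span_def
  by (intro span_sum span_scale span_base) auto

lemma proj_of_span: "s \<in> basis_span \<phi> d \<Longrightarrow> \<pi> d s = s"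
  unfolding basis_span_def
proof (induction rule: span_induct_alt)
  case base
  show ?case by (simp add: proj_linear_simps)
next
  case (step c x y)
  then obtain k where "x = \<phi> k" "k < d" by auto
  then have "\<pi> d x = x"
    by (simp add: coord_proj_def inner_basis if_distrib if_distribR sum.delta cong: if_cong)
  with step show ?case by (simp add: proj_linear_simps)
qed

lemma subspace_basis_span: "subspace (basis_span \<phi> d)"
  unfolding basis_span_def by (rule subspace_span)

lemma proj_residual_orthogonal: "s \<in> basis_span \<phi> d \<Longrightarrow> (z - \<pi> d z) \<bullet> s = 0"
  by (metis proj_of_span proj_self_adjoint inner_diff_left proj_idem diff_self)

lemma inner_proj_span: "s \<in> basis_span \<phi> d \<Longrightarrow> \<pi> d z \<bullet> s = z \<bullet> s"
  using proj_residual_orthogonal[of s d z] by (simp add: inner_diff_left)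

text \<open>\<open>orth_proj\<close> is a definite description; on a coordinate subspace it is a
  finite sum, whose linearity and measurability are evident. Everything below is argued with the
  sum.\<close>

lemma orth_proj_basis_span: "orth_proj (basis_span \<phi> d) z = \<pi> d z"
  unfolding orth_proj_def
proof (rule the_equality)
  show "\<pi> d z \<in> basis_span \<phi> d \<and> (\<forall>s\<in>basis_span \<phi> d. orthogonal (z - \<pi> d z) s)"
    by (simp add: proj_in_span orthogonal_def proj_residual_orthogonal)
next
  fix y assume y: "y \<in> basis_span \<phi> d \<and> (\<forall>s\<in>basis_span \<phi> d. orthogonal (z - y) s)"
  have s: "y - \<pi> d z \<in> basis_span \<phi> d"
    using y proj_in_span subspace_basis_span subspace_diff by blast
  have "(z - \<pi> d z) \<bullet> (y - \<pi> d z) = 0" using s by (rule proj_residual_orthogonal)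
  moreover have "(z - y) \<bullet> (y - \<pi> d z) = 0" using y s by (auto simp: orthogonal_def)
  ultimately have "(y - \<pi> d z) \<bullet> (y - \<pi> d z) = 0" by (simp add: inner_diff_left)
  then show "y = \<pi> d z" by simp
qed

lemma norm_proj_Pythagoras: "(norm z)\<^sup>2 = (norm (\<pi> d z))\<^sup>2 + (norm (z - \<pi> d z))\<^sup>2"
proof -
  have "\<pi> d z \<bullet> (z - \<pi> d z) = 0"
    by (metis proj_residual_orthogonal proj_in_span inner_commute)
  then show ?thesis
    by (simp add: power2_norm_eq_inner inner_diff_left inner_diff_right inner_commute)
qed

lemma norm_proj_le: "norm (\<pi> d z) \<le> norm z"
  using norm_proj_Pythagoras[of z d] by (metis norm_ge_zero le_add_same_cancel1 power2_le_imp_le zero_le_power2)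

lemma norm_residual_le: "norm (z - \<pi> d z) \<le> norm z"
  using norm_proj_Pythagoras[of z d] by (metis norm_ge_zero le_add_same_cancel2 power2_le_imp_le zero_le_power2)

lemma norm_residual_le_dist:
  assumes "s \<in> basis_span \<phi> d" shows "norm (z - \<pi> d z) \<le> norm (z - s)"
proof -
  have "z - \<pi> d z = (z - s) - \<pi> d (z - s)" using assms by (simp add: proj_linear_simps proj_of_span)
  then show ?thesis by (metis norm_residual_le)
qed

lemma norm_proj_sum: "(norm (\<pi> d z))\<^sup>2 = (\<Sum>k<d. (z \<bullet> \<phi> k)\<^sup>2)"
proof -
  have "(norm (\<pi> d z))\<^sup>2 = z \<bullet> \<pi> d z"
    unfolding power2_norm_eq_inner by (metis proj_self_adjoint proj_idem)
  also have "\<dots> = (\<Sum>k<d. (z \<bullet> \<phi> k)\<^sup>2)"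
    by (simp add: coord_proj_def inner_sum_right power2_eq_square)
  finally show ?thesis .
qed

lemma basis_span_mono: "d \<le> d' \<Longrightarrow> basis_span \<phi> d \<subseteq> basis_span \<phi> d'"
  unfolding basis_span_def by (intro span_mono image_mono) auto

lemma proj_proj_le: "d \<le> d' \<Longrightarrow> \<pi> d (\<pi> d' z) = \<pi> d z"
  unfolding coord_proj_def[of \<phi> d] by (intro sum.cong) (auto simp: proj_inner_basis)

lemma norm_proj_mono: "d \<le> d' \<Longrightarrow> norm (\<pi> d z) \<le> norm (\<pi> d' z)"
  by (metis norm_proj_le proj_proj_le)

text \<open>The projection is the best approximation from its subspace, and each vector of the dense
  span already lies in some \<open>basis_span \<phi> D\<close>, hence in all later ones.\<close>

lemma proj_tendsto: "(\<lambda>d. \<pi> d z) \<longlonglongrightarrow> z"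
proof (rule LIMSEQ_I)
  fix r :: real assume r: "0 < r"
  have "z \<in> closure (span (range \<phi>))" using onb by (simp add: orthonormal_basis_def)
  then obtain y where y: "y \<in> span (range \<phi>)" "dist y z < r"
    using r by (auto simp: closure_approachable)
  obtain D where D: "y \<in> basis_span \<phi> D"
  proof -
    have "\<exists>D. y \<in> basis_span \<phi> D" using y(1)
    proof (induction rule: span_induct_alt)
      case base then show ?case by (auto simp: basis_span_def span_zero)
    next
      case (step c x y)
      then obtain k D where k: "x = \<phi> k" "y \<in> basis_span \<phi> D" by auto
      have "x \<in> basis_span \<phi> (max D (Suc k))" unfolding basis_span_def k by (rule span_base) auto
      moreover have "y \<in> basis_span \<phi> (max D (Suc k))" using k(2) basis_span_mono[of D "max D (Suc k)"] by auto
      ultimately show ?case using subspace_basis_span by (metis subspace_add subspace_scale)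
    qed
    then show ?thesis using that by blast
  qed
  show "\<exists>no. \<forall>n\<ge>no. norm (\<pi> n z - z) < r"
  proof (intro exI allI impI)
    fix n assume "n \<ge> D"
    then have "y \<in> basis_span \<phi> n" using D basis_span_mono by blast
    then have "norm (z - \<pi> n z) \<le> norm (z - y)" by (rule norm_residual_le_dist)
    then show "norm (\<pi> n z - z) < r" using y(2) by (simp add: dist_norm norm_minus_commute)
  qed
qed

lemma Parseval: "(\<lambda>k. (z \<bullet> \<phi> k)\<^sup>2) sums (norm z)\<^sup>2"
proof -
  have "(\<lambda>d. (norm (\<pi> d z))\<^sup>2) \<longlonglongrightarrow> (norm z)\<^sup>2"
    by (intro tendsto_intros proj_tendsto)
  then show ?thesis by (simp add: sums_def norm_proj_sum)
qed

lemma residual_sums: "(\<lambda>k. (z \<bullet> \<phi> (d + k))\<^sup>2) sums (norm (z - \<pi> d z))\<^sup>2"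
proof -
  have "(\<lambda>k. (z \<bullet> \<phi> (k + d))\<^sup>2) sums ((norm z)\<^sup>2 - (\<Sum>k<d. (z \<bullet> \<phi> k)\<^sup>2))"
    by (rule sums_split_initial_segment[OF Parseval])
  then show ?thesis using norm_proj_Pythagoras[of z d] by (simp add: norm_proj_sum add.commute)
qed

end

section \<open>The norm to second order\<close>

text \<open>With \<open>L = a + p\<close> the first order value,
  \<open>(N - L) * (N + L) = b\<^sup>2 - p\<^sup>2\<close> holds exactly, so \<open>N - L\<close> is
  \<open>w / (N + L)\<close> and only this denominator is compared with \<open>2 * a\<close>. Once
  \<open>k\<close> is longer than half of \<open>z\<close>, both terms are separately below the
  cubic bound; that case costs a factor 8, rounded up to 9.\<close>

lemma norm_second_order:
  fixes z k :: "'a::real_inner"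
  assumes z: "z \<noteq> 0"
  shows "\<bar>norm (z + k) - norm z - sgn z \<bullet> k - ((norm k)\<^sup>2 - (sgn z \<bullet> k)\<^sup>2) / (2 * norm z)\<bar>
    \<le> 9 * norm k ^ 3 / (norm z)\<^sup>2"
proof -
  define a b N p where "a = norm z" and "b = norm k" and "N = norm (z + k)" and "p = sgn z \<bullet> k"
  define L w where "L = a + p" and "w = b\<^sup>2 - p\<^sup>2"
  have a: "a > 0" using z by (simp add: a_def)
  have b: "b \<ge> 0" by (simp add: b_def)
  have pb: "\<bar>p\<bar> \<le> b"
    using Cauchy_Schwarz_ineq2[of "sgn z" k] z by (simp add: p_def b_def norm_sgn)
  have zk: "z \<bullet> k = a * p" using z by (simp add: a_def p_def sgn_div_norm)
  have N2: "N\<^sup>2 = a\<^sup>2 + 2 * (a * p) + b\<^sup>2"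
    unfolding N_def a_def b_def
    using zk by (simp add: power2_norm_eq_inner inner_add_left inner_add_right inner_commute a_def)
  have w0: "0 \<le> w" "w \<le> b\<^sup>2" using pb by (auto simp: w_def abs_le_square_iff[symmetric])
  have NL: "(N - L) * (N + L) = w" using N2 by (simp add: L_def w_def power2_eq_square algebra_simps)
  have N0: "N \<ge> 0" by (simp add: N_def)
  have NaB: "\<bar>N - a\<bar> \<le> b" unfolding N_def a_def b_def using norm_triangle_ineq3[of "z + k" z] by simp
  have LaB: "\<bar>L - a\<bar> \<le> b" using pb by (simp add: L_def)
  have main: "\<bar>(N - L) - w / (2 * a)\<bar> \<le> 9 * b ^ 3 / a\<^sup>2"
  proof (cases "b \<le> a / 2")
    case True
    have S: "N + L \<ge> a" "N + L > 0" using True NaB LaB a by linarith+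
    have "N - L = w / (N + L)" using NL S by (simp add: field_simps)
    moreover have "w / (N + L) - w / (2 * a) = w * (2 * a - (N + L)) / ((N + L) * (2 * a))"
      by (subst diff_frac_eq) (use S a in \<open>auto simp: right_diff_distrib\<close>)
    ultimately have "(N - L) - w / (2 * a) = w * (2 * a - (N + L)) / ((N + L) * (2 * a))" by simp
    then have "\<bar>(N - L) - w / (2 * a)\<bar> = w * \<bar>2 * a - (N + L)\<bar> / ((N + L) * (2 * a))"
      using S a w0 by (simp add: abs_mult)
    also have "\<dots> \<le> b\<^sup>2 * (2 * b) / (a * (2 * a))"
      using S a w0 b NaB LaB by (intro frac_le mult_mono) auto
    also have "\<dots> = b ^ 3 / a\<^sup>2" using a by (simp add: power2_eq_square power3_eq_cube)
    also have "\<dots> \<le> 9 * b ^ 3 / a\<^sup>2" using b by (intro divide_right_mono) auto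
    finally show ?thesis .
  next
    case False
    then have ab: "a \<le> 2 * b" by simp
    have bp: "b > 0" using False a by linarith
    have a2: "a\<^sup>2 \<le> 4 * b\<^sup>2" using power_mono[OF ab, of 2] a by simp
    \<comment> \<open>\<open>N - L\<close> and \<open>w / (2 * a)\<close> are both nonnegative, so
      their difference is at most the larger of the two.\<close>
    have NL0: "N - L \<ge> 0"
    proof (rule ccontr)
      assume "\<not> ?thesis"
      then have "N < L" by simp
      then have "N\<^sup>2 < L\<^sup>2" using N0 by (simp add: power_strict_mono)
      then show False using NL w0 by (simp add: power2_eq_square algebra_simps)
    qed
    have 1: "N - L \<le> 2 * b" using NaB LaB by linarith
    have 2: "2 * b \<le> 9 * b ^ 3 / a\<^sup>2"
    proof -
      have "2 * b * a\<^sup>2 \<le> 2 * b * (4 * b\<^sup>2)" using a2 b by (intro mult_left_mono) auto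
      also have "\<dots> \<le> 9 * b ^ 3" using b by (simp add: power2_eq_square power3_eq_cube)
      finally show ?thesis using a by (simp add: field_simps)
    qed
    have 3: "w / (2 * a) \<le> 9 * b ^ 3 / a\<^sup>2"
    proof -
      have "w / (2 * a) \<le> b\<^sup>2 / (2 * a)" using w0 a by (intro divide_right_mono) auto
      also have "\<dots> = (b\<^sup>2 * a / 2) / a\<^sup>2" using a by (simp add: power2_eq_square)
      also have "\<dots> \<le> (9 * b ^ 3) / a\<^sup>2"
      proof (rule divide_right_mono)
        have "b\<^sup>2 * a / 2 \<le> b\<^sup>2 * (2 * b) / 2" using ab by (intro divide_right_mono mult_left_mono) auto
        also have "\<dots> \<le> 9 * b ^ 3" using b by (simp add: power2_eq_square power3_eq_cube)
        finally show "b\<^sup>2 * a / 2 \<le> 9 * b ^ 3" .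
      qed simp
      finally show ?thesis .
    qed
    have "w / (2 * a) \<ge> 0" using w0 a by simp
    then show ?thesis using NL0 1 2 3 by linarith
  qed
  show ?thesis using main by (simp add: L_def w_def a_def b_def N_def p_def algebra_simps)
qed

section \<open>Coercive operators and quadratic minimization\<close>

text \<open>Lax-Milgram through Banach's fixed point theorem: solutions of \<open>T x = y\<close>
  are the fixed points of \<open>x - \<tau> (T x - y)\<close>. Injectivity and the bound on the
  inverse both come from \<open>\<kappa> * norm h \<le> norm (T h)\<close>.\<close>

lemma coercive_bij:
  fixes T :: "'a::{real_inner, banach} \<Rightarrow> 'a"
  assumes T: "bounded_linear T" and \<kappa>: "\<kappa> > 0" and co: "\<And>h. \<kappa> * (norm h)\<^sup>2 \<le> T h \<bullet> h"
  shows "bij T" and "bounded_linear (inv T)"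
proof -
  interpret T: bounded_linear T by fact
  obtain K where K: "K > 0" "\<And>h. norm (T h) \<le> norm h * K" using T.pos_bounded by blast
  have low: "\<kappa> * norm h \<le> norm (T h)" for h
  proof (cases "h = 0")
    case False
    have "\<kappa> * (norm h)\<^sup>2 \<le> norm (T h) * norm h" using co[of h] norm_cauchy_schwarz[of "T h" h] by linarith
    then show ?thesis using False by (simp add: power2_eq_square)
  qed (simp add: T.zero)
  have inj: "inj T"
  proof (rule injI)
    fix x y assume "T x = T y"
    then have "T (x - y) = 0" by (simp add: T.diff)
    then have "\<kappa> * norm (x - y) \<le> 0" using low[of "x - y"] by simp
    then show "x = y" using \<kappa> by (simp add: mult_le_0_iff)
  qed
  have surj: "surj T"
  proof -
    have "\<exists>x. y = T x" for y
    proof -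
      \<comment> \<open>This value minimizes
        \<open>1 - 2 \<tau> \<kappa> + \<tau>\<^sup>2 K\<^sup>2\<close>, the bound on the squared
        contraction factor; the minimum is \<open>1 - \<tau> \<kappa>\<close>.\<close>
      define \<tau> where "\<tau> = \<kappa> / K\<^sup>2"
      have \<tau>: "\<tau> > 0" using \<kappa> K by (simp add: \<tau>_def)
      define q where "q = 1 - \<tau> * \<kappa>"
      have contr: "(norm (h - \<tau> *\<^sub>R T h))\<^sup>2 \<le> q * (norm h)\<^sup>2" for h
      proof -
        have "(norm (h - \<tau> *\<^sub>R T h))\<^sup>2 = (norm h)\<^sup>2 - 2 * \<tau> * (T h \<bullet> h) + \<tau>\<^sup>2 * (norm (T h))\<^sup>2"
          unfolding power2_norm_eq_inner
          by (simp add: inner_diff_left inner_diff_right inner_commute power2_eq_square)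
        also have "\<dots> \<le> (norm h)\<^sup>2 - 2 * \<tau> * (\<kappa> * (norm h)\<^sup>2) + \<tau>\<^sup>2 * (norm h * K)\<^sup>2"
          using co[of h] K(2)[of h] \<tau> by (intro add_mono diff_left_mono mult_left_mono power_mono) auto
        also have "\<dots> = q * (norm h)\<^sup>2"
          using K(1) by (simp add: q_def \<tau>_def power2_eq_square field_simps)
        finally show ?thesis .
      qed
      have q1: "q < 1" using \<tau> \<kappa> by (simp add: q_def)
      \<comment> \<open>In the zero space \<open>q\<close> may be negative, so the contraction
        constant is the root of \<open>max q 0\<close>.\<close>
      have nonneg: "max q 0 \<ge> 0" "max q 0 < 1" using q1 by auto
      define F where "F x = x - \<tau> *\<^sub>R (T x - y)" for x
      have "\<exists>!x. F x = x"
      proof (rule banach_fix_type[of "sqrt (max q 0)"])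
        show "0 \<le> sqrt (max q 0)" by simp
        show "sqrt (max q 0) < 1" using nonneg by (simp del: max.absorb1 max.absorb2)
        show "\<forall>x z. dist (F x) (F z) \<le> sqrt (max q 0) * dist x z"
        proof (intro allI)
          fix x z
          have "F x - F z = (x - z) - \<tau> *\<^sub>R T (x - z)" by (simp add: F_def T.diff algebra_simps)
          then have "(norm (F x - F z))\<^sup>2 \<le> q * (norm (x - z))\<^sup>2" using contr by simp
          also have "\<dots> \<le> max q 0 * (norm (x - z))\<^sup>2" by (intro mult_right_mono) auto
          finally have "sqrt ((norm (F x - F z))\<^sup>2) \<le> sqrt (max q 0 * (norm (x - z))\<^sup>2)"
            by (rule real_sqrt_le_mono)
          then show "dist (F x) (F z) \<le> sqrt (max q 0) * dist x z"
            by (simp add: dist_norm real_sqrt_mult)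
        qed
      qed
      then obtain x where "F x = x" by blast
      then have "T x = y" using \<tau> by (simp add: F_def)
      then show ?thesis by blast
    qed
    then show ?thesis by (simp add: surj_def)
  qed
  show bij: "bij T" using inj surj by (rule bijI)
  have TI: "T (inv T x) = x" for x using surj by (rule surj_f_inv_f)
  show "bounded_linear (inv T)"
  proof (rule bounded_linear_intro[where K = "1 / \<kappa>"])
    fix x y :: 'a and r :: real
    show "inv T (x + y) = inv T x + inv T y"
      by (rule injD[OF inj]) (simp add: T.add TI)
    show "inv T (r *\<^sub>R x) = r *\<^sub>R inv T x"
      by (rule injD[OF inj]) (simp add: T.scaleR TI)
    show "norm (inv T x) \<le> norm x * (1 / \<kappa>)"
      using low[of "inv T x"] \<kappa> by (simp add: TI field_simps)
  qed
qed

text \<open>Otherwise compare both functions at the point where the segment from \<open>p\<close> to the minimizer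
  leaves the ball of radius \<open>\<delta>\<close>.\<close>

lemma convex_argmin_close:
  fixes T :: "'a::real_inner \<Rightarrow> 'a" and A :: "'a \<Rightarrow> real"
  assumes T: "bounded_linear T" and sym: "\<And>h v. T h \<bullet> v = h \<bullet> T v"
    and co: "\<And>h. \<kappa> * (norm h)\<^sup>2 \<le> T h \<bullet> h" and bd: "\<And>h. T h \<bullet> h \<le> K * (norm h)\<^sup>2"
    and S: "subspace S" and conv: "convex_on S A"
    and min: "\<And>h. h \<in> S \<Longrightarrow> A \<Delta> \<le> A h" and \<Delta>: "\<Delta> \<in> S" and p: "p \<in> S"
    and close: "\<And>h. h \<in> S \<Longrightarrow> norm (h - p) \<le> \<delta> \<Longrightarrow> \<bar>A h - (T h \<bullet> h / 2 - T hs \<bullet> h)\<bar> \<le> \<eta>"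
    and \<delta>: "0 < \<delta>" and \<epsilon>: "norm (p - hs) \<le> \<epsilon>" "\<epsilon> \<le> \<delta>" and \<kappa>: "\<kappa> > 0" and K: "K \<ge> 0"
    and small: "K * \<epsilon>\<^sup>2 + 4 * \<eta> < \<kappa> * (\<delta> - \<epsilon>)\<^sup>2"
  shows "norm (\<Delta> - p) \<le> \<delta>"
proof (rule ccontr)
  assume "\<not> norm (\<Delta> - p) \<le> \<delta>"
  then have far: "norm (\<Delta> - p) > \<delta>" by simp
  then have pos: "norm (\<Delta> - p) > 0" using \<delta> by linarith
  interpret T: bounded_linear T by fact
  define s where "s = \<delta> / norm (\<Delta> - p)"
  have s: "0 < s" "s < 1" using far pos \<delta> by (auto simp: s_def simp del: zero_less_norm_iff)
  define h where "h = (1 - s) *\<^sub>R p + s *\<^sub>R \<Delta>"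
  have h: "h \<in> S" unfolding h_def using S p \<Delta> by (intro subspace_add subspace_scale)
  have hp: "h - p = s *\<^sub>R (\<Delta> - p)" by (simp add: h_def algebra_simps)
  have nh: "norm (h - p) = \<delta>" unfolding hp using pos \<delta> by (simp add: s_def)
  have "A h \<le> (1 - s) * A p + s * A \<Delta>"
    unfolding h_def using conv s p \<Delta> by (intro convex_onD) auto
  also have "\<dots> \<le> (1 - s) * A p + s * A p" using min[OF p] s by (intro add_left_mono mult_left_mono) auto
  finally have Ahp: "A h \<le> A p" by (simp add: algebra_simps)
  define q where "q h = T h \<bullet> h / 2 - T hs \<bullet> h" for h
  \<comment> \<open>Completing the square by symmetry: the quadratic is centred at
    \<open>hs\<close>, so its values at \<open>p\<close> and on the sphere around \<open>p\<close>
    are compared through distances to \<open>hs\<close>.\<close>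
  have q: "q h = T (h - hs) \<bullet> (h - hs) / 2 - T hs \<bullet> hs / 2" for h
    using sym[of h hs] by (simp add: q_def T.diff inner_diff_left inner_diff_right inner_commute field_simps)
  have "q h \<le> q p + 2 * \<eta>" using close[OF h] close[OF p] nh \<delta> Ahp unfolding q_def by auto
  then have "T (h - hs) \<bullet> (h - hs) \<le> T (p - hs) \<bullet> (p - hs) + 4 * \<eta>" by (simp add: q)
  then have 1: "\<kappa> * (norm (h - hs))\<^sup>2 \<le> K * (norm (p - hs))\<^sup>2 + 4 * \<eta>"
    using co[of "h - hs"] bd[of "p - hs"] by linarith
  have "\<delta> - \<epsilon> \<le> norm (h - hs)"
    using norm_triangle_ineq[of "h - hs" "hs - p"] nh \<epsilon> by (simp add: norm_minus_commute)
  then have "\<kappa> * (\<delta> - \<epsilon>)\<^sup>2 \<le> \<kappa> * (norm (h - hs))\<^sup>2" using \<epsilon> \<kappa> by (intro mult_left_mono power_mono) auto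
  also have "\<dots> \<le> K * \<epsilon>\<^sup>2 + 4 * \<eta>" using 1 \<epsilon> K mult_left_mono[OF power_mono[OF \<epsilon>(1), of 2], of K] by auto
  finally show False using small by simp
qed

section \<open>Existence of minimizers\<close>

text \<open>The points of nearly minimal norm in the nested sublevel sets form a Cauchy sequence by the
  parallelogram law, which replaces a weak compactness argument.\<close>

lemma convex_coercive_attains_min:
  fixes f :: "'a::{real_inner, banach} \<Rightarrow> real"
  assumes conv: "convex_on UNIV f" and cont: "continuous_on UNIV f"
    and c: "c > 0" and coercive: "\<And>x. c * norm x - b \<le> f x"
  shows "\<exists>x. \<forall>y. f x \<le> f y"
proof -
  have bb: "bdd_below (range f)"
  proof (rule bdd_belowI)
    fix y assume "y \<in> range f"
    then obtain x where "y = f x" by auto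
    then show "- b \<le> y" using coercive[of x] mult_nonneg_nonneg[of c "norm x"] c norm_ge_zero[of x]
      by linarith
  qed
  define I where "I = Inf (range f)"
  have I: "I \<le> f x" for x unfolding I_def using bb by (intro cInf_lower) auto
  define t where "t n = 1 / real (Suc n)" for n
  have t: "t n > 0" for n by (simp add: t_def)
  have t_mono: "t m \<le> t n" if "n \<le> m" for m n using that by (simp add: t_def frac_le)
  have t0: "t \<longlonglongrightarrow> 0" unfolding t_def by (rule LIMSEQ_Suc[OF lim_1_over_n])
  define C where "C n = {x. f x \<le> I + t n}" for n
  have C_ne: "C n \<noteq> {}" for n
  proof -
    have "\<exists>y\<in>range f. y < I + t n" using t[of n] bb unfolding I_def by (subst cInf_less_iff[symmetric]) auto
    then obtain x where "f x < I + t n" by blast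
    then have "x \<in> C n" by (simp add: C_def)
    then show ?thesis by blast
  qed
  have C_mono: "C m \<subseteq> C n" if "n \<le> m" for m n using t_mono[OF that] by (auto simp: C_def)
  define \<rho> where "\<rho> n = Inf (norm ` C n)" for n
  have bbn: "bdd_below (norm ` C n)" for n by (rule bdd_belowI[of _ 0]) auto
  have \<rho>_le: "\<rho> n \<le> norm x" if "x \<in> C n" for n x unfolding \<rho>_def using that bbn by (intro cInf_lower) auto
  have \<rho>0: "0 \<le> \<rho> n" for n unfolding \<rho>_def using C_ne by (intro cInf_greatest) auto
  have "\<exists>x\<in>C n. norm x < \<rho> n + t n" for n
  proof -
    have "\<exists>y\<in>norm ` C n. y < \<rho> n + t n"
      using t[of n] bbn[of n] C_ne[of n] unfolding \<rho>_def by (subst cInf_less_iff[symmetric]) auto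
    then show ?thesis by auto
  qed
  then obtain x where x: "\<And>n. x n \<in> C n" "\<And>n. norm (x n) < \<rho> n + t n" by metis
  have \<rho>_mono: "incseq \<rho>"
    unfolding incseq_def \<rho>_def using C_mono C_ne bbn by (auto intro!: cInf_superset_mono)
  \<comment> \<open>Coercivity bounds the sublevel sets, so the increasing radii
    \<open>\<rho> n\<close> have a limit \<open>R\<close>.\<close>
  have \<rho>_bd: "\<rho> n \<le> (I + 1 + b) / c" for n
  proof -
    have "c * norm (x n) - b \<le> I + t n" using coercive[of "x n"] x(1)[of n] by (auto simp: C_def)
    moreover have "t n \<le> 1" by (simp add: t_def)
    ultimately have "norm (x n) \<le> (I + 1 + b) / c" using c by (simp add: field_simps)
    then show ?thesis using \<rho>_le[OF x(1)] order_trans by blast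
  qed
  obtain R where R: "\<rho> \<longlonglongrightarrow> R" "\<And>n. \<rho> n \<le> R"
    using incseq_convergent[OF \<rho>_mono] \<rho>_bd by (metis LIMSEQ_le_const2 incseq_le)
  \<comment> \<open>In the parallelogram law the endpoints have norm at most \<open>R + t n\<close>,
    while the midpoint stays in the convex set \<open>C n\<close> and so has norm at least
    \<open>\<rho> n\<close>.\<close>
  define e where "e n = 4 * ((R + t n)\<^sup>2 - (\<rho> n)\<^sup>2)" for n
  have e0: "e \<longlonglongrightarrow> 0"
  proof -
    have "e \<longlonglongrightarrow> 4 * ((R + 0)\<^sup>2 - R\<^sup>2)" unfolding e_def by (intro tendsto_intros t0 R)
    then show ?thesis by simp
  qed
  have close: "(norm (x m - x n))\<^sup>2 \<le> e n" if "n \<le> m" for m n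
  proof -
    let ?mid = "(1 / 2) *\<^sub>R x m + (1 / 2) *\<^sub>R x n"
    have "x m \<in> C n" using x(1) C_mono[OF that] by blast
    then have "f (x m) \<le> I + t n" "f (x n) \<le> I + t n" using x(1)[of n] by (auto simp: C_def)
    moreover have "f ((1 - 1/2) *\<^sub>R x m + (1 / 2) *\<^sub>R x n) \<le> (1 - 1 / 2) * f (x m) + (1 / 2) * f (x n)"
      by (intro convex_onD[OF conv]) auto
    ultimately have "?mid \<in> C n" by (simp add: C_def)
    then have mid: "(\<rho> n)\<^sup>2 \<le> (norm ?mid)\<^sup>2" using \<rho>_le \<rho>0 by (intro power_mono) auto
    have par: "(norm (x m - x n))\<^sup>2 = 2 * (norm (x m))\<^sup>2 + 2 * (norm (x n))\<^sup>2 - 4 * (norm ?mid)\<^sup>2"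
      unfolding power2_norm_eq_inner
      by (simp add: inner_add_left inner_add_right inner_diff_left inner_diff_right inner_commute field_simps)
    have "norm (x m) \<le> R + t n" "norm (x n) \<le> R + t n"
      using x(2)[of m] x(2)[of n] R(2)[of m] R(2)[of n] t_mono[OF that] by linarith+
    then have "(norm (x m))\<^sup>2 \<le> (R + t n)\<^sup>2" "(norm (x n))\<^sup>2 \<le> (R + t n)\<^sup>2" by (auto intro!: power_mono)
    moreover have "p \<le> 4 * (X - Y)" if "p = 2 * q + 2 * r - 4 * s" "q \<le> X" "r \<le> X" "Y \<le> s"
      for p q r s X Y :: real using that by (simp add: algebra_simps)
    ultimately show ?thesis using par mid unfolding e_def by blast
  qed
  have "Cauchy x"
  proof (rule CauchyI)
    fix \<epsilon> :: real assume \<epsilon>: "0 < \<epsilon>"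
    then have "eventually (\<lambda>n. e n < (\<epsilon> / 2)\<^sup>2) sequentially" by (intro order_tendstoD(2)[OF e0]) auto
    then obtain N where N: "e N < (\<epsilon> / 2)\<^sup>2" unfolding eventually_sequentially by blast
    have half: "norm (x m - x N) < \<epsilon> / 2" if "m \<ge> N" for m
      using close[OF that] N \<epsilon> by (intro power2_less_imp_less[of "norm (x m - x N)"]) auto
    have "norm (x m - x n) < \<epsilon>" if "m \<ge> N" "n \<ge> N" for m n
      using half[OF that(1)] half[OF that(2)] norm_triangle_ineq4[of "x m - x N" "x n - x N"] by simp
    then show "\<exists>M. \<forall>m\<ge>M. \<forall>n\<ge>M. norm (x m - x n) < \<epsilon>" by blast
  qed
  then obtain z where z: "x \<longlonglongrightarrow> z" by (meson Cauchy_convergent_iff convergent_def)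
  have "(\<lambda>n. f (x n)) \<longlonglongrightarrow> f z" by (rule continuous_on_tendsto_compose[OF cont z]) auto
  moreover have "(\<lambda>n. I + t n) \<longlonglongrightarrow> I + 0" by (intro tendsto_intros t0)
  moreover have "f (x n) \<le> I + t n" for n using x(1)[of n] by (simp add: C_def)
  ultimately have "f z \<le> I" by (auto intro: LIMSEQ_le)
  then show ?thesis using I order_trans by blast
qed

section \<open>The population objective\<close>

lemma borel_measurable_sgn_vector [measurable (raw)]:
  fixes f :: "'b \<Rightarrow> 'a::{real_normed_vector, second_countable_topology}"
  assumes [measurable]: "f \<in> borel_measurable M"
  shows "(\<lambda>x. sgn (f x)) \<in> borel_measurable M"
  unfolding sgn_div_norm by measurable

lemma norm_sgn_le: "norm (sgn (x::'a::real_normed_vector)) \<le> 1"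
  by (simp add: norm_sgn)

text \<open>The left-hand side is the squared distance from \<open>V\<close> to the line of
  \<open>U\<close>. It is at most the squared distance to \<open>(b * a) *\<^sub>R U\<close>, the
  point reached by projecting \<open>V\<close> to the line of \<open>h\<close> and the result to the
  line of \<open>U\<close>. The two legs have squared lengths \<open>1 - b\<^sup>2\<close> and
  \<open>b\<^sup>2 * (1 - a\<^sup>2)\<close>.\<close>

lemma one_minus_inner_sq_le:
  fixes U V h :: "'a::real_inner"
  assumes "norm U = 1" "norm V = 1" "norm h = 1"
  shows "1 - (U \<bullet> V)\<^sup>2 \<le> 2 * (1 - (U \<bullet> h)\<^sup>2) + 2 * (1 - (V \<bullet> h)\<^sup>2)"
proof -
  define a b c where "a = U \<bullet> h" and "b = V \<bullet> h" and "c = U \<bullet> V"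
  have n: "U \<bullet> U = 1" "V \<bullet> V = 1" "h \<bullet> h = 1"
    using assms by (simp_all add: norm_eq_1)
  have b1: "b\<^sup>2 \<le> 1"
    using Cauchy_Schwarz_ineq[of V h] n by (simp add: b_def)
  have a1: "a\<^sup>2 \<le> 1"
    using Cauchy_Schwarz_ineq[of U h] n by (simp add: a_def)
  have "0 \<le> (c - b * a)\<^sup>2" by simp
  then have "1 - c\<^sup>2 \<le> (norm (V - (b * a) *\<^sub>R U))\<^sup>2"
    unfolding power2_norm_eq_inner using n
    by (simp add: inner_diff_left inner_diff_right inner_commute c_def power2_eq_square algebra_simps)
  also have "V - (b * a) *\<^sub>R U = b *\<^sub>R (h - a *\<^sub>R U) + (V - b *\<^sub>R h)"
    by (simp add: algebra_simps)
  also have "(norm (b *\<^sub>R (h - a *\<^sub>R U) + (V - b *\<^sub>R h)))\<^sup>2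
      \<le> 2 * (norm (b *\<^sub>R (h - a *\<^sub>R U)))\<^sup>2 + 2 * (norm (V - b *\<^sub>R h))\<^sup>2"
  proof -
    have "0 \<le> (norm (b *\<^sub>R (h - a *\<^sub>R U) - (V - b *\<^sub>R h)))\<^sup>2" by simp
    then show ?thesis unfolding power2_norm_eq_inner
      by (simp add: inner_add_left inner_add_right inner_diff_left inner_diff_right inner_commute)
  qed
  also have "(norm (b *\<^sub>R (h - a *\<^sub>R U)))\<^sup>2 = b\<^sup>2 * (1 - a\<^sup>2)"
    unfolding power2_norm_eq_inner using n
    by (simp add: inner_diff_left inner_diff_right inner_commute a_def power2_eq_square algebra_simps)
  also have "(norm (V - b *\<^sub>R h))\<^sup>2 = 1 - b\<^sup>2"
    unfolding power2_norm_eq_inner using n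
    by (simp add: inner_diff_left inner_diff_right inner_commute b_def power2_eq_square algebra_simps)
  also have "2 * (b\<^sup>2 * (1 - a\<^sup>2)) + 2 * (1 - b\<^sup>2) \<le> 2 * (1 - a\<^sup>2) + 2 * (1 - b\<^sup>2)"
    using mult_right_mono[OF b1, of "1 - a\<^sup>2"] a1 by simp
  finally show ?thesis by (simp add: a_def b_def c_def)
qed

text \<open>\<open>integrable_inv_sq\<close> is what makes the cubic Taylor error integrable. Its
  integrand is 0 at \<open>x = Q\<close> by the convention for division; \<open>nonatomic\<close>
  makes that point negligible.\<close>

locale spatial = prob_space \<mu> for \<mu> :: "'a::{real_inner, banach, second_countable_topology} measure" +
  assumes sets_mu [measurable_cong, simp]: "sets \<mu> = sets borel"
    and integrable_norm_mu: "integrable \<mu> norm"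
    and nonatomic: "\<And>x. emeasure \<mu> {x} = 0"
    and not_line: "\<not> (\<exists>x y. AE z in \<mu>. z \<in> line_through x y)"
    and integrable_inv_sq: "\<And>Q. integrable \<mu> (\<lambda>x. 1 / (norm (Q - x))\<^sup>2)"
begin

lemma space_mu [simp]: "space \<mu> = UNIV"
  using sets_eq_imp_space_eq[OF sets_mu] by simp

lemma AE_neq: "AE x in \<mu>. x \<noteq> Q"
  using nonatomic by (intro AE_I[of _ _ "{Q}"]) auto

lemma integrable_inv: "integrable \<mu> (\<lambda>x. 1 / norm (Q - x))"
  by (rule square_integrable_imp_integrable) (use integrable_inv_sq[of Q] in \<open>auto simp: power_divide\<close>)

section \<open>The averaged curvature of the norm and its coercivity\<close>

definition inv_moment :: "'a \<Rightarrow> real" where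
  "inv_moment Q = (\<integral>x. 1 / norm (Q - x) \<partial>\<mu>)"

text \<open>The second derivative of the norm at \<open>Q - x\<close>: projection onto the
  orthogonal complement of \<open>sgn (Q - x)\<close>, divided by the distance. At
  \<open>x = Q\<close> it is 0 by the convention for division.\<close>

definition curv :: "'a \<Rightarrow> 'a \<Rightarrow> 'a \<Rightarrow> 'a" where
  "curv Q x h = (1 / norm (Q - x)) *\<^sub>R (h - (sgn (Q - x) \<bullet> h) *\<^sub>R sgn (Q - x))"

definition hess :: "'a \<Rightarrow> 'a \<Rightarrow> 'a" where
  "hess Q h = (\<integral>x. curv Q x h \<partial>\<mu>)"

lemma curv_measurable [measurable]: "(\<lambda>x. curv Q x h) \<in> borel_measurable borel"
  unfolding curv_def by measurable

lemma curv_inner: "curv Q x h \<bullet> v = (h \<bullet> v - (sgn (Q - x) \<bullet> h) * (sgn (Q - x) \<bullet> v)) / norm (Q - x)"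
  by (simp add: curv_def inner_diff_left)

lemma curv_inner_self: "curv Q x h \<bullet> h = ((norm h)\<^sup>2 - (sgn (Q - x) \<bullet> h)\<^sup>2) / norm (Q - x)"
  unfolding curv_inner power2_norm_eq_inner by (simp add: power2_eq_square)

lemma curv_nonneg: "0 \<le> curv Q x h \<bullet> h"
proof -
  have "(sgn (Q - x) \<bullet> h)\<^sup>2 \<le> (norm (sgn (Q - x)) * norm h)\<^sup>2"
    by (metis Cauchy_Schwarz_ineq2 abs_ge_zero power2_abs power_mono)
  also have "\<dots> \<le> (norm h)\<^sup>2"
    by (simp add: norm_sgn)
  finally show ?thesis by (simp add: curv_inner_self)
qed

lemma curv_inner_self_le: "curv Q x h \<bullet> h \<le> (norm h)\<^sup>2 / norm (Q - x)"
  unfolding curv_inner_self by (intro divide_right_mono) auto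

lemma norm_curv_le: "norm (curv Q x h) \<le> norm h / norm (Q - x)"
proof -
  let ?U = "sgn (Q - x)"
  have "(norm (h - (?U \<bullet> h) *\<^sub>R ?U))\<^sup>2 \<le> (norm h)\<^sup>2"
  proof (cases "Q = x")
    case False
    then have "?U \<bullet> ?U = 1" by (simp add: norm_sgn flip: norm_eq_1)
    then have "(norm (h - (?U \<bullet> h) *\<^sub>R ?U))\<^sup>2 = (norm h)\<^sup>2 - (?U \<bullet> h)\<^sup>2"
      unfolding power2_norm_eq_inner
      by (simp add: inner_diff_left inner_diff_right inner_commute power2_eq_square)
    then show ?thesis by simp
  qed simp
  then have "norm (h - (?U \<bullet> h) *\<^sub>R ?U) \<le> norm h" by (simp add: abs_le_square_iff[symmetric])
  then show ?thesis by (simp add: curv_def divide_right_mono)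
qed

lemma integrable_curv: "integrable \<mu> (\<lambda>x. curv Q x h)"
proof (rule Bochner_Integration.integrable_bound)
  show "integrable \<mu> (\<lambda>x. norm h * (1 / norm (Q - x)))" by (intro integrable_mult_right integrable_inv)
  show "AE x in \<mu>. norm (curv Q x h) \<le> norm (norm h * (1 / norm (Q - x)))"
    using norm_curv_le[of Q _ h] by auto
qed measurable

lemma hess_inner: "hess Q h \<bullet> v = (\<integral>x. curv Q x h \<bullet> v \<partial>\<mu>)"
  unfolding hess_def by (rule integral_inner_left[symmetric]) (rule integrable_curv)

lemma curv_linear: "curv Q x (a + b) = curv Q x a + curv Q x b" "curv Q x (c *\<^sub>R a) = c *\<^sub>R curv Q x a"
  by (simp_all add: curv_def inner_add_right algebra_simps)

lemma bounded_linear_hess: "bounded_linear (hess Q)"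
proof (rule bounded_linear_intro[where K = "inv_moment Q"])
  fix x y r
  show "hess Q (x + y) = hess Q x + hess Q y"
    unfolding hess_def curv_linear by (intro Bochner_Integration.integral_add integrable_curv)
  show "hess Q (r *\<^sub>R x) = r *\<^sub>R hess Q x"
    unfolding hess_def curv_linear by simp
  have "norm (hess Q x) \<le> (\<integral>y. norm (curv Q y x) \<partial>\<mu>)" unfolding hess_def by (rule integral_norm_bound)
  also have "\<dots> \<le> (\<integral>y. norm x * (1 / norm (Q - y)) \<partial>\<mu>)"
    using norm_curv_le[of Q _ x]
    by (intro integral_mono integrable_norm integrable_curv integrable_mult_right integrable_inv) auto
  also have "\<dots> = norm x * inv_moment Q" unfolding inv_moment_def by (subst integral_mult_right_zero) simp
  finally show "norm (hess Q x) \<le> norm x * inv_moment Q" .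
qed

lemma hess_sym: "hess Q h \<bullet> v = h \<bullet> hess Q v"
proof -
  have "h \<bullet> hess Q v = hess Q v \<bullet> h" by (rule inner_commute)
  also have "\<dots> = hess Q h \<bullet> v" unfolding hess_inner curv_inner by (simp add: inner_commute mult.commute)
  finally show ?thesis by simp
qed

lemma hess_le: "hess Q h \<bullet> h \<le> inv_moment Q * (norm h)\<^sup>2"
proof -
  have "hess Q h \<bullet> h \<le> (\<integral>x. (norm h)\<^sup>2 * (1 / norm (Q - x)) \<partial>\<mu>)"
    unfolding hess_inner using curv_inner_self_le[of Q _ h]
    by (intro integral_mono integrable_mult_right integrable_inv integrable_inner_left integrable_curv) auto
  then show ?thesis unfolding integral_mult_right_zero inv_moment_def[symmetric] by (simp add: mult.commute)
qed

lemma inv_moment_pos: "0 < inv_moment Q"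
proof -
  have "0 \<le> inv_moment Q" unfolding inv_moment_def by (intro Bochner_Integration.integral_nonneg) auto
  moreover have "inv_moment Q \<noteq> 0"
  proof
    assume "inv_moment Q = 0"
    then have "AE x in \<mu>. 1 / norm (Q - x) = 0"
      unfolding inv_moment_def by (subst (asm) integral_nonneg_eq_0_iff_AE[OF integrable_inv]) auto
    with AE_neq[of Q] have "AE x in \<mu>. False" by eventually_elim auto
    then show False by simp
  qed
  ultimately show ?thesis by simp
qed

text \<open>The squared sine of the angle at \<open>Q\<close> between two independent observations, weighted by the
  inverse distances; its mean is positive because \<open>\<mu>\<close> does not sit on a line through \<open>Q\<close>.\<close>

definition angle_weight :: "'a \<Rightarrow> 'a \<Rightarrow> 'a \<Rightarrow> real" where
  "angle_weight Q x y = (1 - (sgn (Q - x) \<bullet> sgn (Q - y))\<^sup>2) / (norm (Q - x) * norm (Q - y))"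

lemma angle_weight_bounds: "0 \<le> angle_weight Q x y" "angle_weight Q x y \<le> 1 / norm (Q - x) * (1 / norm (Q - y))"
proof -
  have "(sgn (Q - x) \<bullet> sgn (Q - y))\<^sup>2 \<le> (norm (sgn (Q - x)) * norm (sgn (Q - y)))\<^sup>2"
    by (metis Cauchy_Schwarz_ineq2 abs_ge_zero power2_abs power_mono)
  also have "\<dots> \<le> 1" by (simp add: norm_sgn)
  finally show "0 \<le> angle_weight Q x y" by (simp add: angle_weight_def)
  show "angle_weight Q x y \<le> 1 / norm (Q - x) * (1 / norm (Q - y))"
    unfolding angle_weight_def times_divide_times_eq by (intro divide_right_mono) auto
qed

lemma angle_weight_measurable [measurable]:
  "(\<lambda>(x, y). angle_weight Q x y) \<in> borel_measurable (\<mu> \<Otimes>\<^sub>M \<mu>)"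
  unfolding angle_weight_def by measurable

lemma integrable_angle_weight: "integrable \<mu> (angle_weight Q x)"
proof (rule Bochner_Integration.integrable_bound)
  show "integrable \<mu> (\<lambda>y. 1 / norm (Q - x) * (1 / norm (Q - y)))"
    by (intro integrable_mult_right integrable_inv)
  show "angle_weight Q x \<in> borel_measurable \<mu>" unfolding angle_weight_def by measurable
  show "AE y in \<mu>. norm (angle_weight Q x y) \<le> norm (1 / norm (Q - x) * (1 / norm (Q - y)))"
    using angle_weight_bounds[of Q x] by (intro AE_I2) simp
qed

lemma integrable_integral_angle_weight: "integrable \<mu> (\<lambda>x. \<integral>y. angle_weight Q x y \<partial>\<mu>)"
proof (rule Bochner_Integration.integrable_bound)
  show "integrable \<mu> (\<lambda>x. inv_moment Q * (1 / norm (Q - x)))" by (intro integrable_mult_right integrable_inv)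
  show "AE x in \<mu>. norm (\<integral>y. angle_weight Q x y \<partial>\<mu>) \<le> norm (inv_moment Q * (1 / norm (Q - x)))"
  proof (intro AE_I2)
    fix x
    have "(\<integral>y. angle_weight Q x y \<partial>\<mu>) \<le> (\<integral>y. 1 / norm (Q - x) * (1 / norm (Q - y)) \<partial>\<mu>)"
      by (intro integral_mono integrable_angle_weight integrable_mult_right integrable_inv angle_weight_bounds)
    also have "\<dots> = inv_moment Q * (1 / norm (Q - x))"
      unfolding integral_mult_right_zero inv_moment_def by (rule mult.commute)
    finally show "norm (\<integral>y. angle_weight Q x y \<partial>\<mu>) \<le> norm (inv_moment Q * (1 / norm (Q - x)))"
      using inv_moment_pos[of Q] angle_weight_bounds(1)[of Q x] by (simp add: Bochner_Integration.integral_nonneg)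
  qed
qed measurable

text \<open>A vanishing mean would give some \<open>x\<close> for which the weight vanishes at
  almost every \<open>y\<close>. This is the equality case of Cauchy-Schwarz, so
  \<open>Q - y\<close> is a multiple of \<open>Q - x\<close> and \<open>\<mu>\<close> sits on the
  line through \<open>Q\<close> and \<open>x\<close>.\<close>

lemma angle_weight_mean_pos: "0 < (\<integral>x. \<integral>y. angle_weight Q x y \<partial>\<mu> \<partial>\<mu>)"
proof -
  have nn: "0 \<le> (\<integral>y. angle_weight Q x y \<partial>\<mu>)" for x by (intro Bochner_Integration.integral_nonneg angle_weight_bounds)
  moreover have "(\<integral>x. \<integral>y. angle_weight Q x y \<partial>\<mu> \<partial>\<mu>) \<noteq> 0"
  proof
    assume "(\<integral>x. \<integral>y. angle_weight Q x y \<partial>\<mu> \<partial>\<mu>) = 0"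
    then have "AE x in \<mu>. (\<integral>y. angle_weight Q x y \<partial>\<mu>) = 0"
      using nn by (subst (asm) integral_nonneg_eq_0_iff_AE[OF integrable_integral_angle_weight]) auto
    \<comment> \<open>A set of full measure contains a point other than \<open>Q\<close>; this
      single point fixes the line.\<close>
    have "\<exists>x. x \<noteq> Q \<and> (\<integral>y. angle_weight Q x y \<partial>\<mu>) = 0"
    proof (rule ccontr)
      assume none: "\<not> ?thesis"
      from AE_neq[of Q] \<open>AE x in \<mu>. (\<integral>y. angle_weight Q x y \<partial>\<mu>) = 0\<close> have "AE x in \<mu>. False"
        by eventually_elim (use none in auto)
      then show False by simp
    qed
    then obtain x where x: "x \<noteq> Q" "(\<integral>y. angle_weight Q x y \<partial>\<mu>) = 0" by blast
    then have "AE y in \<mu>. angle_weight Q x y = 0"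
      using angle_weight_bounds by (subst (asm) integral_nonneg_eq_0_iff_AE[OF integrable_angle_weight]) auto
    with AE_neq[of Q] have "AE y in \<mu>. y \<in> line_through Q x"
    proof eventually_elim
      case (elim y)
      let ?U = "sgn (Q - x)" and ?V = "sgn (Q - y)"
      have n: "norm ?U = 1" "norm ?V = 1" using x elim by (auto simp: norm_sgn)
      have "(?U \<bullet> ?V)\<^sup>2 = 1" using elim x by (simp add: angle_weight_def)
      then have "\<bar>?U \<bullet> ?V\<bar> = norm ?U * norm ?V" using n by (auto simp: power2_eq_1_iff)
      then have "norm ?U *\<^sub>R ?V = norm ?V *\<^sub>R ?U \<or> norm ?U *\<^sub>R ?V = - norm ?V *\<^sub>R ?U"
        by (simp only: norm_cauchy_schwarz_abs_eq)
      then obtain s where s: "?V = s *\<^sub>R ?U" using n by (metis scaleR_one scaleR_minus1_left)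
      have "Q - y = norm (Q - y) *\<^sub>R ?V" using elim by (simp add: sgn_div_norm)
      also have "\<dots> = (norm (Q - y) * s) *\<^sub>R ?U" by (simp only: s scaleR_scaleR)
      also have "?U = (1 / norm (Q - x)) *\<^sub>R (Q - x)" by (simp only: sgn_div_norm inverse_eq_divide)
      finally have "Q - y = (norm (Q - y) * s * (1 / norm (Q - x))) *\<^sub>R (Q - x)" by (simp only: scaleR_scaleR)
      then obtain c where "Q - y = c *\<^sub>R (Q - x)" by blast
      then have "y = (1 - c) *\<^sub>R Q + (1 - (1 - c)) *\<^sub>R x" by (simp add: algebra_simps)
      then show ?case unfolding line_through_def by blast
    qed
    then show False using not_line by blast
  qed
  moreover have "0 \<le> (\<integral>x. \<integral>y. angle_weight Q x y \<partial>\<mu> \<partial>\<mu>)"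
    by (intro Bochner_Integration.integral_nonneg nn)
  ultimately show ?thesis by linarith
qed

text \<open>Dividing \<open>one_minus_inner_sq_le\<close> by both distances gives products of a
  function of \<open>x\<close> and a function of \<open>y\<close>, so the double integral of the
  bound factorizes. If \<open>x\<close> or \<open>y\<close> equals \<open>Q\<close>, the weight is
  0.\<close>

lemma angle_weight_le:
  assumes "norm h = 1"
  shows "angle_weight Q x y \<le> 2 * (curv Q x h \<bullet> h) * (1 / norm (Q - y)) + 2 * (1 / norm (Q - x)) * (curv Q y h \<bullet> h)"
proof (cases "x = Q \<or> y = Q")
  case False
  then have "1 - (sgn (Q - x) \<bullet> sgn (Q - y))\<^sup>2
      \<le> 2 * (1 - (sgn (Q - x) \<bullet> h)\<^sup>2) + 2 * (1 - (sgn (Q - y) \<bullet> h)\<^sup>2)"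
    using assms by (intro one_minus_inner_sq_le) (auto simp: norm_sgn)
  then have "angle_weight Q x y \<le> (2 * (1 - (sgn (Q - x) \<bullet> h)\<^sup>2) + 2 * (1 - (sgn (Q - y) \<bullet> h)\<^sup>2)) / (norm (Q - x) * norm (Q - y))"
    unfolding angle_weight_def by (intro divide_right_mono) auto
  also have "\<dots> = 2 * (curv Q x h \<bullet> h) * (1 / norm (Q - y)) + 2 * (1 / norm (Q - x)) * (curv Q y h \<bullet> h)"
  proof -
    have frac: "(2 * p + 2 * q) / (r * s) = 2 * (p / r) * (1 / s) + 2 * (1 / r) * (q / s)"
      for p q r s :: real by (simp add: add_divide_distrib)
    from frac[of "1 - (sgn (Q - x) \<bullet> h)\<^sup>2" "1 - (sgn (Q - y) \<bullet> h)\<^sup>2"]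
    show ?thesis unfolding curv_inner_self assms power_one .
  qed
  finally show ?thesis .
next
  case True
  then have "angle_weight Q x y = 0" by (auto simp: angle_weight_def)
  also have "0 \<le> 2 * (curv Q x h \<bullet> h) * (1 / norm (Q - y)) + 2 * (1 / norm (Q - x)) * (curv Q y h \<bullet> h)"
    by (intro add_nonneg_nonneg mult_nonneg_nonneg curv_nonneg) auto
  finally show ?thesis .
qed

text \<open>In the integral of the bound from \<open>angle_weight_le\<close> each of the two
  products contributes \<open>2 * inv_moment Q * (hess Q h \<bullet> h)\<close>, whence the
  4.\<close>

definition coerc :: "'a \<Rightarrow> real" where
  "coerc Q = (\<integral>x. \<integral>y. angle_weight Q x y \<partial>\<mu> \<partial>\<mu>) / (4 * inv_moment Q)"

lemma coerc_pos: "0 < coerc Q"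
  unfolding coerc_def using angle_weight_mean_pos inv_moment_pos by simp

lemma hess_coercive_unit:
  assumes "norm h = 1"
  shows "coerc Q \<le> hess Q h \<bullet> h"
proof -
  let ?J = "hess Q h \<bullet> h" and ?\<zeta> = "inv_moment Q"
  have inti: "integrable \<mu> (\<lambda>x. curv Q x h \<bullet> h)" by (intro integrable_inner_left integrable_curv)
  have "(\<integral>y. angle_weight Q x y \<partial>\<mu>) \<le> 2 * (curv Q x h \<bullet> h) * ?\<zeta> + 2 * (1 / norm (Q - x)) * ?J" for x
  proof -
    have "(\<integral>y. angle_weight Q x y \<partial>\<mu>)
       \<le> (\<integral>y. 2 * (curv Q x h \<bullet> h) * (1 / norm (Q - y)) + 2 * (1 / norm (Q - x)) * (curv Q y h \<bullet> h) \<partial>\<mu>)"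
      by (intro integral_mono integrable_angle_weight Bochner_Integration.integrable_add integrable_mult_right
          integrable_inv inti angle_weight_le assms)
    also have "\<dots> = (\<integral>y. 2 * (curv Q x h \<bullet> h) * (1 / norm (Q - y)) \<partial>\<mu>) + (\<integral>y. 2 * (1 / norm (Q - x)) * (curv Q y h \<bullet> h) \<partial>\<mu>)"
      by (intro Bochner_Integration.integral_add integrable_mult_right integrable_inv inti)
    also have "\<dots> = 2 * (curv Q x h \<bullet> h) * ?\<zeta> + 2 * (1 / norm (Q - x)) * ?J"
      unfolding integral_mult_right_zero hess_inner inv_moment_def ..
    finally show ?thesis .
  qed
  then have "(\<integral>x. \<integral>y. angle_weight Q x y \<partial>\<mu> \<partial>\<mu>) \<le> (\<integral>x. 2 * ?\<zeta> * (curv Q x h \<bullet> h) + 2 * ?J * (1 / norm (Q - x)) \<partial>\<mu>)"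
    by (intro integral_mono integrable_integral_angle_weight Bochner_Integration.integrable_add integrable_mult_right
        integrable_inv inti) (simp add: mult_ac)
  also have "\<dots> = (\<integral>x. 2 * ?\<zeta> * (curv Q x h \<bullet> h) \<partial>\<mu>) + (\<integral>x. 2 * ?J * (1 / norm (Q - x)) \<partial>\<mu>)"
    by (intro Bochner_Integration.integral_add integrable_mult_right integrable_inv inti)
  also have "\<dots> = 4 * ?\<zeta> * ?J"
    unfolding integral_mult_right_zero hess_inner inv_moment_def by simp
  finally show ?thesis using inv_moment_pos[of Q] by (simp add: coerc_def field_simps)
qed

lemma hess_coercive: "coerc Q * (norm h)\<^sup>2 \<le> hess Q h \<bullet> h"
proof (cases "h = 0")
  case False
  interpret bounded_linear "hess Q" by (rule bounded_linear_hess)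
  have "coerc Q \<le> hess Q (sgn h) \<bullet> sgn h" by (rule hess_coercive_unit) (use False in \<open>simp add: norm_sgn\<close>)
  also have "\<dots> = (hess Q h \<bullet> h) / (norm h)\<^sup>2"
    by (simp add: sgn_div_norm scaleR power2_eq_square divide_inverse mult_ac)
  finally show ?thesis using False by (simp add: field_simps)
qed (simp add: bounded_linear.linear[OF bounded_linear_hess, THEN linear_0])

lemmas bij_hess = coercive_bij(1)[OF bounded_linear_hess coerc_pos hess_coercive]
lemmas bounded_linear_inv_hess = coercive_bij(2)[OF bounded_linear_hess coerc_pos hess_coercive]

section \<open>Taylor expansion of the population objective\<close>

definition inv_sq_moment :: "'a \<Rightarrow> real" where
  "inv_sq_moment Q = (\<integral>x. 1 / (norm (Q - x))\<^sup>2 \<partial>\<mu>)"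

lemma integrable_sgn: "integrable \<mu> (\<lambda>x. sgn (Q - x) - u)"
  by (rule integrable_const_bound[of _ "1 + norm u"])
     (auto intro!: norm_triangle_le_diff simp: norm_sgn)

lemma integrable_dist_diff: "integrable \<mu> (\<lambda>x. norm (Q - x) - norm x)"
proof (rule integrable_const_bound[of _ "norm Q"])
  show "AE x in \<mu>. norm (norm (Q - x) - norm x) \<le> norm Q"
  proof (intro AE_I2)
    fix x show "norm (norm (Q - x) - norm x) \<le> norm Q"
      using norm_triangle_ineq3[of "x - Q" x] by (simp add: norm_minus_commute)
  qed
qed measurable

lemma spatial_objective_diff:
  "spatial_objective \<mu> u R - spatial_objective \<mu> u Q = (\<integral>x. norm (R - x) - norm (Q - x) \<partial>\<mu>) - u \<bullet> (R - Q)"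
proof -
  have "(\<integral>x. norm (R - x) - norm (Q - x) \<partial>\<mu>) = (\<integral>x. (norm (R - x) - norm x) - (norm (Q - x) - norm x) \<partial>\<mu>)"
    by simp
  also have "\<dots> = (\<integral>x. norm (R - x) - norm x \<partial>\<mu>) - (\<integral>x. norm (Q - x) - norm x \<partial>\<mu>)"
    by (intro Bochner_Integration.integral_diff integrable_dist_diff)
  finally show ?thesis by (simp add: spatial_objective_def inner_diff_right)
qed

text \<open>\<open>norm_second_order\<close> is integrated at \<open>z = Q - x\<close>, which is
  nonzero almost everywhere. The single cubic bound serves three purposes: the Hessian limit, the
  vanishing gradient and uniqueness.\<close>

lemma spatial_objective_Taylor:
  "\<bar>spatial_objective \<mu> u (Q + h) - spatial_objective \<mu> u Q - (\<integral>x. sgn (Q - x) - u \<partial>\<mu>) \<bullet> h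
      - (hess Q h \<bullet> h) / 2\<bar> \<le> 9 * norm h ^ 3 * inv_sq_moment Q"
proof -
  \<comment> \<open>The terms with \<open>u\<close> cancel; they are kept apart so that the integral
    of \<open>sgn (Q - x) - u\<close> appears.\<close>
  define F where "F x = (norm (Q + h - x) - norm (Q - x)) - (sgn (Q - x) - u) \<bullet> h - u \<bullet> h - (curv Q x h \<bullet> h) / 2" for x
  have i1: "integrable \<mu> (\<lambda>x. norm (Q + h - x) - norm (Q - x))"
    using Bochner_Integration.integrable_diff[OF integrable_dist_diff[of "Q + h"] integrable_dist_diff[of Q]] by simp
  have i2: "integrable \<mu> (\<lambda>x. (sgn (Q - x) - u) \<bullet> h)" by (intro integrable_inner_left integrable_sgn)
  have i3: "integrable \<mu> (\<lambda>x. (curv Q x h \<bullet> h) / 2)" by (intro integrable_divide integrable_inner_left integrable_curv)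
  have iF: "integrable \<mu> F" unfolding F_def
    by (intro Bochner_Integration.integrable_diff i1 i2 i3) simp
  have "(\<integral>x. F x \<partial>\<mu>) = (\<integral>x. norm (Q + h - x) - norm (Q - x) \<partial>\<mu>) - (\<integral>x. (sgn (Q - x) - u) \<bullet> h \<partial>\<mu>)
      - u \<bullet> h - (\<integral>x. (curv Q x h \<bullet> h) / 2 \<partial>\<mu>)"
    unfolding F_def by (simp add: i1 i2 i3 prob_space[simplified])
  also have "\<dots> = spatial_objective \<mu> u (Q + h) - spatial_objective \<mu> u Q - (\<integral>x. sgn (Q - x) - u \<partial>\<mu>) \<bullet> h
      - (hess Q h \<bullet> h) / 2"
    by (simp add: spatial_objective_diff hess_inner integral_inner_left[OF integrable_sgn])
  finally have "spatial_objective \<mu> u (Q + h) - spatial_objective \<mu> u Q - (\<integral>x. sgn (Q - x) - u \<partial>\<mu>) \<bullet> h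
      - (hess Q h \<bullet> h) / 2 = (\<integral>x. F x \<partial>\<mu>)" by simp
  also have "\<bar>\<dots>\<bar> \<le> (\<integral>x. \<bar>F x\<bar> \<partial>\<mu>)" using integral_norm_bound[of \<mu> F] by simp
  also have "\<dots> \<le> (\<integral>x. 9 * norm h ^ 3 * (1 / (norm (Q - x))\<^sup>2) \<partial>\<mu>)"
  proof (rule integral_mono_AE)
    show "AE x in \<mu>. \<bar>F x\<bar> \<le> 9 * norm h ^ 3 * (1 / (norm (Q - x))\<^sup>2)"
      using AE_neq[of Q]
    proof eventually_elim
      case (elim x)
      then show ?case using norm_second_order[of "Q - x" h]
        by (simp add: F_def curv_inner_self inner_diff_left algebra_simps)
    qed
    show "integrable \<mu> (\<lambda>x. 9 * norm h ^ 3 * (1 / (norm (Q - x))\<^sup>2))"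
      by (intro integrable_mult_right integrable_inv_sq)
  qed (use iF in auto)
  also have "\<dots> = 9 * norm h ^ 3 * inv_sq_moment Q" unfolding inv_sq_moment_def by (rule integral_mult_right_zero)
  finally show ?thesis .
qed

lemma hessian_form: "is_spatial_hessian \<mu> u Q (\<lambda>h v. hess Q h \<bullet> v)"
  unfolding is_spatial_hessian_def
proof (intro conjI allI)
  show "bounded_bilinear (\<lambda>h v. hess Q h \<bullet> v)"
    using bounded_bilinear.comp1[OF bounded_bilinear_inner bounded_linear_hess] .
  show "hess Q h \<bullet> v = hess Q v \<bullet> h" for h v using hess_sym[of Q h v] by (simp add: inner_commute)
  fix h :: 'a
  let ?B = "9 * norm h ^ 3 * inv_sq_moment Q"
  let ?E = "\<lambda>t. \<bar>spatial_objective \<mu> u (Q + t *\<^sub>R h) - spatial_objective \<mu> u Q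
      - t * ((\<integral>x. sgn (Q - x) - u \<partial>\<mu>) \<bullet> h) - t\<^sup>2 / 2 * (hess Q h \<bullet> h)\<bar> / t\<^sup>2"
  have bd: "?E t \<le> ?B * \<bar>t\<bar>" if "t \<noteq> 0" for t
  proof -
    interpret bounded_linear "hess Q" by (rule bounded_linear_hess)
    have "?E t \<le> (9 * norm (t *\<^sub>R h) ^ 3 * inv_sq_moment Q) / t\<^sup>2"
      using spatial_objective_Taylor[of u Q "t *\<^sub>R h"]
      by (intro divide_right_mono) (auto simp: scaleR power2_eq_square mult_ac)
    also have "\<dots> = ?B * (\<bar>t\<bar> ^ 3 / \<bar>t\<bar>\<^sup>2)" by (simp add: power_mult_distrib mult_ac)
    also have "\<bar>t\<bar> ^ 3 / \<bar>t\<bar>\<^sup>2 = \<bar>t\<bar>" using that by (simp add: power3_eq_cube power2_eq_square)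
    finally show ?thesis .
  qed
  show "(?E \<longlongrightarrow> 0) (at 0)"
  proof (rule tendsto_sandwich[OF _ _ tendsto_const])
    show "eventually (\<lambda>t. 0 \<le> ?E t) (at 0)" by (intro always_eventually) auto
    show "eventually (\<lambda>t. ?E t \<le> ?B * \<bar>t\<bar>) (at 0)"
      using bd by (auto simp: eventually_at intro!: exI[of _ 1])
    have "((\<lambda>t. ?B * \<bar>t\<bar>) \<longlongrightarrow> ?B * \<bar>0\<bar>) (at 0)" by (intro tendsto_intros)
    then show "((\<lambda>t. ?B * \<bar>t\<bar>) \<longlongrightarrow> 0) (at 0)" by simp
  qed
qed

section \<open>Existence, stationarity and uniqueness of the population quantile\<close>

lemma convex_spatial_objective: "convex_on UNIV (spatial_objective \<mu> u)"
proof (rule convex_onI)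
  fix t :: real and x y :: 'a assume t: "0 < t" "t < 1"
  have "(\<integral>z. norm ((1 - t) *\<^sub>R x + t *\<^sub>R y - z) - norm z \<partial>\<mu>)
      \<le> (\<integral>z. (1 - t) * (norm (x - z) - norm z) + t * (norm (y - z) - norm z) \<partial>\<mu>)"
  proof (intro integral_mono Bochner_Integration.integrable_add integrable_mult_right integrable_dist_diff)
    fix z
    have "(1 - t) *\<^sub>R x + t *\<^sub>R y - z = (1 - t) *\<^sub>R (x - z) + t *\<^sub>R (y - z)" by (simp add: algebra_simps)
    then have "norm ((1 - t) *\<^sub>R x + t *\<^sub>R y - z) \<le> (1 - t) * norm (x - z) + t * norm (y - z)"
      using t norm_triangle_ineq[of "(1 - t) *\<^sub>R (x - z)" "t *\<^sub>R (y - z)"] by simp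
    then show "norm ((1 - t) *\<^sub>R x + t *\<^sub>R y - z) - norm z
        \<le> (1 - t) * (norm (x - z) - norm z) + t * (norm (y - z) - norm z)" by (simp add: algebra_simps)
  qed
  also have "\<dots> = (1 - t) * (\<integral>z. norm (x - z) - norm z \<partial>\<mu>) + t * (\<integral>z. norm (y - z) - norm z \<partial>\<mu>)"
    by (subst Bochner_Integration.integral_add) (auto intro!: integrable_mult_right integrable_dist_diff
        simp del: Bochner_Integration.integral_diff)
  finally show "spatial_objective \<mu> u ((1 - t) *\<^sub>R x + t *\<^sub>R y)
      \<le> (1 - t) * spatial_objective \<mu> u x + t * spatial_objective \<mu> u y"
    by (simp add: spatial_objective_def inner_add_right algebra_simps)
qed simp

lemma spatial_objective_Lipschitz:
  "\<bar>spatial_objective \<mu> u R - spatial_objective \<mu> u Q\<bar> \<le> (1 + norm u) * norm (R - Q)"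
proof -
  have "\<bar>\<integral>x. norm (R - x) - norm (Q - x) \<partial>\<mu>\<bar> \<le> (\<integral>x. norm (R - Q) \<partial>\<mu>)"
  proof -
    have "integrable \<mu> (\<lambda>x. norm (R - x) - norm (Q - x))"
      using Bochner_Integration.integrable_diff[OF integrable_dist_diff[of R] integrable_dist_diff[of Q]] by simp
    moreover have "\<bar>norm (R - x) - norm (Q - x)\<bar> \<le> norm (R - Q)" for x
      using norm_triangle_ineq3[of "R - x" "Q - x"] by simp
    ultimately have "(\<integral>x. \<bar>norm (R - x) - norm (Q - x)\<bar> \<partial>\<mu>) \<le> (\<integral>x. norm (R - Q) \<partial>\<mu>)"
      by (intro integral_mono) auto
    then show ?thesis
      by (rule order_trans[OF integral_norm_bound[of \<mu> "\<lambda>x. norm (R - x) - norm (Q - x)", unfolded real_norm_def]])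
  qed
  then have "\<bar>\<integral>x. norm (R - x) - norm (Q - x) \<partial>\<mu>\<bar> \<le> norm (R - Q)" by (simp add: prob_space[simplified])
  moreover have "\<bar>u \<bullet> (R - Q)\<bar> \<le> norm u * norm (R - Q)" by (rule Cauchy_Schwarz_ineq2)
  ultimately show ?thesis unfolding spatial_objective_diff by (simp add: distrib_right)
qed

text \<open>From \<open>norm (Q - x) - norm x \<ge> norm Q - 2 * norm x\<close> the objective is at
  least \<open>(1 - norm u) * norm Q\<close> minus twice the mean norm, hence coercive.\<close>

lemma spatial_quantile_exists:
  assumes u: "norm u < 1"
  obtains Q where "\<And>R. spatial_objective \<mu> u Q \<le> spatial_objective \<mu> u R"
proof -
  have "\<exists>Q. \<forall>R. spatial_objective \<mu> u Q \<le> spatial_objective \<mu> u R"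
  proof (rule convex_coercive_attains_min[OF convex_spatial_objective])
    show "continuous_on UNIV (spatial_objective \<mu> u)"
    proof (rule lipschitz_on_continuous_on[of "1 + norm u"], rule lipschitz_onI)
      show "dist (spatial_objective \<mu> u x) (spatial_objective \<mu> u y) \<le> (1 + norm u) * dist x y" for x y
        using spatial_objective_Lipschitz by (simp add: dist_norm)
    qed simp
    show "1 - norm u > 0" using u by simp
    fix Q :: 'a
    have "norm Q - 2 * (\<integral>x. norm x \<partial>\<mu>) = (\<integral>x. norm Q - 2 * norm x \<partial>\<mu>)"
      using integrable_norm_mu by (simp add: prob_space[simplified])
    also have "\<dots> \<le> (\<integral>x. norm (Q - x) - norm x \<partial>\<mu>)"
    proof (intro integral_mono integrable_dist_diff)
      show "integrable \<mu> (\<lambda>x. norm Q - 2 * norm x)" using integrable_norm_mu by simp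
      show "norm Q - 2 * norm x \<le> norm (Q - x) - norm x" for x
        using norm_triangle_ineq2[of Q x] by simp
    qed
    finally show "(1 - norm u) * norm Q - 2 * (\<integral>x. norm x \<partial>\<mu>) \<le> spatial_objective \<mu> u Q"
      using norm_cauchy_schwarz[of u Q] by (simp add: spatial_objective_def algebra_simps)
  qed
  then show ?thesis using that by blast
qed

text \<open>A step of \<open>- t\<close> times the gradient would lower the objective to first
  order; minimality leaves only the terms of higher order in \<open>t\<close> to bound the squared
  gradient.\<close>

lemma spatial_quantile_gradient_zero:
  assumes min: "\<And>R. spatial_objective \<mu> u Q \<le> spatial_objective \<mu> u R"
  shows "(\<integral>x. sgn (Q - x) - u \<partial>\<mu>) = 0"
proof -
  let ?G = "\<integral>x. sgn (Q - x) - u \<partial>\<mu>"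
  let ?c = "(hess Q ?G \<bullet> ?G) / 2" and ?B = "9 * norm ?G ^ 3 * inv_sq_moment Q"
  interpret bounded_linear "hess Q" by (rule bounded_linear_hess)
  have le: "?G \<bullet> ?G \<le> t * ?c + t\<^sup>2 * ?B" if t: "t > 0" for t
  proof -
    have "0 \<le> spatial_objective \<mu> u (Q + (- t) *\<^sub>R ?G) - spatial_objective \<mu> u Q" using min by simp
    moreover have "\<bar>spatial_objective \<mu> u (Q + (- t) *\<^sub>R ?G) - spatial_objective \<mu> u Q - ?G \<bullet> ((- t) *\<^sub>R ?G)
        - (hess Q ((- t) *\<^sub>R ?G) \<bullet> ((- t) *\<^sub>R ?G)) / 2\<bar> \<le> 9 * norm ((- t) *\<^sub>R ?G) ^ 3 * inv_sq_moment Q"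
      by (rule spatial_objective_Taylor)
    moreover have "?G \<bullet> ((- t) *\<^sub>R ?G) = - (t * (?G \<bullet> ?G))" by simp
    moreover have "(hess Q ((- t) *\<^sub>R ?G) \<bullet> ((- t) *\<^sub>R ?G)) / 2 = t * (t * ?c)"
      by (simp only: scaleR inner_scaleR_left inner_scaleR_right)
    moreover have "9 * norm ((- t) *\<^sub>R ?G) ^ 3 * inv_sq_moment Q = t * (t\<^sup>2 * ?B)"
      using t by (simp add: power_mult_distrib power3_eq_cube power2_eq_square)
    ultimately have "t * (?G \<bullet> ?G) \<le> t * (t * ?c) + t * (t\<^sup>2 * ?B)" by linarith
    also have "\<dots> = t * (t * ?c + t\<^sup>2 * ?B)" by (simp add: distrib_left)
    finally show ?thesis using t by simp
  qed
  have "((\<lambda>t. t * ?c + t\<^sup>2 * ?B) \<longlongrightarrow> 0 * ?c + 0\<^sup>2 * ?B) (at_right 0)" by (intro tendsto_intros)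
  moreover have "eventually (\<lambda>t. ?G \<bullet> ?G \<le> t * ?c + t\<^sup>2 * ?B) (at_right 0)"
    by (rule eventually_at_rightI[of 0 1]) (use le in auto)
  ultimately have "?G \<bullet> ?G \<le> 0 * ?c + 0\<^sup>2 * ?B" by (rule tendsto_lowerbound) simp
  then have "?G \<bullet> ?G \<le> 0" by simp
  then show ?thesis by (simp add: inner_gt_zero_iff flip: not_less)
qed

text \<open>Convexity keeps the objective minimal along the whole segment between two minimizers,
  whereas the coercive quadratic term beats the cubic error close to \<open>Q\<close>.\<close>

lemma spatial_quantile_unique:
  assumes min: "\<And>R. spatial_objective \<mu> u Q \<le> spatial_objective \<mu> u R"
    and R: "spatial_objective \<mu> u R \<le> spatial_objective \<mu> u Q"
  shows "R = Q"
proof (rule ccontr)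
  assume "R \<noteq> Q"
  define h where "h = R - Q"
  have h: "norm h > 0" using \<open>R \<noteq> Q\<close> by (simp add: h_def)
  let ?c = "coerc Q * (norm h)\<^sup>2 / 2" and ?B = "9 * norm h ^ 3 * inv_sq_moment Q"
  interpret bounded_linear "hess Q" by (rule bounded_linear_hess)
  have le: "?c \<le> t * ?B" if t: "0 < t" "t < 1" for t
  proof -
    have "spatial_objective \<mu> u ((1 - t) *\<^sub>R Q + t *\<^sub>R R) \<le> (1 - t) * spatial_objective \<mu> u Q + t * spatial_objective \<mu> u R"
      by (rule convex_onD[OF convex_spatial_objective]) (use t in auto)
    also have "\<dots> \<le> (1 - t) * spatial_objective \<mu> u Q + t * spatial_objective \<mu> u Q"
      using R t by (intro add_left_mono mult_left_mono) auto
    finally have "spatial_objective \<mu> u (Q + t *\<^sub>R h) \<le> spatial_objective \<mu> u Q"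
      by (simp add: h_def algebra_simps)
    moreover have "\<bar>spatial_objective \<mu> u (Q + t *\<^sub>R h) - spatial_objective \<mu> u Q
        - (hess Q (t *\<^sub>R h) \<bullet> (t *\<^sub>R h)) / 2\<bar> \<le> 9 * norm (t *\<^sub>R h) ^ 3 * inv_sq_moment Q"
      using spatial_objective_Taylor[of u Q "t *\<^sub>R h"] spatial_quantile_gradient_zero[OF min] by simp
    moreover have "(hess Q (t *\<^sub>R h) \<bullet> (t *\<^sub>R h)) / 2 = t\<^sup>2 * ((hess Q h \<bullet> h) / 2)"
      by (simp add: scaleR power2_eq_square)
    moreover have "9 * norm (t *\<^sub>R h) ^ 3 * inv_sq_moment Q = t\<^sup>2 * (t * ?B)"
      using t by (simp add: power_mult_distrib power3_eq_cube power2_eq_square)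
    ultimately have "t\<^sup>2 * ((hess Q h \<bullet> h) / 2) \<le> t\<^sup>2 * (t * ?B)" by linarith
    then have "(hess Q h \<bullet> h) / 2 \<le> t * ?B" using t by simp
    then show ?thesis using hess_coercive[of Q h] by simp
  qed
  have "((\<lambda>t. t * ?B) \<longlongrightarrow> 0 * ?B) (at_right 0)" by (intro tendsto_intros)
  moreover have "eventually (\<lambda>t. ?c \<le> t * ?B) (at_right 0)"
    by (rule eventually_at_rightI[of 0 1]) (use le in auto)
  ultimately have "?c \<le> 0 * ?B" by (rule tendsto_lowerbound) simp
  then have "?c \<le> 0" by simp
  then show False using coerc_pos[of Q] h
    by (metis mult_pos_pos zero_less_power half_gt_zero not_less)
qed

end

section \<open>Criteria for weak convergence\<close>

text \<open>\<open>g k\<close> is the infimal convolution of \<open>f\<close> with \<open>k\<close>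
  times the distance, the largest \<open>k\<close>-Lipschitz function below
  \<open>f\<close>.\<close>

lemma Lipschitz_minorant:
  fixes f :: "'a::metric_space \<Rightarrow> real"
  assumes bd: "\<And>x. 0 \<le> f x" "\<And>x. f x \<le> C" and cont: "continuous_on UNIV f"
  defines "g k x \<equiv> (INF y. f y + real k * dist x y)"
  shows "\<And>k x. 0 \<le> g k x" "\<And>k x. g k x \<le> f x"
    "\<And>k x y. \<bar>g k x - g k y\<bar> \<le> real k * dist x y" "\<And>x. (\<lambda>k. g k x) \<longlonglongrightarrow> f x"
proof -
  have bb: "bdd_below (range (\<lambda>y. f y + real k * dist x y))" for k x
    by (rule bdd_belowI[of _ 0]) (use bd in auto)
  show nn: "0 \<le> g k x" for k x unfolding g_def using bd by (intro cINF_greatest) auto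
  show le: "g k x \<le> f x" for k x unfolding g_def by (rule cINF_lower2[OF bb, of x]) auto
  have half: "g k x \<le> g k y + real k * dist x y" for k x y
  proof -
    have "g k x - real k * dist x y \<le> g k y"
      unfolding g_def[of k y]
    proof (rule cINF_greatest)
      fix z
      have "g k x \<le> f z + real k * dist x z" unfolding g_def by (rule cINF_lower[OF bb]) simp
      moreover have "real k * dist x z \<le> real k * (dist x y + dist y z)"
        by (intro mult_left_mono dist_triangle) simp
      ultimately show "g k x - real k * dist x y \<le> f z + real k * dist y z" by (simp add: distrib_left)
    qed simp
    then show ?thesis by simp
  qed
  show "\<bar>g k x - g k y\<bar> \<le> real k * dist x y" for k x y
    using half[of k x y] half[of k y x] by (simp add: dist_commute abs_le_iff)
  show "(\<lambda>k. g k x) \<longlonglongrightarrow> f x" for x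
  proof (rule LIMSEQ_I)
    fix e :: real assume e: "0 < e"
    have "isCont f x" using cont by (simp add: continuous_on_eq_continuous_at)
    then obtain \<delta> where \<delta>: "\<delta> > 0" "\<And>y. dist y x < \<delta> \<Longrightarrow> dist (f y) (f x) < e / 2"
      unfolding continuous_at_eps_delta using e by (metis half_gt_zero)
    obtain k0 :: nat where k0: "C / \<delta> < real k0" using reals_Archimedean2 by blast
    have "norm (g k x - f x) < e" if k: "k0 \<le> k" for k
    proof -
      have "f x - e / 2 \<le> g k x" unfolding g_def
      proof (rule cINF_greatest)
        fix y
        show "f x - e / 2 \<le> f y + real k * dist x y"
        proof (cases "dist y x < \<delta>")
          case True
          then have "f x - e / 2 \<le> f y" using \<delta>(2)[OF True] by (auto simp: dist_real_def abs_if split: if_splits)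
          moreover have "0 \<le> real k * dist x y" by simp
          ultimately show ?thesis by linarith
        next
          case False
          \<comment> \<open>Points at distance at least \<open>\<delta>\<close> carry a penalty
            above the bound \<open>C\<close> of \<open>f\<close>, so only points where
            \<open>f\<close> is close to \<open>f x\<close> compete.\<close>
          have "C < real k * \<delta>"
          proof -
            have "C / \<delta> < real k" using k0 k by linarith
            then show ?thesis using \<delta>(1) by (simp add: divide_less_eq)
          qed
          also have "\<dots> \<le> real k * dist x y" using False by (intro mult_left_mono) (auto simp: dist_commute)
          finally show ?thesis using bd(1)[of y] bd(2)[of x] e by linarith
        qed
      qed simp
      then show ?thesis using le[of k x] e by simp
    qed
    then show "\<exists>n0. \<forall>n\<ge>n0. norm (g n x - f x) < e" by blast
  qed
qed

lemma integrable_bounded_compose: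
  fixes f :: "'a::topological_space \<Rightarrow> real"
  assumes "prob_space M" and [measurable]: "W \<in> borel_measurable M"
    and cont: "continuous_on UNIV f" and bd: "\<And>x. \<bar>f x\<bar> \<le> B"
  shows "integrable M (\<lambda>\<omega>. f (W \<omega>))"
proof -
  interpret prob_space M by fact
  have [measurable]: "f \<in> borel_measurable borel" using cont by (rule borel_measurable_continuous_onI)
  show ?thesis by (rule integrable_const_bound[of _ B]) (use bd in auto)
qed

text \<open>Lipschitz minorants give an asymptotic lower bound for the integrals of a nonnegative
  bounded continuous function; applied to \<open>B + f\<close> and to \<open>B - f\<close>, it gives
  convergence.\<close>

lemma converges_weakly_LipschitzI:
  fixes W :: "nat \<Rightarrow> 'c \<Rightarrow> 'a::metric_space"
  assumes M: "prob_space M" and N: "prob_space N"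
    and W: "\<And>n. W n \<in> borel_measurable M" and Z: "Z \<in> borel_measurable N"
    and Lip: "\<And>f L B. (\<And>x y. \<bar>f x - f y\<bar> \<le> L * dist x y) \<Longrightarrow> (\<And>x. \<bar>f x\<bar> \<le> (B::real)) \<Longrightarrow>
      0 \<le> L \<Longrightarrow> (\<lambda>n. \<integral>\<omega>. f (W n \<omega>) \<partial>M) \<longlonglongrightarrow> (\<integral>\<omega>. f (Z \<omega>) \<partial>N)"
  shows "converges_weakly M W N Z"
proof -
  interpret M: prob_space M by fact
  interpret N: prob_space N by fact
  have lower: "\<forall>\<^sub>F n in sequentially. (\<integral>\<omega>. f (Z \<omega>) \<partial>N) - e < (\<integral>\<omega>. f (W n \<omega>) \<partial>M)"
    if f: "continuous_on UNIV f" "\<And>x. 0 \<le> f x" "\<And>x. f x \<le> C" and e: "e > 0" for f :: "'a \<Rightarrow> real" and C e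
  proof -
    define g where "g k x = (INF y. f y + real k * dist x y)" for k x
    note G = Lipschitz_minorant[OF f(2,3,1), folded g_def]
    have gC: "\<bar>g k x\<bar> \<le> C" for k x using G(1,2)[of k x] f(3)[of x] by simp
    have contg: "continuous_on UNIV (g k)" for k
      by (rule lipschitz_on_continuous_on[of "real k"], rule lipschitz_onI)
         (use G(3) in \<open>auto simp: dist_real_def\<close>)
    have [measurable]: "g k \<in> borel_measurable borel" for k by (rule borel_measurable_continuous_onI[OF contg])
    have [measurable]: "f \<in> borel_measurable borel" by (rule borel_measurable_continuous_onI[OF f(1)])
    note [measurable] = W Z
    have "(\<lambda>k. \<integral>\<omega>. g k (Z \<omega>) \<partial>N) \<longlonglongrightarrow> (\<integral>\<omega>. f (Z \<omega>) \<partial>N)"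
      by (rule integral_dominated_convergence[where w = "\<lambda>_. C"]) (use G(4) gC in auto)
    then have "\<forall>\<^sub>F k in sequentially. (\<integral>\<omega>. f (Z \<omega>) \<partial>N) - e < (\<integral>\<omega>. g k (Z \<omega>) \<partial>N)"
      by (rule order_tendstoD) (use e in auto)
    then obtain k where k: "(\<integral>\<omega>. f (Z \<omega>) \<partial>N) - e < (\<integral>\<omega>. g k (Z \<omega>) \<partial>N)"
      unfolding eventually_sequentially by blast
    have "(\<lambda>n. \<integral>\<omega>. g k (W n \<omega>) \<partial>M) \<longlonglongrightarrow> (\<integral>\<omega>. g k (Z \<omega>) \<partial>N)"
      by (rule Lip[of _ "real k" C]) (use G(3) gC in auto)
    then have "\<forall>\<^sub>F n in sequentially. (\<integral>\<omega>. f (Z \<omega>) \<partial>N) - e < (\<integral>\<omega>. g k (W n \<omega>) \<partial>M)"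
      by (rule order_tendstoD) (rule k)
    moreover have "(\<integral>\<omega>. g k (W n \<omega>) \<partial>M) \<le> (\<integral>\<omega>. f (W n \<omega>) \<partial>M)" for n
    proof (rule integral_mono)
      show "integrable M (\<lambda>\<omega>. g k (W n \<omega>))" by (rule integrable_bounded_compose[OF M W contg gC])
      show "integrable M (\<lambda>\<omega>. f (W n \<omega>))" by (rule integrable_bounded_compose[OF M W f(1), where B = C]) (use f in auto)
    qed (rule G)
    ultimately show ?thesis by (auto elim!: eventually_mono intro: less_le_trans)
  qed
  show ?thesis unfolding converges_weakly_def
  proof (intro allI impI)
    fix f :: "'a \<Rightarrow> real"
    assume f: "continuous_on UNIV f \<and> bounded (range f)"
    then obtain B where B: "\<And>x. \<bar>f x\<bar> \<le> B" by (auto simp: bounded_iff)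
    have iW: "integrable M (\<lambda>\<omega>. f (W n \<omega>))" for n by (rule integrable_bounded_compose[OF M W _ B]) (use f in auto)
    have iZ: "integrable N (\<lambda>\<omega>. f (Z \<omega>))" by (rule integrable_bounded_compose[OF N Z _ B]) (use f in auto)
    show "(\<lambda>n. \<integral>\<omega>. f (W n \<omega>) \<partial>M) \<longlonglongrightarrow> (\<integral>\<omega>. f (Z \<omega>) \<partial>N)"
    proof (rule LIMSEQ_I)
      fix e :: real assume e: "0 < e"
      have bd: "0 \<le> B + f x" "B + f x \<le> 2 * B" "0 \<le> B - f x" "B - f x \<le> 2 * B" for x using B[of x] by (auto simp: abs_le_iff)
      have "\<forall>\<^sub>F n in sequentially. (\<integral>\<omega>. B + f (Z \<omega>) \<partial>N) - e < (\<integral>\<omega>. B + f (W n \<omega>) \<partial>M)"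
        by (rule lower[of "\<lambda>x. B + f x" "2 * B"]) (use f bd e in \<open>auto intro!: continuous_intros\<close>)
      moreover have "\<forall>\<^sub>F n in sequentially. (\<integral>\<omega>. B - f (Z \<omega>) \<partial>N) - e < (\<integral>\<omega>. B - f (W n \<omega>) \<partial>M)"
        by (rule lower[of "\<lambda>x. B - f x" "2 * B"]) (use f bd e in \<open>auto intro!: continuous_intros\<close>)
      ultimately have "\<forall>\<^sub>F n in sequentially. norm ((\<integral>\<omega>. f (W n \<omega>) \<partial>M) - (\<integral>\<omega>. f (Z \<omega>) \<partial>N)) < e"
        by eventually_elim (auto simp: iW iZ M.prob_space N.prob_space abs_less_iff)
      then show "\<exists>n0. \<forall>n\<ge>n0. norm ((\<integral>\<omega>. f (W n \<omega>) \<partial>M) - (\<integral>\<omega>. f (Z \<omega>) \<partial>N)) < e"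
        by (simp add: eventually_sequentially)
    qed
  qed
qed

lemma Lipschitz_integral_diff:
  fixes W V :: "'c \<Rightarrow> 'a::{real_normed_vector, second_countable_topology}"
  assumes "prob_space M" and [measurable]: "W \<in> borel_measurable M" "V \<in> borel_measurable M"
    and Lip: "\<And>x y. \<bar>f x - f y\<bar> \<le> L * dist x y" and bd: "\<And>x. \<bar>f x\<bar> \<le> (B::real)" and L: "0 \<le> L" and \<delta>: "0 \<le> \<delta>"
  shows "\<bar>(\<integral>\<omega>. f (W \<omega>) \<partial>M) - (\<integral>\<omega>. f (V \<omega>) \<partial>M)\<bar>
    \<le> L * \<delta> + 2 * B * measure M {\<omega> \<in> space M. \<delta> < norm (W \<omega> - V \<omega>)}"
proof -
  interpret prob_space M by fact
  have cont: "continuous_on UNIV f"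
    by (rule lipschitz_on_continuous_on[of L], rule lipschitz_onI) (use Lip L in \<open>auto simp: dist_real_def\<close>)
  define A where "A = {\<omega> \<in> space M. \<delta> < norm (W \<omega> - V \<omega>)}"
  have A [measurable]: "A \<in> sets M" unfolding A_def by measurable
  have i1: "integrable M (\<lambda>\<omega>. f (W \<omega>))" and i2: "integrable M (\<lambda>\<omega>. f (V \<omega>))"
    by (rule integrable_bounded_compose[OF assms(1) _ cont bd], measurable)+
  have B0: "0 \<le> B" using bd[of undefined] by linarith
  have pt: "\<bar>f (W \<omega>) - f (V \<omega>)\<bar> \<le> L * \<delta> + 2 * B * indicator A \<omega>" if "\<omega> \<in> space M" for \<omega>
  proof (cases "\<omega> \<in> A")
    case True
    then show ?thesis using bd[of "W \<omega>"] bd[of "V \<omega>"] mult_nonneg_nonneg[OF L \<delta>] by (simp add: abs_le_iff)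
  next
    case False
    then have "dist (W \<omega>) (V \<omega>) \<le> \<delta>" using that by (simp add: A_def dist_norm)
    then have "L * dist (W \<omega>) (V \<omega>) \<le> L * \<delta>" using L by (intro mult_left_mono)
    then show ?thesis using Lip[of "W \<omega>" "V \<omega>"] False by simp
  qed
  have "\<bar>(\<integral>\<omega>. f (W \<omega>) \<partial>M) - (\<integral>\<omega>. f (V \<omega>) \<partial>M)\<bar> = \<bar>\<integral>\<omega>. f (W \<omega>) - f (V \<omega>) \<partial>M\<bar>"
    using i1 i2 by simp
  also have "\<dots> \<le> (\<integral>\<omega>. \<bar>f (W \<omega>) - f (V \<omega>)\<bar> \<partial>M)"
    using integral_norm_bound[of M "\<lambda>\<omega>. f (W \<omega>) - f (V \<omega>)"] by simp
  also have "\<dots> \<le> (\<integral>\<omega>. L * \<delta> + 2 * B * indicator A \<omega> \<partial>M)"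
    by (rule integral_mono) (use i1 i2 pt in \<open>auto intro!: integrable_real_indicator simp: emeasure_eq_measure\<close>)
  also have "\<dots> = L * \<delta> + 2 * B * measure M A"
    by (simp add: prob_space integrable_real_indicator emeasure_eq_measure)
  finally show ?thesis by (simp add: A_def)
qed

lemma converges_weakly_Slutsky:
  fixes W V :: "nat \<Rightarrow> 'c \<Rightarrow> 'a::{real_normed_vector, second_countable_topology}"
  assumes M: "prob_space M" and N: "prob_space N"
    and W: "\<And>n. W n \<in> borel_measurable M" and V: "\<And>n. V n \<in> borel_measurable M" and Z: "Z \<in> borel_measurable N"
    and VZ: "converges_weakly M V N Z"
    and close: "\<And>\<delta>. 0 < \<delta> \<Longrightarrow> (\<lambda>n. measure M {\<omega> \<in> space M. \<delta> < norm (W n \<omega> - V n \<omega>)}) \<longlonglongrightarrow> 0"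
  shows "converges_weakly M W N Z"
proof (rule converges_weakly_LipschitzI[OF M N W Z])
  fix f :: "'a \<Rightarrow> real" and L B
  assume Lip: "\<And>x y. \<bar>f x - f y\<bar> \<le> L * dist x y" and bd: "\<And>x. \<bar>f x\<bar> \<le> B" and L: "0 \<le> L"
  have cont: "continuous_on UNIV f"
    by (rule lipschitz_on_continuous_on[of L], rule lipschitz_onI) (use Lip L in \<open>auto simp: dist_real_def\<close>)
  have B0: "0 \<le> B" using bd[of undefined] by linarith
  have VZf: "(\<lambda>n. \<integral>\<omega>. f (V n \<omega>) \<partial>M) \<longlonglongrightarrow> (\<integral>\<omega>. f (Z \<omega>) \<partial>N)"
    using VZ cont bd unfolding converges_weakly_def bounded_iff by auto
  have "(\<lambda>n. (\<integral>\<omega>. f (W n \<omega>) \<partial>M) - (\<integral>\<omega>. f (V n \<omega>) \<partial>M)) \<longlonglongrightarrow> 0"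
  proof (rule LIMSEQ_I)
    fix e :: real assume e: "0 < e"
    \<comment> \<open>Then \<open>L * \<delta>\<close> stays below \<open>e / 2\<close>;
      \<open>L + 1\<close> avoids a division by 0 for constant \<open>f\<close>.\<close>
    define \<delta> where "\<delta> = e / (2 * (L + 1))"
    have \<delta>: "\<delta> > 0" "L * \<delta> < e / 2 + e / 4"
      using e L by (auto simp: \<delta>_def field_simps intro!: add_pos_nonneg)
    have "(\<lambda>n. 2 * B * measure M {\<omega> \<in> space M. \<delta> < norm (W n \<omega> - V n \<omega>)}) \<longlonglongrightarrow> 2 * B * 0"
      by (intro tendsto_intros close \<delta>)
    then have "\<forall>\<^sub>F n in sequentially. 2 * B * measure M {\<omega> \<in> space M. \<delta> < norm (W n \<omega> - V n \<omega>)} < e / 4"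
      by (rule order_tendstoD) (use e in auto)
    then have "\<forall>\<^sub>F n in sequentially. norm ((\<integral>\<omega>. f (W n \<omega>) \<partial>M) - (\<integral>\<omega>. f (V n \<omega>) \<partial>M) - 0) < e"
    proof eventually_elim
      case (elim n)
      have "\<bar>(\<integral>\<omega>. f (W n \<omega>) \<partial>M) - (\<integral>\<omega>. f (V n \<omega>) \<partial>M)\<bar>
          \<le> L * \<delta> + 2 * B * measure M {\<omega> \<in> space M. \<delta> < norm (W n \<omega> - V n \<omega>)}"
        by (rule Lipschitz_integral_diff[OF M W V]) (use Lip bd L \<delta> in auto)
      then show ?case using elim \<delta> by simp
    qed
    then show "\<exists>n0. \<forall>n\<ge>n0. norm ((\<integral>\<omega>. f (W n \<omega>) \<partial>M) - (\<integral>\<omega>. f (V n \<omega>) \<partial>M) - 0) < e"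
      by (simp add: eventually_sequentially)
  qed
  from tendsto_add[OF this VZf] show "(\<lambda>n. \<integral>\<omega>. f (W n \<omega>) \<partial>M) \<longlonglongrightarrow> (\<integral>\<omega>. f (Z \<omega>) \<partial>N)" by simp
qed

subsection \<open>Convergence of trigonometric moments\<close>

text \<open>Real trigonometric polynomials on the space. The free phase \<open>b\<close> supplies
  the sines and makes the set closed under products by the product-to-sum formula, so the real form
  of Stone-Weierstrass applies.\<close>

inductive_set trig :: "('a::real_inner \<Rightarrow> real) set" where
  cosine: "(\<lambda>x. c * cos (l \<bullet> x + b)) \<in> trig"
| sum: "f \<in> trig \<Longrightarrow> g \<in> trig \<Longrightarrow> (\<lambda>x. f x + g x) \<in> trig"

lemma trig_const: "(\<lambda>_. c) \<in> trig"
  using trig.cosine[of c 0 0] by simp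

lemma trig_mult:
  assumes "f \<in> trig" "g \<in> trig" shows "(\<lambda>x. f x * g x) \<in> trig"
  using assms
proof (induction f)
  case (cosine c l b)
  from cosine.prems show ?case
  proof (induction g)
    case (cosine c' l' b')
    have eq: "(\<lambda>x. c * cos (l \<bullet> x + b) * (c' * cos (l' \<bullet> x + b')))
        = (\<lambda>x. (c * c' / 2) * cos ((l - l') \<bullet> x + (b - b')) + (c * c' / 2) * cos ((l + l') \<bullet> x + (b + b')))"
    proof
      fix x
      have prod: "c * s * (c' * t) = (c * c' / 2) * v + (c * c' / 2) * w" if "s * t = (v + w) / 2"
        for s t v w :: real
      proof -
        have "c * s * (c' * t) = c * c' * (s * t)" by simp
        then show ?thesis unfolding that by (simp add: field_simps)
      qed
      have eqs: "(l - l') \<bullet> x + (b - b') = (l \<bullet> x + b) - (l' \<bullet> x + b')"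
        "(l + l') \<bullet> x + (b + b') = (l \<bullet> x + b) + (l' \<bullet> x + b')"
        by (simp_all add: inner_diff_left inner_add_left)
      have "cos (l \<bullet> x + b) * cos (l' \<bullet> x + b')
          = (cos ((l \<bullet> x + b) - (l' \<bullet> x + b')) + cos ((l \<bullet> x + b) + (l' \<bullet> x + b'))) / 2"
        by (rule cos_times_cos)
      then show "c * cos (l \<bullet> x + b) * (c' * cos (l' \<bullet> x + b'))
        = (c * c' / 2) * cos ((l - l') \<bullet> x + (b - b')) + (c * c' / 2) * cos ((l + l') \<bullet> x + (b + b'))"
        unfolding eqs by (rule prod)
    qed
    show ?case unfolding eq by (intro trig.sum trig.cosine)
  next
    case (sum f g)
    then show ?case by (simp add: distrib_left trig.sum)
  qed
next
  case (sum f g)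
  then show ?case by (simp add: distrib_right trig.sum)
qed

lemma trig_bounded_continuous: "f \<in> trig \<Longrightarrow> continuous_on UNIV f \<and> (\<exists>D. \<forall>x. \<bar>f x\<bar> \<le> D)"
proof (induction rule: trig.induct)
  case (cosine c l b)
  have "\<bar>c * cos (l \<bullet> x + b)\<bar> \<le> \<bar>c\<bar>" for x
    using mult_left_mono[OF abs_cos_le_one[of "l \<bullet> x + b"], of "\<bar>c\<bar>"] by (simp add: abs_mult)
  then show ?case by (auto intro!: continuous_intros)
next
  case (sum f g)
  then obtain D E where "\<And>x. \<bar>f x\<bar> \<le> D" "\<And>x. \<bar>g x\<bar> \<le> E" by auto
  then have "\<bar>f x + g x\<bar> \<le> D + E" for x by (meson abs_triangle_ineq add_mono order_trans)
  then show ?case using sum by (auto intro!: continuous_intros)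
qed

lemma trig_polynomial:
  assumes "real_polynomial_function q" "p \<in> trig"
  shows "(\<lambda>x. q (p x)) \<in> trig"
  using assms(1)
proof induction
  case (linear f)
  then interpret bounded_linear f by simp
  have "f y = f 1 * y" for y using scaleR[of y 1] by simp
  then have eq: "(\<lambda>x. f (p x)) = (\<lambda>x. f 1 * p x)" by (rule ext)
  show ?case unfolding eq by (rule trig_mult[OF trig_const assms(2)])
qed (auto intro: trig_const trig.sum trig_mult)

text \<open>The trigonometric polynomial supplied by the Stone-Weierstrass theorem need not be bounded by
  the bound of \<open>f\<close> off the compact set; composing it with a polynomial that is close to a
  truncation repairs this.\<close>

lemma trig_approx:
  fixes f :: "'a::real_inner \<Rightarrow> real"
  assumes K: "compact K" and cont: "continuous_on UNIV f" and bd: "\<And>x. \<bar>f x\<bar> \<le> B" and e: "0 < e"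
  obtains P where "P \<in> trig" "\<And>x. \<bar>P x\<bar> \<le> B + e" "\<And>x. x \<in> K \<Longrightarrow> \<bar>f x - P x\<bar> \<le> 2 * e"
proof -
  have B0: "0 \<le> B" using bd[of undefined] by linarith
  interpret function_ring_on trig K
  proof
    show "f \<in> trig \<Longrightarrow> continuous_on K f" for f :: "'a \<Rightarrow> real"
      using trig_bounded_continuous continuous_on_subset by blast
    fix x y :: 'a assume "x \<in> K" "y \<in> K" "x \<noteq> y"
    define v where "v = x - y"
    have v: "v \<noteq> 0" using \<open>x \<noteq> y\<close> by (simp add: v_def)
    \<comment> \<open>The phases at \<open>x\<close> and \<open>y\<close> then differ by
      \<open>pi / 2\<close>, and the separating cosine takes the values 0 and 1.\<close>
    define c where "c = pi / (2 * (v \<bullet> v))"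
    have d: "c * (v \<bullet> x) = c * (v \<bullet> y) + pi / 2"
    proof -
      have "v \<bullet> x = v \<bullet> y + v \<bullet> v" by (simp add: v_def inner_diff_right)
      then show ?thesis using v by (simp add: c_def distrib_left)
    qed
    let ?f = "\<lambda>z. 1 * cos ((c *\<^sub>R v) \<bullet> z + (- (c * (v \<bullet> y))))"
    have "?f x \<noteq> ?f y" using d by simp
    then show "\<exists>f\<in>trig. f x \<noteq> f y" by (intro bexI[of _ ?f] trig.cosine)
  qed (use K in \<open>auto intro: trig.sum trig_mult trig_const\<close>)
  obtain p where p: "p \<in> trig" "\<And>x. x \<in> K \<Longrightarrow> \<bar>f x - p x\<bar> < e"
    using Stone_Weierstrass_basic[OF continuous_on_subset[OF cont], of e] e by auto
  obtain D where D: "\<And>x. \<bar>p x\<bar> \<le> D" using trig_bounded_continuous[OF p(1)] by blast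
  define clip where "clip t = max (- B) (min B t)" for t
  have contc: "continuous_on {-D..D} clip" unfolding clip_def by (intro continuous_intros)
  obtain q where q: "real_polynomial_function q" "\<And>t. t \<in> {-D..D} \<Longrightarrow> \<bar>clip t - q t\<bar> < e"
    using Stone_Weierstrass_real_polynomial_function[OF compact_Icc contc e] by blast
  have cB: "\<bar>clip t\<bar> \<le> B" for t using B0 by (auto simp: clip_def)
  have close: "\<bar>clip (p x) - q (p x)\<bar> < e" for x by (rule q) (use D[of x] in auto)
  show ?thesis
  proof
    show "(\<lambda>x. q (p x)) \<in> trig" by (rule trig_polynomial) fact+
    show "\<bar>q (p x)\<bar> \<le> B + e" for x using close[of x] cB[of "p x"] by linarith
    show "\<bar>f x - q (p x)\<bar> \<le> 2 * e" if "x \<in> K" for x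
    proof -
      \<comment> \<open>\<open>f x\<close> lies in the interval of truncation, so clipping cannot
        move a value away from it.\<close>
      have "\<bar>f x - clip (p x)\<bar> \<le> \<bar>f x - p x\<bar>"
      proof -
        have "- B \<le> f x" "f x \<le> B" using bd[of x] by (auto simp: abs_le_iff)
        then show ?thesis by (auto simp: clip_def max_def min_def abs_real_def)
      qed
      then show ?thesis using close[of x] p(2)[OF that] by linarith
    qed
  qed
qed

lemma integral_diff_compact:
  fixes f g :: "'a::topological_space \<Rightarrow> real"
  assumes "prob_space M" and [measurable]: "W \<in> borel_measurable M" and K [measurable]: "K \<in> sets borel"
    and cont: "continuous_on UNIV f" "continuous_on UNIV g"
    and bd: "\<And>x. \<bar>f x\<bar> \<le> B" "\<And>x. \<bar>g x\<bar> \<le> B'"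
    and close: "\<And>x. x \<in> K \<Longrightarrow> \<bar>f x - g x\<bar> \<le> e" and e: "0 \<le> e"
  shows "\<bar>(\<integral>\<omega>. f (W \<omega>) \<partial>M) - (\<integral>\<omega>. g (W \<omega>) \<partial>M)\<bar> \<le> e + (B + B') * measure M {\<omega> \<in> space M. W \<omega> \<notin> K}"
proof -
  interpret prob_space M by fact
  define A where "A = {\<omega> \<in> space M. W \<omega> \<notin> K}"
  have A [measurable]: "A \<in> sets M" unfolding A_def by measurable
  have i1: "integrable M (\<lambda>\<omega>. f (W \<omega>))" and i2: "integrable M (\<lambda>\<omega>. g (W \<omega>))"
    by (rule integrable_bounded_compose[OF assms(1) _ cont(1) bd(1)], measurable)
       (rule integrable_bounded_compose[OF assms(1) _ cont(2) bd(2)], measurable)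
  have pt: "\<bar>f (W \<omega>) - g (W \<omega>)\<bar> \<le> e + (B + B') * indicator A \<omega>" if "\<omega> \<in> space M" for \<omega>
    using that bd(1)[of "W \<omega>"] bd(2)[of "W \<omega>"] close[of "W \<omega>"] e
    by (cases "\<omega> \<in> A") (auto simp: A_def)
  have "\<bar>(\<integral>\<omega>. f (W \<omega>) \<partial>M) - (\<integral>\<omega>. g (W \<omega>) \<partial>M)\<bar> = \<bar>\<integral>\<omega>. f (W \<omega>) - g (W \<omega>) \<partial>M\<bar>"
    using i1 i2 by simp
  also have "\<dots> \<le> (\<integral>\<omega>. \<bar>f (W \<omega>) - g (W \<omega>)\<bar> \<partial>M)"
    using integral_norm_bound[of M "\<lambda>\<omega>. f (W \<omega>) - g (W \<omega>)"] by simp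
  also have "\<dots> \<le> (\<integral>\<omega>. e + (B + B') * indicator A \<omega> \<partial>M)"
    by (rule integral_mono) (use i1 i2 pt in \<open>auto intro!: integrable_real_indicator simp: emeasure_eq_measure\<close>)
  also have "\<dots> = e + (B + B') * measure M A"
    by (simp add: prob_space integrable_real_indicator emeasure_eq_measure)
  finally show ?thesis by (simp add: A_def)
qed

text \<open>Cosines with all phases encode convergence of characteristic functions. Tightness
  provides one compact set on which the test function may be replaced by an element of
  \<open>trig\<close>, simultaneously for all \<open>n\<close> and for the limit.\<close>

lemma converges_weakly_tight:
  fixes W :: "nat \<Rightarrow> 'c \<Rightarrow> 'a::real_inner"
  assumes M: "prob_space M" and N: "prob_space N"
    and W: "\<And>n. W n \<in> borel_measurable M" and Z: "Z \<in> borel_measurable N"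
    and cosconv: "\<And>l b. (\<lambda>n. \<integral>\<omega>. cos (l \<bullet> W n \<omega> + b) \<partial>M) \<longlonglongrightarrow> (\<integral>\<omega>. cos (l \<bullet> Z \<omega> + b) \<partial>N)"
    and tight: "\<And>e. 0 < e \<Longrightarrow> \<exists>K. compact K \<and> (\<forall>n. measure M {\<omega> \<in> space M. W n \<omega> \<notin> K} \<le> e) \<and>
      measure N {\<omega> \<in> space N. Z \<omega> \<notin> K} \<le> e"
  shows "converges_weakly M W N Z"
  unfolding converges_weakly_def
proof (intro allI impI)
  fix f :: "'a \<Rightarrow> real"
  assume f: "continuous_on UNIV f \<and> bounded (range f)"
  then obtain B where B: "\<And>x. \<bar>f x\<bar> \<le> B" by (auto simp: bounded_iff)
  have B0: "0 \<le> B" using B[of undefined] by linarith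
  have trigconv: "(\<lambda>n. \<integral>\<omega>. P (W n \<omega>) \<partial>M) \<longlonglongrightarrow> (\<integral>\<omega>. P (Z \<omega>) \<partial>N)" if "P \<in> trig" for P
    using that
  proof induction
    case (cosine c l b)
    show ?case unfolding integral_mult_right_zero by (intro tendsto_intros cosconv)
  next
    case (sum g h)
    have i: "integrable M (\<lambda>\<omega>. p (W n \<omega>))" "integrable N (\<lambda>\<omega>. p (Z \<omega>))" if p: "p \<in> trig" for n p
    proof -
      obtain D where D: "continuous_on UNIV p" "\<And>x. \<bar>p x\<bar> \<le> D"
        using trig_bounded_continuous[OF p] by blast
      show "integrable M (\<lambda>\<omega>. p (W n \<omega>))" by (rule integrable_bounded_compose[OF M W D])
      show "integrable N (\<lambda>\<omega>. p (Z \<omega>))" by (rule integrable_bounded_compose[OF N Z D])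
    qed
    show ?case using tendsto_add[OF sum.IH] by (simp add: i[OF sum.hyps(1)] i[OF sum.hyps(2)])
  qed
  show "(\<lambda>n. \<integral>\<omega>. f (W n \<omega>) \<partial>M) \<longlonglongrightarrow> (\<integral>\<omega>. f (Z \<omega>) \<partial>N)"
  proof (rule LIMSEQ_I)
    fix r :: real assume r: "0 < r"
    \<comment> \<open>The cap 1 keeps \<open>P\<close> bounded by \<open>B + 1\<close>. The errors
      \<open>3 * e\<close>, \<open>e\<close> and \<open>3 * e\<close> add up to less than
      \<open>r\<close>.\<close>
    define e where "e = min 1 (r / 16)"
    have e: "0 < e" "e \<le> 1" "e \<le> r / 16" using r by (auto simp: e_def)
    \<comment> \<open>\<open>2 * B + 1\<close> bounds the difference of \<open>f\<close> and
      \<open>P\<close> off \<open>K\<close>, so the mass outside of \<open>K\<close> costs at most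
      \<open>e\<close>.\<close>
    define \<theta> where "\<theta> = e / (2 * B + 1)"
    have \<theta>: "\<theta> > 0" "(2 * B + 1) * \<theta> = e" using e B0 by (auto simp: \<theta>_def add_nonneg_pos)
    obtain K where K: "compact K" "\<And>n. measure M {\<omega> \<in> space M. W n \<omega> \<notin> K} \<le> \<theta>"
      "measure N {\<omega> \<in> space N. Z \<omega> \<notin> K} \<le> \<theta>" using tight[OF \<theta>(1)] by blast
    have Kb: "K \<in> sets borel" using K(1) by (simp add: borel_compact)
    obtain P where P: "P \<in> trig" "\<And>x. \<bar>P x\<bar> \<le> B + e" "\<And>x. x \<in> K \<Longrightarrow> \<bar>f x - P x\<bar> \<le> 2 * e"
      using trig_approx[OF K(1) conjunct1[OF f] B e(1)] by blast
    have P1: "\<bar>P x\<bar> \<le> B + 1" for x using P(2)[of x] e(2) by linarith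
    have contP: "continuous_on UNIV P" using trig_bounded_continuous[OF P(1)] by blast
    have bound: "\<bar>(\<integral>\<omega>. f (V \<omega>) \<partial>S) - (\<integral>\<omega>. P (V \<omega>) \<partial>S)\<bar> \<le> 3 * e"
      if S: "prob_space S" "V \<in> borel_measurable S" "measure S {\<omega> \<in> space S. V \<omega> \<notin> K} \<le> \<theta>" for S :: "'d measure" and V
    proof -
      have "\<bar>(\<integral>\<omega>. f (V \<omega>) \<partial>S) - (\<integral>\<omega>. P (V \<omega>) \<partial>S)\<bar> \<le> 2 * e + (B + (B + 1)) * measure S {\<omega> \<in> space S. V \<omega> \<notin> K}"
        by (rule integral_diff_compact[OF S(1,2) Kb conjunct1[OF f] contP B P1]) (use P e in auto)
      also have "\<dots> \<le> 2 * e + (B + (B + 1)) * \<theta>" using S(3) B0 by (intro add_left_mono mult_left_mono) auto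
      finally show ?thesis using \<theta>(2) by (simp add: algebra_simps)
    qed
    have bound': "\<bar>(\<integral>\<omega>. f (Z \<omega>) \<partial>N) - (\<integral>\<omega>. P (Z \<omega>) \<partial>N)\<bar> \<le> 3 * e"
    proof -
      have "\<bar>(\<integral>\<omega>. f (Z \<omega>) \<partial>N) - (\<integral>\<omega>. P (Z \<omega>) \<partial>N)\<bar> \<le> 2 * e + (B + (B + 1)) * measure N {\<omega> \<in> space N. Z \<omega> \<notin> K}"
        by (rule integral_diff_compact[OF N Z Kb conjunct1[OF f] contP B P1]) (use P e in auto)
      also have "\<dots> \<le> 2 * e + (B + (B + 1)) * \<theta>" using K(3) B0 by (intro add_left_mono mult_left_mono) auto
      finally show ?thesis using \<theta>(2) by (simp add: algebra_simps)
    qed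
    have "\<forall>\<^sub>F n in sequentially. dist (\<integral>\<omega>. P (W n \<omega>) \<partial>M) (\<integral>\<omega>. P (Z \<omega>) \<partial>N) < e"
      using trigconv[OF P(1)] e(1) by (rule tendstoD)
    then have "\<forall>\<^sub>F n in sequentially. norm ((\<integral>\<omega>. f (W n \<omega>) \<partial>M) - (\<integral>\<omega>. f (Z \<omega>) \<partial>N)) < r"
    proof eventually_elim
      case (elim n)
      have "\<bar>(\<integral>\<omega>. f (W n \<omega>) \<partial>M) - (\<integral>\<omega>. P (W n \<omega>) \<partial>M)\<bar> \<le> 3 * e" by (rule bound[OF M W K(2)])
      with bound' elim e(3) r show ?case by (simp add: dist_real_def abs_less_iff abs_le_iff)
    qed
    then show "\<exists>n0. \<forall>n\<ge>n0. norm ((\<integral>\<omega>. f (W n \<omega>) \<partial>M) - (\<integral>\<omega>. f (Z \<omega>) \<partial>N)) < r"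
      by (simp add: eventually_sequentially)
  qed
qed

section \<open>Weak convergence in Hilbert space from finite-dimensional projections\<close>

context onb
begin

text \<open>Each further coordinate is a Minkowski sum with a segment, which preserves compactness.
  These boxes witness tightness of the projected sequences.\<close>

lemma compact_coord_box: "compact {x. \<exists>a. (\<forall>i<k. \<bar>a i\<bar> \<le> R) \<and> x = (\<Sum>i<k. a i *\<^sub>R \<phi> i)}"
proof (induction k)
  case 0
  have "{x. \<exists>a :: nat \<Rightarrow> real. (\<forall>i<0. \<bar>a i\<bar> \<le> R) \<and> x = (\<Sum>i<0. a i *\<^sub>R \<phi> i)} = {0}" by auto
  then show ?case by simp
next
  case (Suc k)
  let ?K = "{x. \<exists>a. (\<forall>i<k. \<bar>a i\<bar> \<le> R) \<and> x = (\<Sum>i<k. a i *\<^sub>R \<phi> i)}"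
  let ?L = "(\<lambda>t. t *\<^sub>R \<phi> k) ` {-R..R}"
  have "compact ?L" by (intro compact_continuous_image continuous_intros) auto
  with Suc have "compact {x + y | x y. x \<in> ?K \<and> y \<in> ?L}" by (rule compact_sums)
  also have "{x + y | x y. x \<in> ?K \<and> y \<in> ?L} = {x. \<exists>a. (\<forall>i<Suc k. \<bar>a i\<bar> \<le> R) \<and> x = (\<Sum>i<Suc k. a i *\<^sub>R \<phi> i)}"
  proof (intro equalityI subsetI)
    fix z assume "z \<in> {x + y | x y. x \<in> ?K \<and> y \<in> ?L}"
    then obtain x y where xy: "z = x + y" "x \<in> ?K" "y \<in> ?L" by blast
    then obtain a where "\<forall>i<k. \<bar>a i\<bar> \<le> R" "x = (\<Sum>i<k. a i *\<^sub>R \<phi> i)" by blast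
    moreover obtain t where "y = t *\<^sub>R \<phi> k" "t \<in> {- R..R}" using xy(3) by blast
    ultimately have a: "\<forall>i<k. \<bar>a i\<bar> \<le> R" "\<bar>t\<bar> \<le> R" "z = (\<Sum>i<k. a i *\<^sub>R \<phi> i) + t *\<^sub>R \<phi> k"
      using xy(1) by auto
    then have "\<forall>i<Suc k. \<bar>(a(k := t)) i\<bar> \<le> R" "z = (\<Sum>i<Suc k. (a(k := t)) i *\<^sub>R \<phi> i)"
      by (auto simp: less_Suc_eq)
    then show "z \<in> {x. \<exists>a. (\<forall>i<Suc k. \<bar>a i\<bar> \<le> R) \<and> x = (\<Sum>i<Suc k. a i *\<^sub>R \<phi> i)}" by blast
  next
    fix z assume "z \<in> {x. \<exists>a. (\<forall>i<Suc k. \<bar>a i\<bar> \<le> R) \<and> x = (\<Sum>i<Suc k. a i *\<^sub>R \<phi> i)}"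
    then obtain a where a: "\<forall>i<Suc k. \<bar>a i\<bar> \<le> R" "z = (\<Sum>i<k. a i *\<^sub>R \<phi> i) + a k *\<^sub>R \<phi> k" by auto
    moreover have "(\<Sum>i<k. a i *\<^sub>R \<phi> i) \<in> ?K" using a(1) by (intro CollectI exI[of _ a]) auto
    moreover have "\<bar>a k\<bar> \<le> R" using a(1) by simp
    then have "a k *\<^sub>R \<phi> k \<in> ?L" by (intro imageI) (simp add: abs_le_iff)
    ultimately show "z \<in> {x + y | x y. x \<in> ?K \<and> y \<in> ?L}" by blast
  qed
  finally show ?case .
qed

end

lemma (in prob_space) expectation_le_sqrt:
  fixes X :: "'a \<Rightarrow> real"
  assumes "integrable M (\<lambda>x. (X x)\<^sup>2)" "X \<in> borel_measurable M" "expectation (\<lambda>x. (X x)\<^sup>2) \<le> c"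
  shows "expectation X \<le> sqrt c"
proof -
  have "integrable M X" by (rule square_integrable_imp_integrable[OF assms(2,1)])
  then have "(expectation X)\<^sup>2 \<le> expectation (\<lambda>x. (X x)\<^sup>2)"
    using variance_eq[of X] variance_positive[of X] assms(1) by simp
  then have "(expectation X)\<^sup>2 \<le> c" using assms(3) by simp
  then show ?thesis by (rule real_le_rsqrt)
qed

lemma (in prob_space) tail_prob_tendsto_0:
  fixes X :: "'a \<Rightarrow> real"
  assumes [measurable]: "X \<in> borel_measurable M" and e: "0 < e"
  shows "\<exists>R>0. prob {\<omega> \<in> space M. R < X \<omega>} \<le> e"
proof -
  have "(\<lambda>n. prob {\<omega> \<in> space M. real n < X \<omega>}) \<longlonglongrightarrow> prob (\<Inter>n. {\<omega> \<in> space M. real n < X \<omega>})"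
    by (rule finite_Lim_measure_decseq) (auto simp: decseq_def)
  also have "(\<Inter>n. {\<omega> \<in> space M. real n < X \<omega>}) = {}"
  proof -
    have False if "\<And>n. real n < X \<omega>" for \<omega>
      using that reals_Archimedean2[of "X \<omega>"] by (meson less_asym)
    then show ?thesis by auto
  qed
  finally have "\<forall>\<^sub>F n in sequentially. prob {\<omega> \<in> space M. real n < X \<omega>} < e"
    using e by (intro order_tendstoD(2)) auto
  then have "\<forall>\<^sub>F n in sequentially. prob {\<omega> \<in> space M. real n < X \<omega>} < e \<and> 0 < n"
    using eventually_gt_at_top[of "0::nat"] by eventually_elim auto
  then obtain n where "prob {\<omega> \<in> space M. real n < X \<omega>} < e" "0 < n"
    unfolding eventually_sequentially by blast
  then show ?thesis by (intro exI[of _ "real n"]) auto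
qed

lemma (in prob_space) Markov_second_moment:
  assumes [measurable]: "X \<in> borel_measurable M" and int: "integrable M (\<lambda>\<omega>. (X \<omega>)\<^sup>2)"
    and le: "expectation (\<lambda>\<omega>. (X \<omega>)\<^sup>2) \<le> c" and R: "0 < R"
  shows "prob {\<omega> \<in> space M. R < X \<omega>} \<le> c / R\<^sup>2"
proof -
  have "prob {\<omega> \<in> space M. R < X \<omega>} \<le> prob {\<omega> \<in> space M. R\<^sup>2 \<le> (X \<omega>)\<^sup>2}"
    using R by (intro finite_measure_mono) (auto intro: power_mono)
  also have "\<dots> \<le> expectation (\<lambda>\<omega>. (X \<omega>)\<^sup>2) / R\<^sup>2"
    by (rule integral_Markov_inequality_measure[OF int, of "{}"]) (use R in auto)
  also have "\<dots> \<le> c / R\<^sup>2" using le R by (intro divide_right_mono) auto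
  finally show ?thesis .
qed

text \<open>For a Lipschitz test function, replacing \<open>W n\<close> by its projection costs at
  most \<open>L * sqrt (\<eta> k)\<close>, uniformly in \<open>n\<close>; for \<open>Z\<close>
  pointwise convergence of the projections and dominated convergence suffice. With \<open>k\<close>
  fixed, second moments make the projections tight.\<close>

lemma converges_weakly_Hilbert:
  fixes W :: "nat \<Rightarrow> 'c \<Rightarrow> 'a::{real_inner, second_countable_topology}"
  assumes basis: "orthonormal_basis \<phi>" and M: "prob_space M" and N: "prob_space N"
    and W: "\<And>n. W n \<in> borel_measurable M" and Z: "Z \<in> borel_measurable N"
    and cosconv: "\<And>l b. (\<lambda>n. \<integral>\<omega>. cos (l \<bullet> W n \<omega> + b) \<partial>M) \<longlonglongrightarrow> (\<integral>\<omega>. cos (l \<bullet> Z \<omega> + b) \<partial>N)"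
    and sq: "\<And>n. integrable M (\<lambda>\<omega>. (norm (W n \<omega>))\<^sup>2)" "\<And>n. (\<integral>\<omega>. (norm (W n \<omega>))\<^sup>2 \<partial>M) \<le> c"
    and tail: "\<And>n k. (\<integral>\<omega>. (norm (W n \<omega> - coord_proj \<phi> k (W n \<omega>)))\<^sup>2 \<partial>M) \<le> \<eta> k" "\<eta> \<longlonglongrightarrow> 0"
  shows "converges_weakly M W N Z"
proof (rule converges_weakly_LipschitzI[OF M N W Z])
  interpret onb \<phi> by unfold_locales fact
  interpret M: prob_space M by fact
  interpret N: prob_space N by fact
  note [measurable] = W Z
  fix f :: "'a \<Rightarrow> real" and L B
  assume Lip: "\<And>x y. \<bar>f x - f y\<bar> \<le> L * dist x y" and bd: "\<And>x. \<bar>f x\<bar> \<le> B" and L: "0 \<le> L"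
  have cont: "continuous_on UNIV f"
    by (rule lipschitz_on_continuous_on[of L], rule lipschitz_onI) (use Lip L in \<open>auto simp: dist_real_def\<close>)
  have [measurable]: "f \<in> borel_measurable borel" by (rule borel_measurable_continuous_onI[OF cont])
  have iW: "integrable M (\<lambda>\<omega>. f (V \<omega>))" if [measurable]: "V \<in> borel_measurable M" for V
    by (rule integrable_bounded_compose[OF M _ cont bd]) measurable
  have "0 \<le> (\<integral>\<omega>. (norm (W 0 \<omega>))\<^sup>2 \<partial>M)" by (intro Bochner_Integration.integral_nonneg) auto
  then have c0: "0 \<le> c" using sq(2)[of 0] by linarith
  have finite_dim: "converges_weakly M (\<lambda>n \<omega>. \<pi> k (W n \<omega>)) N (\<lambda>\<omega>. \<pi> k (Z \<omega>))" for k
  proof (rule converges_weakly_tight[OF M N])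
    show "(\<lambda>n. \<integral>\<omega>. cos (l \<bullet> \<pi> k (W n \<omega>) + b) \<partial>M) \<longlonglongrightarrow> (\<integral>\<omega>. cos (l \<bullet> \<pi> k (Z \<omega>) + b) \<partial>N)" for l b
      using cosconv[of "\<pi> k l" b] by (simp add: proj_self_adjoint)
    fix e :: real assume e: "0 < e"
    obtain R1 where R1: "R1 > 0" "N.prob {\<omega> \<in> space N. R1 < norm (Z \<omega>)} \<le> e"
      using N.tail_prob_tendsto_0[of "\<lambda>\<omega>. norm (Z \<omega>)" e] e by auto
    \<comment> \<open>\<open>c + 1\<close> in place of \<open>c\<close> keeps the radius positive
      when \<open>c = 0\<close>.\<close>
    define R2 where "R2 = sqrt ((c + 1) / e)"
    have R2: "R2 > 0" "c / R2\<^sup>2 \<le> e" using e c0 by (auto simp: R2_def field_simps)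
    define R where "R = max R1 R2"
    let ?K = "{x. \<exists>a. (\<forall>i<k. \<bar>a i\<bar> \<le> R) \<and> x = (\<Sum>i<k. a i *\<^sub>R \<phi> i)}"
    have inK: "\<pi> k z \<in> ?K" if "norm z \<le> R" for z
    proof -
      have "\<bar>z \<bullet> \<phi> i\<bar> \<le> R" for i using Cauchy_Schwarz_ineq2[of z "\<phi> i"] that by simp
      then show ?thesis unfolding coord_proj_def by (intro CollectI exI[of _ "\<lambda>i. z \<bullet> \<phi> i"]) simp
    qed
    have "M.prob {\<omega> \<in> space M. \<pi> k (W n \<omega>) \<notin> ?K} \<le> e" for n
    proof -
      have "M.prob {\<omega> \<in> space M. \<pi> k (W n \<omega>) \<notin> ?K} \<le> M.prob {\<omega> \<in> space M. R2 < norm (W n \<omega>)}"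
      proof (rule M.finite_measure_mono)
        show "{\<omega> \<in> space M. \<pi> k (W n \<omega>) \<notin> ?K} \<subseteq> {\<omega> \<in> space M. R2 < norm (W n \<omega>)}"
          using inK unfolding R_def by (force simp: not_less)
      qed measurable
      also have "\<dots> \<le> c / R2\<^sup>2" by (rule M.Markov_second_moment) (use sq R2 in auto)
      finally show ?thesis using R2 by simp
    qed
    moreover have "N.prob {\<omega> \<in> space N. \<pi> k (Z \<omega>) \<notin> ?K} \<le> e"
    proof -
      have "N.prob {\<omega> \<in> space N. \<pi> k (Z \<omega>) \<notin> ?K} \<le> N.prob {\<omega> \<in> space N. R1 < norm (Z \<omega>)}"
      proof (rule N.finite_measure_mono)
        show "{\<omega> \<in> space N. \<pi> k (Z \<omega>) \<notin> ?K} \<subseteq> {\<omega> \<in> space N. R1 < norm (Z \<omega>)}"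
          using inK unfolding R_def by (force simp: not_less)
      qed measurable
      then show ?thesis using R1 by simp
    qed
    ultimately show "\<exists>K. compact K \<and> (\<forall>n. M.prob {\<omega> \<in> space M. \<pi> k (W n \<omega>) \<notin> K} \<le> e) \<and>
        N.prob {\<omega> \<in> space N. \<pi> k (Z \<omega>) \<notin> K} \<le> e"
      using compact_coord_box by blast
  qed measurable
  have approxW: "\<bar>(\<integral>\<omega>. f (W n \<omega>) \<partial>M) - (\<integral>\<omega>. f (\<pi> k (W n \<omega>)) \<partial>M)\<bar> \<le> L * sqrt (\<eta> k)" for n k
  proof -
    let ?D = "\<lambda>\<omega>. norm (W n \<omega> - \<pi> k (W n \<omega>))"
    have sqD: "integrable M (\<lambda>\<omega>. (?D \<omega>)\<^sup>2)"
      by (rule Bochner_Integration.integrable_bound[OF sq(1)[of n]])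
         (auto intro!: AE_I2 power_mono norm_residual_le)
    have iD: "integrable M ?D" by (rule M.square_integrable_imp_integrable[OF _ sqD]) measurable
    have "\<bar>(\<integral>\<omega>. f (W n \<omega>) \<partial>M) - (\<integral>\<omega>. f (\<pi> k (W n \<omega>)) \<partial>M)\<bar> = \<bar>\<integral>\<omega>. f (W n \<omega>) - f (\<pi> k (W n \<omega>)) \<partial>M\<bar>"
      by (simp add: iW)
    also have "\<dots> \<le> (\<integral>\<omega>. \<bar>f (W n \<omega>) - f (\<pi> k (W n \<omega>))\<bar> \<partial>M)"
      by (rule integral_norm_bound[of M "\<lambda>\<omega>. f (W n \<omega>) - f (\<pi> k (W n \<omega>))", unfolded real_norm_def])
    also have "\<dots> \<le> (\<integral>\<omega>. L * ?D \<omega> \<partial>M)"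
    proof (rule integral_mono)
      show "\<bar>f (W n \<omega>) - f (\<pi> k (W n \<omega>))\<bar> \<le> L * ?D \<omega>" for \<omega> using Lip by (simp add: dist_norm)
      show "integrable M (\<lambda>\<omega>. \<bar>f (W n \<omega>) - f (\<pi> k (W n \<omega>))\<bar>)"
        by (intro integrable_abs Bochner_Integration.integrable_diff iW) measurable
    qed (use iD in auto)
    also have "\<dots> = L * M.expectation ?D" by simp
    also have "\<dots> \<le> L * sqrt (\<eta> k)"
      by (intro mult_left_mono L M.expectation_le_sqrt sqD tail(1)) measurable
    finally show ?thesis .
  qed
  have approxZ: "(\<lambda>k. \<integral>\<omega>. f (\<pi> k (Z \<omega>)) \<partial>N) \<longlonglongrightarrow> (\<integral>\<omega>. f (Z \<omega>) \<partial>N)"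
  proof (rule integral_dominated_convergence[where w = "\<lambda>_. B"])
    show "AE \<omega> in N. (\<lambda>k. f (\<pi> k (Z \<omega>))) \<longlonglongrightarrow> f (Z \<omega>)"
      by (intro AE_I2 continuous_on_tendsto_compose[OF cont proj_tendsto]) auto
  qed (use bd in auto)
  show "(\<lambda>n. \<integral>\<omega>. f (W n \<omega>) \<partial>M) \<longlonglongrightarrow> (\<integral>\<omega>. f (Z \<omega>) \<partial>N)"
  proof (rule LIMSEQ_I)
    fix r :: real assume r: "0 < r"
    have "(\<lambda>k. L * sqrt (\<eta> k)) \<longlonglongrightarrow> L * sqrt 0" by (intro tendsto_intros tail)
    then have "\<forall>\<^sub>F k in sequentially. L * sqrt (\<eta> k) < r / 3" by (rule order_tendstoD) (use r in auto)
    moreover have "\<forall>\<^sub>F k in sequentially. dist (\<integral>\<omega>. f (\<pi> k (Z \<omega>)) \<partial>N) (\<integral>\<omega>. f (Z \<omega>) \<partial>N) < r / 3"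
      using approxZ by (rule tendstoD) (use r in auto)
    ultimately have "\<forall>\<^sub>F k in sequentially. L * sqrt (\<eta> k) < r / 3 \<and>
        dist (\<integral>\<omega>. f (\<pi> k (Z \<omega>)) \<partial>N) (\<integral>\<omega>. f (Z \<omega>) \<partial>N) < r / 3"
      by (rule eventually_conj)
    then obtain k where k: "L * sqrt (\<eta> k) < r / 3" "dist (\<integral>\<omega>. f (\<pi> k (Z \<omega>)) \<partial>N) (\<integral>\<omega>. f (Z \<omega>) \<partial>N) < r / 3"
      unfolding eventually_sequentially by blast
    have "(\<lambda>n. \<integral>\<omega>. f (\<pi> k (W n \<omega>)) \<partial>M) \<longlonglongrightarrow> (\<integral>\<omega>. f (\<pi> k (Z \<omega>)) \<partial>N)"
      using finite_dim[of k] cont bd unfolding converges_weakly_def bounded_iff by auto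
    then have "\<forall>\<^sub>F n in sequentially. dist (\<integral>\<omega>. f (\<pi> k (W n \<omega>)) \<partial>M) (\<integral>\<omega>. f (\<pi> k (Z \<omega>)) \<partial>N) < r / 3"
      by (rule tendstoD) (use r in auto)
    then have "\<forall>\<^sub>F n in sequentially. norm ((\<integral>\<omega>. f (W n \<omega>) \<partial>M) - (\<integral>\<omega>. f (Z \<omega>) \<partial>N)) < r"
    proof eventually_elim
      case (elim n)
      show ?case using elim k approxW[of n k] unfolding dist_real_def real_norm_def by linarith
    qed
    then show "\<exists>n0. \<forall>n\<ge>n0. norm ((\<integral>\<omega>. f (W n \<omega>) \<partial>M) - (\<integral>\<omega>. f (Z \<omega>) \<partial>N)) < r"
      by (simp add: eventually_sequentially)
  qed
qed

section \<open>Gaussian elements with a prescribed covariance\<close>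

text \<open>Gram-Schmidt in \<open>L\<^sup>2(\<mu>)\<close>: step \<open>s\<close> removes the component along the \<open>s\<close>-th residual. If
  that residual vanishes almost everywhere, the division by 0 yields 0 and the step does nothing.\<close>

primrec gram_schmidt :: "'a measure \<Rightarrow> (nat \<Rightarrow> 'a \<Rightarrow> real) \<Rightarrow> nat \<Rightarrow> nat \<Rightarrow> 'a \<Rightarrow> real" where
  "gram_schmidt \<mu> b 0 = b"
| "gram_schmidt \<mu> b (Suc s) = (\<lambda>k x. gram_schmidt \<mu> b s k x
     - (\<integral>y. gram_schmidt \<mu> b s k y * gram_schmidt \<mu> b s s y \<partial>\<mu>) / (\<integral>y. (gram_schmidt \<mu> b s s y)\<^sup>2 \<partial>\<mu>)
       * gram_schmidt \<mu> b s s x)"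

text \<open>The Cholesky factor of the Gram matrix of \<open>b\<close> in
  \<open>L\<^sup>2(\<mu>)\<close>: the component of the \<open>k\<close>-th residual along the
  normalized \<open>s\<close>-th one, and 0 if the latter is null.\<close>

definition cholesky :: "'a measure \<Rightarrow> (nat \<Rightarrow> 'a \<Rightarrow> real) \<Rightarrow> nat \<Rightarrow> nat \<Rightarrow> real" where
  "cholesky \<mu> b k s = (\<integral>y. gram_schmidt \<mu> b s k y * gram_schmidt \<mu> b s s y \<partial>\<mu>) / sqrt (\<integral>y. (gram_schmidt \<mu> b s s y)\<^sup>2 \<partial>\<mu>)"

context prob_space
begin

context
  fixes b :: "nat \<Rightarrow> 'a \<Rightarrow> real"
  assumes meas: "\<And>k. b k \<in> borel_measurable M" and bdd: "\<And>k. \<exists>B. \<forall>x. \<bar>b k x\<bar> \<le> B"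
begin

abbreviation "GS \<equiv> gram_schmidt M b"

lemma gram_schmidt_measurable [measurable]: "GS s k \<in> borel_measurable M"
  by (induction s arbitrary: k) (use meas in auto)

lemma gram_schmidt_bounded: "\<exists>B. \<forall>x. \<bar>GS s k x\<bar> \<le> B"
proof (induction s arbitrary: k)
  case (Suc s)
  obtain B where B: "\<And>x. \<bar>GS s k x\<bar> \<le> B" using Suc[of k] by blast
  obtain C where C: "\<And>x. \<bar>GS s s x\<bar> \<le> C" using Suc[of s] by blast
  define r where "r = (\<integral>y. GS s k y * GS s s y \<partial>M) / (\<integral>y. (GS s s y)\<^sup>2 \<partial>M)"
  have "\<bar>GS (Suc s) k x\<bar> \<le> B + \<bar>r\<bar> * C" for x
  proof -
    have "GS (Suc s) k x = GS s k x - r * GS s s x" by (simp add: r_def)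
    then have "\<bar>GS (Suc s) k x\<bar> \<le> \<bar>GS s k x\<bar> + \<bar>r\<bar> * \<bar>GS s s x\<bar>"
      unfolding abs_mult[symmetric] by (simp only: abs_triangle_ineq4)
    also have "\<dots> \<le> B + \<bar>r\<bar> * C" by (intro add_mono mult_left_mono B C) auto
    finally show ?thesis .
  qed
  then show ?case by blast
qed (use bdd in auto)

lemma integrable_gram_schmidt: "integrable M (\<lambda>x. GS s j x * GS t k x)"
proof -
  obtain B where B: "\<And>x. \<bar>GS s j x\<bar> \<le> B" using gram_schmidt_bounded by blast
  obtain C where C: "\<And>x. \<bar>GS t k x\<bar> \<le> C" using gram_schmidt_bounded by blast
  have "\<bar>GS s j x * GS t k x\<bar> \<le> B * C" for x
    unfolding abs_mult using B[of x] by (intro mult_mono B C) auto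
  then show ?thesis by (intro integrable_const_bound[of _ "B * C"]) auto
qed

text \<open>One elimination step subtracts a rank one matrix from the Gram matrix, the outer product
  of the \<open>s\<close>-th column of the factor with itself. If the pivot \<open>D\<close> is 0,
  nothing is removed and the column is 0.\<close>

lemma gram_schmidt_step:
  "expectation (\<lambda>x. GS s j x * GS s k x)
    = expectation (\<lambda>x. GS (Suc s) j x * GS (Suc s) k x) + cholesky M b j s * cholesky M b k s"
proof -
  define D where "D = expectation (\<lambda>x. (GS s s x)\<^sup>2)"
  define p where "p = (\<lambda>k. expectation (\<lambda>x. GS s k x * GS s s x))"
  have GS: "GS (Suc s) k x = GS s k x - p k / D * GS s s x" for k x by (simp add: p_def D_def)
  have ch: "cholesky M b k s = p k / sqrt D" for k by (simp add: cholesky_def p_def D_def)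
  show ?thesis
  proof (cases "D = 0")
    case True
    then show ?thesis by (simp add: ch del: gram_schmidt.simps) (simp add: GS True del: gram_schmidt.simps)
  next
    case False
    have D: "D \<ge> 0" unfolding D_def by simp
    have e: "expectation (\<lambda>x. GS s s x * GS s s x) = D" by (simp add: D_def power2_eq_square)
    have "GS (Suc s) j x * GS (Suc s) k x = GS s j x * GS s k x - p k / D * (GS s j x * GS s s x)
        - p j / D * (GS s k x * GS s s x) + p j / D * (p k / D) * (GS s s x * GS s s x)" for x
      unfolding GS by (simp add: algebra_simps)
    then have "expectation (\<lambda>x. GS (Suc s) j x * GS (Suc s) k x)
        = expectation (\<lambda>x. GS s j x * GS s k x) - p k / D * p j - p j / D * p k + p j / D * (p k / D) * D"
      by (simp add: integrable_gram_schmidt e p_def del: gram_schmidt.simps)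
    moreover have "cholesky M b j s * cholesky M b k s = p j * p k / D"
      using D by (simp add: ch)
    moreover have "p j / D * (p k / D) * D = p j * p k / D" "p k / D * p j = p j * p k / D" "p j / D * p k = p j * p k / D"
      using False by simp_all
    ultimately show ?thesis by linarith
  qed
qed

text \<open>The residual with index \<open>s\<close> becomes null at step \<open>s\<close>, at the
  latest; by \<open>gram_schmidt_step\<close> later steps cannot increase its second moment.\<close>

lemma gram_schmidt_zero: "s < n \<Longrightarrow> expectation (\<lambda>x. GS n s x * GS n s x) = 0"
proof (induction n)
  case (Suc n)
  define D where "D = expectation (\<lambda>x. (GS n n x)\<^sup>2)"
  have nonneg: "0 \<le> expectation (\<lambda>x. GS (Suc n) s x * GS (Suc n) s x)"
    by (intro Bochner_Integration.integral_nonneg) simp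
  show ?case
  proof (cases "s = n")
    case False
    then have "expectation (\<lambda>x. GS n s x * GS n s x) = 0" using Suc by simp
    moreover have "0 \<le> cholesky M b s n * cholesky M b s n" by simp
    ultimately show ?thesis using gram_schmidt_step[of n s s] nonneg by linarith
  next
    case True
    show ?thesis
    proof (cases "D = 0")
      case True
      then have "GS (Suc n) n x = GS n n x" for x by (simp add: D_def)
      then show ?thesis using True \<open>s = n\<close> by (simp add: D_def power2_eq_square del: gram_schmidt.simps)
    next
      case False
      then have "GS (Suc n) n x = 0" for x by (simp add: D_def power2_eq_square)
      then show ?thesis using \<open>s = n\<close> by (simp del: gram_schmidt.simps)
    qed
  qed
qed simp

lemma gram_schmidt_null: "s < n \<Longrightarrow> expectation (\<lambda>x. GS n s x * GS n k x) = 0"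
proof -
  assume "s < n"
  then have "AE x in M. GS n s x * GS n s x = 0"
    using gram_schmidt_zero integrable_gram_schmidt by (subst integral_nonneg_eq_0_iff_AE[symmetric]) auto
  then have "AE x in M. GS n s x * GS n k x = 0" by eventually_elim auto
  then show ?thesis by (subst integral_cong_AE[where g = "\<lambda>_. 0"]) auto
qed

text \<open>The rank one corrections are summed over \<open>n\<close> steps; after these the
  residual with index \<open>j < n\<close> is null, so its entry of the remaining Gram matrix
  vanishes.\<close>

lemma cholesky_decomposition:
  assumes "j < n" shows "expectation (\<lambda>x. b j x * b k x) = (\<Sum>s<n. cholesky M b j s * cholesky M b k s)"
proof -
  have "expectation (\<lambda>x. b j x * b k x)
      = expectation (\<lambda>x. GS m j x * GS m k x) + (\<Sum>s<m. cholesky M b j s * cholesky M b k s)" for m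
  proof (induction m)
    case (Suc m)
    then show ?case using gram_schmidt_step[of m j k] by (simp del: gram_schmidt.simps(2))
  qed simp
  from this[of n] show ?thesis using gram_schmidt_null[OF assms] by simp
qed

lemma cholesky_triangular: "k < s \<Longrightarrow> cholesky M b k s = 0"
  by (simp add: cholesky_def gram_schmidt_null)

end

end

text \<open>Riesz-Fischer: the squared norm of a block of the series is the same block of the sum of
  squares, so the Cauchy criterion transfers.\<close>

lemma square_summable_imp_summable:
  fixes \<phi> :: "nat \<Rightarrow> 'a::{real_inner, banach}"
  assumes on: "\<And>i j. \<phi> i \<bullet> \<phi> j = (if i = j then 1 else 0)" and sum: "summable (\<lambda>k. (a k)\<^sup>2)"
  shows "summable (\<lambda>k. a k *\<^sub>R \<phi> k)"
proof (subst summable_Cauchy, intro allI impI)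
  fix e :: real assume e: "0 < e"
  then obtain N where N: "\<And>m n. N \<le> m \<Longrightarrow> norm (\<Sum>k\<in>{m..<n}. (a k)\<^sup>2) < e\<^sup>2"
    using sum unfolding summable_Cauchy by (meson zero_less_power)
  show "\<exists>N. \<forall>m\<ge>N. \<forall>n. norm (\<Sum>k\<in>{m..<n}. a k *\<^sub>R \<phi> k) < e"
  proof (intro exI[of _ N] allI impI)
    fix m n assume "N \<le> m"
    have "(norm (\<Sum>k\<in>{m..<n}. a k *\<^sub>R \<phi> k))\<^sup>2 = (\<Sum>k\<in>{m..<n}. (a k)\<^sup>2)"
      unfolding power2_norm_eq_inner
      by (simp add: inner_sum_left inner_sum_right on if_distrib sum.delta power2_eq_square cong: if_cong)
    also have "\<dots> < e\<^sup>2" using N[OF \<open>N \<le> m\<close>, of n] by (simp add: sum_nonneg)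
    finally show "norm (\<Sum>k\<in>{m..<n}. a k *\<^sub>R \<phi> k) < e" using e by (intro power2_less_imp_less[of _ e]) auto
  qed
qed

section \<open>Normal laws, white noise and the construction of Gaussian elements\<close>

lemma normal_law_eq_distr:
  assumes "0 \<le> v" shows "normal_law 0 v = distr std_normal_distribution borel (\<lambda>x. sqrt v * x)"
proof (cases "v = 0")
  case True
  interpret real_distribution std_normal_distribution by (rule real_dist_normal_dist)
  have "distr std_normal_distribution borel (\<lambda>x. 0) = return borel (0::real)"
    by (rule distr_const) auto
  then show ?thesis using True by (simp add: normal_law_def)
next
  case False
  interpret real_distribution std_normal_distribution by (rule real_dist_normal_dist)
  have "distributed std_normal_distribution lborel (\<lambda>x. x) (normal_density 0 1)"
    unfolding distributed_def by (auto simp: distr_id2)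
  then have "distributed std_normal_distribution lborel (\<lambda>x. 0 + sqrt v * x) (normal_density (0 + sqrt v * 0) (\<bar>sqrt v\<bar> * 1))"
    by (rule normal_density_affine) (use False assms in auto)
  then have "distr std_normal_distribution lborel (\<lambda>x. sqrt v * x) = density lborel (normal_density 0 (sqrt v))"
    using assms by (simp add: distributed_def)
  then show ?thesis using False by (simp add: normal_law_def cong: distr_cong)
qed

lemma real_distribution_normal_law:
  assumes "0 \<le> v" shows "real_distribution (normal_law 0 v)"
proof -
  interpret real_distribution std_normal_distribution by (rule real_dist_normal_dist)
  show ?thesis unfolding normal_law_eq_distr[OF assms] by (rule real_distribution_distr) simp
qed

lemma char_normal_law:
  assumes "0 \<le> v" shows "char (normal_law 0 v) t = exp (- (t\<^sup>2 * v) / 2)"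
proof -
  have "char (normal_law 0 v) t = char std_normal_distribution (t * sqrt v)"
    unfolding normal_law_eq_distr[OF assms] char_def by (subst integral_distr) (auto simp: mult.assoc)
  then show ?thesis using assms by (simp add: char_std_normal_distribution power_mult_distrib exp_of_real)
qed

lemma normal_law_second_moment:
  assumes "0 \<le> v"
  shows "integrable (normal_law 0 v) (\<lambda>x. x\<^sup>2)" "(\<integral>x. x\<^sup>2 \<partial>normal_law 0 v) = v"
proof -
  have 1: "integrable std_normal_distribution (\<lambda>x. x\<^sup>2)" "(LINT x|std_normal_distribution. x\<^sup>2) = 1"
    using std_normal_distribution_even_moments[of 1] by simp_all
  show "integrable (normal_law 0 v) (\<lambda>x. x\<^sup>2)"
    unfolding normal_law_eq_distr[OF assms] using 1(1) by (subst integrable_distr_eq) (auto simp: power_mult_distrib)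
  show "(\<integral>x. x\<^sup>2 \<partial>normal_law 0 v) = v"
    unfolding normal_law_eq_distr[OF assms] using 1(2) assms by (subst integral_distr) (auto simp: power_mult_distrib)
qed

abbreviation white_noise :: "(nat \<Rightarrow> real) measure" where
  "white_noise \<equiv> PiM UNIV (\<lambda>_. std_normal_distribution)"

lemma prob_space_white_noise: "prob_space white_noise"
  using real_dist_normal_dist by (intro prob_space_PiM) (simp add: real_distribution_def)

lemma white_noise_coord_measurable: "(\<lambda>\<omega>. \<omega> s) \<in> borel_measurable white_noise"
proof -
  have "(\<lambda>\<omega>. \<omega> s) \<in> measurable white_noise std_normal_distribution"
    by (rule measurable_component_singleton) simp
  then show ?thesis by (subst (asm) measurable_cong_sets[OF refl, of _ borel]) auto
qed

lemma white_noise_law: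
  "distr white_noise borel (\<lambda>\<omega>. \<Sum>s<n. c s * \<omega> s) = normal_law 0 (\<Sum>s<n. (c s)\<^sup>2)"
proof (rule Levy_uniqueness)
  interpret prob_space white_noise by (rule prob_space_white_noise)
  have [measurable]: "(\<lambda>\<omega>. \<omega> s) \<in> borel_measurable white_noise" for s by (rule white_noise_coord_measurable)
  show "real_distribution (distr white_noise borel (\<lambda>\<omega>. \<Sum>s<n. c s * \<omega> s))"
    by (rule real_distribution_distr) measurable
  show "real_distribution (normal_law 0 (\<Sum>s<n. (c s)\<^sup>2))"
    by (intro real_distribution_normal_law sum_nonneg) auto
  have coord: "distr white_noise borel (\<lambda>\<omega>. \<omega> s) = std_normal_distribution" for s
  proof -
    have "distr white_noise borel (\<lambda>\<omega>. \<omega> s) = distr white_noise std_normal_distribution (\<lambda>\<omega>. \<omega> s)"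
      by (rule distr_cong) auto
    also have "\<dots> = std_normal_distribution"
      using real_dist_normal_dist by (intro distr_PiM_component) (auto simp: real_distribution_def)
    finally show ?thesis .
  qed
  have indep: "indep_vars (\<lambda>_. borel) (\<lambda>s \<omega>. \<omega> s) (UNIV :: nat set)"
  proof (subst indep_vars_iff_distr_eq_PiM)
    have "distr white_noise (PiM UNIV (\<lambda>_. borel)) (\<lambda>x. \<lambda>i\<in>UNIV. x i) = distr white_noise white_noise (\<lambda>x. x)"
      by (rule distr_cong) (auto intro!: sets_PiM_cong simp: restrict_def)
    then show "distr white_noise (PiM UNIV (\<lambda>_. borel)) (\<lambda>x. \<lambda>i\<in>UNIV. x i)
        = PiM UNIV (\<lambda>i. distr white_noise borel (\<lambda>\<omega>. \<omega> i))"
      by (simp add: coord)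
  qed auto
  have indep': "indep_vars (\<lambda>_. borel) (\<lambda>s \<omega>. c s * \<omega> s) {..<n}"
    by (rule indep_vars_subset[OF indep_vars_compose2[OF indep]]) auto
  show "char (distr white_noise borel (\<lambda>\<omega>. \<Sum>s<n. c s * \<omega> s)) = char (normal_law 0 (\<Sum>s<n. (c s)\<^sup>2))"
  proof
    fix t
    have "char (distr white_noise borel (\<lambda>\<omega>. c s * \<omega> s)) t = exp (- (t\<^sup>2 * (c s)\<^sup>2) / 2)" for s
    proof -
      have "char (distr white_noise borel (\<lambda>\<omega>. c s * \<omega> s)) t = char (distr white_noise borel (\<lambda>\<omega>. \<omega> s)) (t * c s)"
        unfolding char_def by (subst (1 2) integral_distr) (auto simp: mult.assoc)
      then show ?thesis by (simp add: coord char_std_normal_distribution power_mult_distrib exp_of_real)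
    qed
    then have "char (distr white_noise borel (\<lambda>\<omega>. \<Sum>s<n. c s * \<omega> s)) t = (\<Prod>s<n. exp (- (t\<^sup>2 * (c s)\<^sup>2) / 2))"
      by (simp add: char_distr_sum[OF indep'])
    also have "\<dots> = exp (\<Sum>s<n. - (t\<^sup>2 * (c s)\<^sup>2) / 2)" by (simp add: exp_sum)
    also have "(\<Sum>s<n. - (t\<^sup>2 * (c s)\<^sup>2) / 2) = - (t\<^sup>2 * (\<Sum>s<n. (c s)\<^sup>2)) / 2"
      by (simp add: sum_negf sum_divide_distrib sum_distrib_left)
    finally show "char (distr white_noise borel (\<lambda>\<omega>. \<Sum>s<n. c s * \<omega> s)) t = char (normal_law 0 (\<Sum>s<n. (c s)\<^sup>2)) t"
      by (simp add: char_normal_law sum_nonneg)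
  qed
qed

text \<open>The Cholesky factor of the coordinates of \<open>W\<close>, applied to white noise,
  gives Gaussian coordinates \<open>Z k\<close> with the right covariances. Boundedness of
  \<open>W\<close> makes the series \<open>Z k \<omega> *\<^sub>R \<phi> k\<close> converge almost
  surely, and the law of \<open>l \<bullet> G\<close> is the limit of the laws of the partial sums,
  identified by characteristic functions.\<close>

lemma gaussian_exists:
  fixes W :: "'c \<Rightarrow> 'a::{real_inner, banach, second_countable_topology}"
  assumes "prob_space \<mu>" and [measurable]: "W \<in> borel_measurable \<mu>" and bdd: "\<And>x. norm (W x) \<le> C"
    and basis: "orthonormal_basis (\<phi> :: nat \<Rightarrow> 'a)"
  shows "\<exists>N :: 'a measure. prob_space N \<and> sets N = sets borel \<and>
    (\<forall>l. distr N borel (\<lambda>z. l \<bullet> z) = normal_law 0 (\<integral>x. (l \<bullet> W x)\<^sup>2 \<partial>\<mu>))"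
proof -
  interpret \<mu>: prob_space \<mu> by fact
  interpret \<Omega>: prob_space white_noise by (rule prob_space_white_noise)
  interpret onb \<phi> by unfold_locales fact
  have [measurable]: "(\<lambda>\<omega>. \<omega> s) \<in> borel_measurable white_noise" for s by (rule white_noise_coord_measurable)
  have C0: "0 \<le> C" using bdd[of undefined] norm_ge_zero order_trans by blast
  define b where "b k x = W x \<bullet> \<phi> k" for k x
  have meas: "b k \<in> borel_measurable \<mu>" for k unfolding b_def by measurable
  have bC: "\<bar>b k x\<bar> \<le> C" for k x
    using Cauchy_Schwarz_ineq2[of "W x" "\<phi> k"] bdd[of x] by (simp add: b_def)
  have bdd': "\<exists>B. \<forall>x. \<bar>b k x\<bar> \<le> B" for k using bC by blast
  have ibb: "integrable \<mu> (\<lambda>x. b j x * b k x)" for j k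
    using \<mu>.integrable_gram_schmidt[OF meas bdd', where s = 0 and t = 0 and j = j and k = k] by simp
  define a where "a = cholesky \<mu> b"
  have cov: "(\<integral>x. b j x * b k x \<partial>\<mu>) = (\<Sum>s<n. a j s * a k s)" if "j < n" for j k n
    unfolding a_def by (rule \<mu>.cholesky_decomposition[OF meas bdd' that])
  have tri: "a k s = 0" if "k < s" for k s
    unfolding a_def by (rule \<mu>.cholesky_triangular[OF meas bdd' that])
  define Z where "Z k \<omega> = (\<Sum>s<Suc k. a k s * \<omega> s)" for k and \<omega> :: "nat \<Rightarrow> real"
  have [measurable]: "Z k \<in> borel_measurable white_noise" for k unfolding Z_def by measurable
  \<comment> \<open>Triangularity lets the sum run up to any \<open>n > k\<close>, so a partial sum
    over \<open>k < n\<close> is a linear form in the first \<open>n\<close> noise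
    coordinates.\<close>
  have Z_eq: "Z k \<omega> = (\<Sum>s<n. a k s * \<omega> s)" if "k < n" for k n \<omega>
    unfolding Z_def by (rule sum.mono_neutral_left) (use that tri in auto)
  have sqZ: "integrable white_noise (\<lambda>\<omega>. (Z k \<omega>)\<^sup>2)" "(\<integral>\<omega>. (Z k \<omega>)\<^sup>2 \<partial>white_noise) = (\<integral>x. (b k x)\<^sup>2 \<partial>\<mu>)" for k
  proof -
    have v: "(\<Sum>s<Suc k. (a k s)\<^sup>2) = (\<integral>x. (b k x)\<^sup>2 \<partial>\<mu>)" using cov[of k "Suc k" k] by (simp add: power2_eq_square)
    have law: "distr white_noise borel (Z k) = normal_law 0 (\<integral>x. (b k x)\<^sup>2 \<partial>\<mu>)"
      unfolding v[symmetric] Z_def[abs_def] by (rule white_noise_law)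
    have v0: "0 \<le> (\<integral>x. (b k x)\<^sup>2 \<partial>\<mu>)" by simp
    show "integrable white_noise (\<lambda>\<omega>. (Z k \<omega>)\<^sup>2)"
      using normal_law_second_moment(1)[OF v0] unfolding law[symmetric] by (subst (asm) integrable_distr_eq) auto
    show "(\<integral>\<omega>. (Z k \<omega>)\<^sup>2 \<partial>white_noise) = (\<integral>x. (b k x)\<^sup>2 \<partial>\<mu>)"
      using normal_law_second_moment(2)[OF v0] unfolding law[symmetric] by (subst (asm) integral_distr) (auto simp: law)
  qed
  have ib2: "integrable \<mu> (\<lambda>x. (b k x)\<^sup>2)" for k using ibb[of k k] by (simp add: power2_eq_square)
  \<comment> \<open>\<open>Z k\<close> and \<open>b k\<close> have equal second moments, and those
    of the \<open>b k\<close> add up to the mean of \<open>(norm (W x))\<^sup>2\<close> by Tonelli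
    and Parseval.\<close>
  have summ: "AE \<omega> in white_noise. summable (\<lambda>k. (Z k \<omega>)\<^sup>2)"
  proof -
    have "(\<integral>\<^sup>+\<omega>. (\<Sum>k. ennreal ((Z k \<omega>)\<^sup>2)) \<partial>white_noise) = (\<Sum>k. \<integral>\<^sup>+\<omega>. ennreal ((Z k \<omega>)\<^sup>2) \<partial>white_noise)"
      by (rule nn_integral_suminf) measurable
    also have "\<dots> = (\<Sum>k. \<integral>\<^sup>+x. ennreal ((b k x)\<^sup>2) \<partial>\<mu>)"
      using sqZ ib2 by (simp add: nn_integral_eq_integral)
    also have "\<dots> = (\<integral>\<^sup>+x. (\<Sum>k. ennreal ((b k x)\<^sup>2)) \<partial>\<mu>)"
      by (rule nn_integral_suminf[symmetric]) (use meas in measurable)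
    also have "\<dots> = (\<integral>\<^sup>+x. ennreal ((norm (W x))\<^sup>2) \<partial>\<mu>)"
      using Parseval by (intro nn_integral_cong) (auto simp: b_def intro!: suminf_ennreal_eq)
    also have "\<dots> \<le> (\<integral>\<^sup>+x. ennreal (C\<^sup>2) \<partial>\<mu>)"
      using bdd C0 by (intro nn_integral_mono ennreal_leI power_mono) auto
    also have "\<dots> < \<infinity>" by (simp add: \<mu>.emeasure_space_1)
    finally have "AE \<omega> in white_noise. (\<Sum>k. ennreal ((Z k \<omega>)\<^sup>2)) \<noteq> \<infinity>"
      by (intro nn_integral_PInf_AE) auto
    then show ?thesis by eventually_elim (auto intro: summable_suminf_not_top)
  qed
  define G where "G \<omega> = (\<Sum>k. Z k \<omega> *\<^sub>R \<phi> k)" for \<omega>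
  have [measurable]: "G \<in> borel_measurable white_noise" unfolding G_def by measurable
  have Glim: "AE \<omega> in white_noise. (\<lambda>n. \<Sum>k<n. (l \<bullet> \<phi> k) * Z k \<omega>) \<longlonglongrightarrow> l \<bullet> G \<omega>" for l
    using summ
  proof eventually_elim
    case (elim \<omega>)
    have "summable (\<lambda>k. Z k \<omega> *\<^sub>R \<phi> k)" by (rule square_summable_imp_summable[OF inner_basis elim])
    then have "(\<lambda>k. Z k \<omega> *\<^sub>R \<phi> k) sums G \<omega>" unfolding G_def by (rule summable_sums)
    then have "(\<lambda>n. l \<bullet> (\<Sum>k<n. Z k \<omega> *\<^sub>R \<phi> k)) \<longlonglongrightarrow> l \<bullet> G \<omega>" unfolding sums_def by (intro tendsto_intros)
    then show ?case by (simp add: inner_sum_right mult.commute)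
  qed
  have law: "distr white_noise borel (\<lambda>\<omega>. l \<bullet> G \<omega>) = normal_law 0 (\<integral>x. (l \<bullet> W x)\<^sup>2 \<partial>\<mu>)" for l
  proof (rule Levy_uniqueness)
    show "real_distribution (distr white_noise borel (\<lambda>\<omega>. l \<bullet> G \<omega>))"
      by (rule \<Omega>.real_distribution_distr) measurable
    show "real_distribution (normal_law 0 (\<integral>x. (l \<bullet> W x)\<^sup>2 \<partial>\<mu>))" by (rule real_distribution_normal_law) simp
    show "char (distr white_noise borel (\<lambda>\<omega>. l \<bullet> G \<omega>)) = char (normal_law 0 (\<integral>x. (l \<bullet> W x)\<^sup>2 \<partial>\<mu>))"
    proof
      fix t
      define S where "S n \<omega> = (\<Sum>k<n. (l \<bullet> \<phi> k) * Z k \<omega>)" for n \<omega>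
      have [measurable]: "S n \<in> borel_measurable white_noise" for n unfolding S_def by measurable
      define c where "c n s = (\<Sum>k<n. (l \<bullet> \<phi> k) * a k s)" for n s
      have Sc: "S n \<omega> = (\<Sum>s<n. c n s * \<omega> s)" for n \<omega>
      proof -
        have "S n \<omega> = (\<Sum>k<n. \<Sum>s<n. (l \<bullet> \<phi> k) * (a k s * \<omega> s))"
          unfolding S_def by (intro sum.cong refl) (simp add: Z_eq sum_distrib_left)
        also have "\<dots> = (\<Sum>s<n. \<Sum>k<n. (l \<bullet> \<phi> k) * (a k s * \<omega> s))" by (rule sum.swap)
        finally show ?thesis by (simp add: c_def sum_distrib_right mult.assoc)
      qed
      \<comment> \<open>The factorization is read backwards: the variance of the partial sum is the
        second moment of \<open>l\<close> against the projected \<open>W\<close>, which converges as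
        \<open>n\<close> grows.\<close>
      have v: "(\<Sum>s<n. (c n s)\<^sup>2) = (\<integral>x. (l \<bullet> \<pi> n (W x))\<^sup>2 \<partial>\<mu>)" for n
      proof -
        have "(\<integral>x. (l \<bullet> \<pi> n (W x))\<^sup>2 \<partial>\<mu>) = (\<integral>x. (\<Sum>j<n. \<Sum>k<n. (l \<bullet> \<phi> j) * (l \<bullet> \<phi> k) * (b j x * b k x)) \<partial>\<mu>)"
          by (simp add: coord_proj_def inner_sum_right b_def power2_eq_square sum_product mult_ac)
        also have "\<dots> = (\<Sum>j<n. \<Sum>k<n. (l \<bullet> \<phi> j) * (l \<bullet> \<phi> k) * (\<integral>x. b j x * b k x \<partial>\<mu>))"
          by (simp add: ibb)
        also have "\<dots> = (\<Sum>j<n. \<Sum>k<n. \<Sum>s<n. ((l \<bullet> \<phi> j) * a j s) * ((l \<bullet> \<phi> k) * a k s))"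
          by (intro sum.cong refl) (simp add: cov sum_distrib_left mult_ac)
        also have "\<dots> = (\<Sum>j<n. \<Sum>s<n. \<Sum>k<n. ((l \<bullet> \<phi> j) * a j s) * ((l \<bullet> \<phi> k) * a k s))"
          by (intro sum.cong refl sum.swap)
        also have "\<dots> = (\<Sum>s<n. \<Sum>j<n. \<Sum>k<n. ((l \<bullet> \<phi> j) * a j s) * ((l \<bullet> \<phi> k) * a k s))"
          by (rule sum.swap)
        finally show ?thesis by (simp add: c_def power2_eq_square sum_product)
      qed
      have "(\<lambda>n. CLINT \<omega>|white_noise. iexp (t * S n \<omega>)) \<longlonglongrightarrow> (CLINT \<omega>|white_noise. iexp (t * (l \<bullet> G \<omega>)))"
      proof (rule integral_dominated_convergence[where w = "\<lambda>_. 1"])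
        show "AE \<omega> in white_noise. (\<lambda>n. iexp (t * S n \<omega>)) \<longlonglongrightarrow> iexp (t * (l \<bullet> G \<omega>))"
          using Glim[of l] by eventually_elim (unfold S_def, intro tendsto_intros)
      qed auto
      moreover have "(CLINT \<omega>|white_noise. iexp (t * S n \<omega>)) = exp (- (t\<^sup>2 * (\<integral>x. (l \<bullet> \<pi> n (W x))\<^sup>2 \<partial>\<mu>)) / 2)" for n
      proof -
        have "(CLINT \<omega>|white_noise. iexp (t * S n \<omega>)) = char (distr white_noise borel (S n)) t"
          unfolding char_def by (subst integral_distr) auto
        also have "distr white_noise borel (S n) = normal_law 0 (\<integral>x. (l \<bullet> \<pi> n (W x))\<^sup>2 \<partial>\<mu>)"
          unfolding v[symmetric] Sc[abs_def] by (rule white_noise_law)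
        also have "char \<dots> t = exp (- (t\<^sup>2 * (\<integral>x. (l \<bullet> \<pi> n (W x))\<^sup>2 \<partial>\<mu>)) / 2)" by (rule char_normal_law) simp
        finally show ?thesis .
      qed
      moreover have "(\<lambda>n. complex_of_real (exp (- (t\<^sup>2 * (\<integral>x. (l \<bullet> \<pi> n (W x))\<^sup>2 \<partial>\<mu>)) / 2)))
          \<longlonglongrightarrow> complex_of_real (exp (- (t\<^sup>2 * (\<integral>x. (l \<bullet> W x)\<^sup>2 \<partial>\<mu>)) / 2))"
      proof (intro tendsto_intros)
        show "(\<lambda>n. \<integral>x. (l \<bullet> \<pi> n (W x))\<^sup>2 \<partial>\<mu>) \<longlonglongrightarrow> (\<integral>x. (l \<bullet> W x)\<^sup>2 \<partial>\<mu>)"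
        proof (rule integral_dominated_convergence[where w = "\<lambda>_. (norm l * C)\<^sup>2"])
          show "AE x in \<mu>. (\<lambda>n. (l \<bullet> \<pi> n (W x))\<^sup>2) \<longlonglongrightarrow> (l \<bullet> W x)\<^sup>2"
            by (intro AE_I2 tendsto_intros proj_tendsto)
          show "AE x in \<mu>. norm ((l \<bullet> \<pi> n (W x))\<^sup>2) \<le> (norm l * C)\<^sup>2" for n
          proof (intro AE_I2)
            fix x
            have "\<bar>l \<bullet> \<pi> n (W x)\<bar> \<le> norm l * norm (\<pi> n (W x))" by (rule Cauchy_Schwarz_ineq2)
            also have "\<dots> \<le> norm l * C"
              using norm_proj_le[of n "W x"] bdd[of x] by (intro mult_left_mono) auto
            finally have "\<bar>l \<bullet> \<pi> n (W x)\<bar>\<^sup>2 \<le> (norm l * C)\<^sup>2" by (intro power_mono) auto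
            then show "norm ((l \<bullet> \<pi> n (W x))\<^sup>2) \<le> (norm l * C)\<^sup>2" by simp
          qed
        qed auto
      qed auto
      ultimately have "(CLINT \<omega>|white_noise. iexp (t * (l \<bullet> G \<omega>))) = exp (- (t\<^sup>2 * (\<integral>x. (l \<bullet> W x)\<^sup>2 \<partial>\<mu>)) / 2)"
        by (simp add: LIMSEQ_unique)
      then show "char (distr white_noise borel (\<lambda>\<omega>. l \<bullet> G \<omega>)) t = char (normal_law 0 (\<integral>x. (l \<bullet> W x)\<^sup>2 \<partial>\<mu>)) t"
        unfolding char_def[of "distr _ _ _"] by (subst integral_distr) (auto simp: char_normal_law)
    qed
  qed
  define N where "N = distr white_noise borel G"
  have "prob_space N" unfolding N_def by (rule \<Omega>.prob_space_distr) measurable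
  moreover have "sets N = sets borel" by (simp add: N_def)
  moreover have "distr N borel (\<lambda>z. l \<bullet> z) = normal_law 0 (\<integral>x. (l \<bullet> W x)\<^sup>2 \<partial>\<mu>)" for l
    unfolding N_def by (subst distr_distr) (auto simp: comp_def law)
  ultimately show ?thesis by blast
qed

section \<open>Sums of independent identically distributed elements\<close>

locale iid = prob_space M for M :: "'c measure" +
  fixes \<mu> :: "'a::{metric_space, second_countable_topology} measure" and Xs :: "nat \<Rightarrow> 'c \<Rightarrow> 'a"
  assumes indep: "indep_vars (\<lambda>_. borel) Xs UNIV"
    and ident: "\<And>i. distr M borel (Xs i) = \<mu>"
begin

lemma Xs_measurable [measurable]: "Xs i \<in> borel_measurable M"
  using indep unfolding indep_vars_def by simp

lemma sets_\<mu> [measurable_cong, simp]: "sets \<mu> = sets borel"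
  using ident[of 0] by auto

lemma prob_space_\<mu>: "prob_space \<mu>"
  unfolding ident[of 0, symmetric] by (rule prob_space_distr) measurable

lemma iid_integrable:
  fixes f :: "'a \<Rightarrow> 'h::{banach, second_countable_topology}"
  assumes "integrable \<mu> f" shows "integrable M (\<lambda>\<omega>. f (Xs i \<omega>))"
proof -
  have "integrable (distr M borel (Xs i)) f" using assms by (simp add: ident)
  then show ?thesis by (rule integrable_distr[rotated]) measurable
qed

lemma iid_integral:
  fixes f :: "'a \<Rightarrow> 'h::{banach, second_countable_topology}"
  assumes [measurable]: "f \<in> borel_measurable borel" shows "(\<integral>\<omega>. f (Xs i \<omega>) \<partial>M) = (\<integral>x. f x \<partial>\<mu>)"
  unfolding ident[of i, symmetric] by (rule integral_distr[symmetric]) measurable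

lemma iid_AE:
  assumes "AE x in \<mu>. P x" shows "AE \<omega> in M. P (Xs i \<omega>)"
proof -
  have "AE x in distr M borel (Xs i). P x" using assms unfolding ident .
  then show ?thesis by (rule AE_distrD[rotated]) measurable
qed

lemma iid_sum_integral:
  fixes f :: "'a \<Rightarrow> 'h::{banach, second_countable_topology}"
  assumes "f \<in> borel_measurable borel" "integrable \<mu> f"
  shows "(\<integral>\<omega>. (\<Sum>i<n. f (Xs i \<omega>)) \<partial>M) = real n *\<^sub>R (\<integral>x. f x \<partial>\<mu>)"
  by (subst Bochner_Integration.integral_sum) (auto intro: iid_integrable assms simp: iid_integral[OF assms(1)] scaleR_conv_of_real sum_constant_scaleR)

lemma iid_joint_law:
  assumes "i \<noteq> j"
  shows "distr M (borel \<Otimes>\<^sub>M borel) (\<lambda>\<omega>. (Xs i \<omega>, Xs j \<omega>)) = \<mu> \<Otimes>\<^sub>M \<mu>"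
proof -
  have "indep_var borel (Xs i) borel (Xs j)"
  proof -
    have "indep_var borel ((\<lambda>f. f i) \<circ> (\<lambda>\<omega>. \<lambda>k\<in>{i}. Xs k \<omega>)) borel ((\<lambda>f. f j) \<circ> (\<lambda>\<omega>. \<lambda>k\<in>{j}. Xs k \<omega>))"
      using assms by (intro indep_var_compose[OF indep_var_restrict[OF indep]]) auto
    then show ?thesis by (simp add: comp_def)
  qed
  then have "distr M borel (Xs i) \<Otimes>\<^sub>M distr M borel (Xs j) = distr M (borel \<Otimes>\<^sub>M borel) (\<lambda>\<omega>. (Xs i \<omega>, Xs j \<omega>))"
    unfolding indep_var_distribution_eq by blast
  then show ?thesis by (simp add: ident)
qed

lemma iid_inner:
  fixes f :: "'a \<Rightarrow> 'h::{real_inner, banach, second_countable_topology}"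
  assumes f [measurable]: "f \<in> borel_measurable borel" and sq: "integrable \<mu> (\<lambda>x. (norm (f x))\<^sup>2)"
    and mean: "(\<integral>x. f x \<partial>\<mu>) = 0"
  shows "integrable M (\<lambda>\<omega>. f (Xs i \<omega>) \<bullet> f (Xs j \<omega>))"
    "(\<integral>\<omega>. f (Xs i \<omega>) \<bullet> f (Xs j \<omega>) \<partial>M) = (if i = j then \<integral>x. (norm (f x))\<^sup>2 \<partial>\<mu> else 0)"
proof -
  interpret \<mu>: prob_space \<mu> by (rule prob_space_\<mu>)
  interpret pair: pair_sigma_finite \<mu> \<mu> ..
  have "integrable \<mu> (\<lambda>x. norm (f x))"
    by (rule \<mu>.square_integrable_imp_integrable[OF _ sq]) measurable
  then have if': "integrable \<mu> f" by (simp add: integrable_norm_iff)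
  show int: "integrable M (\<lambda>\<omega>. f (Xs i \<omega>) \<bullet> f (Xs j \<omega>))" for i j
  proof (rule Bochner_Integration.integrable_bound)
    show "integrable M (\<lambda>\<omega>. (norm (f (Xs i \<omega>)))\<^sup>2 + (norm (f (Xs j \<omega>)))\<^sup>2)"
      by (intro Bochner_Integration.integrable_add iid_integrable[OF sq])
    show "AE \<omega> in M. norm (f (Xs i \<omega>) \<bullet> f (Xs j \<omega>)) \<le> norm ((norm (f (Xs i \<omega>)))\<^sup>2 + (norm (f (Xs j \<omega>)))\<^sup>2)"
    proof (intro AE_I2)
      fix \<omega>
      let ?a = "norm (f (Xs i \<omega>))" and ?b = "norm (f (Xs j \<omega>))"
      have "\<bar>f (Xs i \<omega>) \<bullet> f (Xs j \<omega>)\<bar> \<le> ?a * ?b" by (rule Cauchy_Schwarz_ineq2)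
      also have "\<dots> \<le> ?a\<^sup>2 + ?b\<^sup>2"
      proof -
        have "0 \<le> ?a * ?b" by simp
        then show ?thesis using sum_squares_bound[of ?a ?b] by linarith
      qed
      finally show "norm (f (Xs i \<omega>) \<bullet> f (Xs j \<omega>)) \<le> norm (?a\<^sup>2 + ?b\<^sup>2)" by simp
    qed
  qed measurable
  show "(\<integral>\<omega>. f (Xs i \<omega>) \<bullet> f (Xs j \<omega>) \<partial>M) = (if i = j then \<integral>x. (norm (f x))\<^sup>2 \<partial>\<mu> else 0)"
  proof (cases "i = j")
    case True
    then show ?thesis using iid_integral[of "\<lambda>x. (norm (f x))\<^sup>2" j] by (simp add: power2_norm_eq_inner)
  next
    case False
    let ?X = "\<lambda>\<omega>. (Xs i \<omega>, Xs j \<omega>)"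
    have "integrable (distr M (borel \<Otimes>\<^sub>M borel) ?X) (\<lambda>(x, y). f x \<bullet> f y)"
      using int[of i j] by (subst integrable_distr_eq) auto
    then have ip: "integrable (\<mu> \<Otimes>\<^sub>M \<mu>) (\<lambda>(x, y). f x \<bullet> f y)" by (simp only: iid_joint_law[OF False])
    have "(\<integral>\<omega>. f (Xs i \<omega>) \<bullet> f (Xs j \<omega>) \<partial>M) = (\<integral>z. (case z of (x, y) \<Rightarrow> f x \<bullet> f y) \<partial>distr M (borel \<Otimes>\<^sub>M borel) ?X)"
      by (subst integral_distr) auto
    also have "\<dots> = (\<integral>z. (case z of (x, y) \<Rightarrow> f x \<bullet> f y) \<partial>(\<mu> \<Otimes>\<^sub>M \<mu>))" by (simp only: iid_joint_law[OF False])
    also have "\<dots> = (\<integral>x. \<integral>y. f x \<bullet> f y \<partial>\<mu> \<partial>\<mu>)" by (rule pair.integral_fst[OF ip, symmetric])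
    also have "\<dots> = 0" using if' mean by simp
    finally show ?thesis using False by simp
  qed
qed

lemma iid_sum_second_moment:
  fixes f :: "'a \<Rightarrow> 'h::{real_inner, banach, second_countable_topology}"
  assumes "f \<in> borel_measurable borel" "integrable \<mu> (\<lambda>x. (norm (f x))\<^sup>2)" "(\<integral>x. f x \<partial>\<mu>) = 0"
  shows "integrable M (\<lambda>\<omega>. (norm (\<Sum>i<n. f (Xs i \<omega>)))\<^sup>2)"
    "(\<integral>\<omega>. (norm (\<Sum>i<n. f (Xs i \<omega>)))\<^sup>2 \<partial>M) = real n * (\<integral>x. (norm (f x))\<^sup>2 \<partial>\<mu>)"
proof -
  have eq: "(norm (\<Sum>i<n. f (Xs i \<omega>)))\<^sup>2 = (\<Sum>i<n. \<Sum>j<n. f (Xs i \<omega>) \<bullet> f (Xs j \<omega>))" for \<omega>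
    unfolding power2_norm_eq_inner by (simp add: inner_sum_left inner_sum_right) (rule sum.swap)
  note ii = iid_inner[OF assms]
  show "integrable M (\<lambda>\<omega>. (norm (\<Sum>i<n. f (Xs i \<omega>)))\<^sup>2)" unfolding eq by (intro Bochner_Integration.integrable_sum ii)
  have "(\<integral>\<omega>. (norm (\<Sum>i<n. f (Xs i \<omega>)))\<^sup>2 \<partial>M) = (\<Sum>i<n. \<Sum>j<n. \<integral>\<omega>. f (Xs i \<omega>) \<bullet> f (Xs j \<omega>) \<partial>M)"
    unfolding eq using ii(1) by (simp add: Bochner_Integration.integral_sum)
  also have "\<dots> = real n * (\<integral>x. (norm (f x))\<^sup>2 \<partial>\<mu>)" by (simp add: ii(2) sum.delta)
  finally show "(\<integral>\<omega>. (norm (\<Sum>i<n. f (Xs i \<omega>)))\<^sup>2 \<partial>M) = real n * (\<integral>x. (norm (f x))\<^sup>2 \<partial>\<mu>)" .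
qed

text \<open>Only an inequality in the second claim because of \<open>n = 0\<close>, where the factor
  \<open>1 / sqrt 0\<close> is 0.\<close>

lemma iid_normalized_sum_second_moment:
  fixes f :: "'a \<Rightarrow> 'h::{real_inner, banach, second_countable_topology}"
  assumes f: "f \<in> borel_measurable borel" "integrable \<mu> (\<lambda>x. (norm (f x))\<^sup>2)" "(\<integral>x. f x \<partial>\<mu>) = 0"
  shows "integrable M (\<lambda>\<omega>. (norm ((1 / sqrt (real n)) *\<^sub>R (\<Sum>i<n. f (Xs i \<omega>))))\<^sup>2)"
    "(\<integral>\<omega>. (norm ((1 / sqrt (real n)) *\<^sub>R (\<Sum>i<n. f (Xs i \<omega>))))\<^sup>2 \<partial>M) \<le> (\<integral>x. (norm (f x))\<^sup>2 \<partial>\<mu>)"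
proof -
  have eq: "(norm ((1 / sqrt (real n)) *\<^sub>R v))\<^sup>2 = (1 / real n) * (norm v)\<^sup>2" for v :: 'h
    by (simp add: power_divide power_mult_distrib)
  show "integrable M (\<lambda>\<omega>. (norm ((1 / sqrt (real n)) *\<^sub>R (\<Sum>i<n. f (Xs i \<omega>))))\<^sup>2)"
    unfolding eq by (intro integrable_mult_right iid_sum_second_moment f)
  have "(\<integral>\<omega>. (norm ((1 / sqrt (real n)) *\<^sub>R (\<Sum>i<n. f (Xs i \<omega>))))\<^sup>2 \<partial>M) = (1 / real n) * (real n * (\<integral>x. (norm (f x))\<^sup>2 \<partial>\<mu>))"
    unfolding eq integral_mult_right_zero iid_sum_second_moment(2)[OF f] ..
  also have "\<dots> \<le> (\<integral>x. (norm (f x))\<^sup>2 \<partial>\<mu>)" by (cases "n = 0") auto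
  finally show "(\<integral>\<omega>. (norm ((1 / sqrt (real n)) *\<^sub>R (\<Sum>i<n. f (Xs i \<omega>))))\<^sup>2 \<partial>M) \<le> (\<integral>x. (norm (f x))\<^sup>2 \<partial>\<mu>)" .
qed

text \<open>Centring does not increase the second moment, so the usual variance bound holds with the
  raw one. Applied to the columns \<open>curv Q x (\<phi> k)\<close> of the empirical
  Hessian.\<close>

lemma iid_mean_deviation:
  fixes f :: "'a \<Rightarrow> 'h::{real_inner, banach, second_countable_topology}"
  assumes f [measurable]: "f \<in> borel_measurable borel" and sq: "integrable \<mu> (\<lambda>x. (norm (f x))\<^sup>2)" and n: "n > 0"
  shows "integrable M (\<lambda>\<omega>. (norm ((1 / real n) *\<^sub>R (\<Sum>i<n. f (Xs i \<omega>)) - (\<integral>x. f x \<partial>\<mu>)))\<^sup>2)"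
    "(\<integral>\<omega>. (norm ((1 / real n) *\<^sub>R (\<Sum>i<n. f (Xs i \<omega>)) - (\<integral>x. f x \<partial>\<mu>)))\<^sup>2 \<partial>M) \<le> (\<integral>x. (norm (f x))\<^sup>2 \<partial>\<mu>) / real n"
proof -
  interpret \<mu>: prob_space \<mu> by (rule prob_space_\<mu>)
  define m where "m = (\<integral>x. f x \<partial>\<mu>)"
  have "integrable \<mu> (\<lambda>x. norm (f x))"
    by (rule \<mu>.square_integrable_imp_integrable[OF _ sq]) measurable
  then have if': "integrable \<mu> f" by (simp add: integrable_norm_iff)
  define g where "g x = f x - m" for x
  have [measurable]: "g \<in> borel_measurable borel" unfolding g_def by measurable
  have g0: "(\<integral>x. g x \<partial>\<mu>) = 0" unfolding g_def using if' by (simp add: m_def \<mu>.prob_space)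
  have gsq: "(norm (g x))\<^sup>2 = (norm (f x))\<^sup>2 - 2 * (f x \<bullet> m) + (norm m)\<^sup>2" for x
    unfolding g_def power2_norm_eq_inner by (simp add: inner_diff_left inner_diff_right inner_commute)
  have ig: "integrable \<mu> (\<lambda>x. (norm (g x))\<^sup>2)" unfolding gsq using sq if' by simp
  have "(\<integral>x. (norm (g x))\<^sup>2 \<partial>\<mu>) = (\<integral>x. (norm (f x))\<^sup>2 \<partial>\<mu>) - 2 * (m \<bullet> m) + (norm m)\<^sup>2"
    unfolding gsq using sq if' by (simp add: \<mu>.prob_space m_def)
  then have le: "(\<integral>x. (norm (g x))\<^sup>2 \<partial>\<mu>) \<le> (\<integral>x. (norm (f x))\<^sup>2 \<partial>\<mu>)" by (simp add: power2_norm_eq_inner)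
  have eq: "(norm ((1 / real n) *\<^sub>R (\<Sum>i<n. f (Xs i \<omega>)) - m))\<^sup>2 = (1 / (real n)\<^sup>2) * (norm (\<Sum>i<n. g (Xs i \<omega>)))\<^sup>2" for \<omega>
  proof -
    have "(\<Sum>i<n. g (Xs i \<omega>)) = (\<Sum>i<n. f (Xs i \<omega>)) - real n *\<^sub>R m"
      by (simp add: g_def sum_subtractf sum_constant_scaleR)
    then have "(1 / real n) *\<^sub>R (\<Sum>i<n. f (Xs i \<omega>)) - m = (1 / real n) *\<^sub>R (\<Sum>i<n. g (Xs i \<omega>))"
      using n by (simp add: scaleR_diff_right)
    then show ?thesis by (simp add: power_divide power_mult_distrib)
  qed
  show "integrable M (\<lambda>\<omega>. (norm ((1 / real n) *\<^sub>R (\<Sum>i<n. f (Xs i \<omega>)) - (\<integral>x. f x \<partial>\<mu>)))\<^sup>2)"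
    unfolding m_def[symmetric] eq by (intro integrable_mult_right iid_sum_second_moment ig g0) measurable
  have "(\<integral>\<omega>. (norm ((1 / real n) *\<^sub>R (\<Sum>i<n. f (Xs i \<omega>)) - m))\<^sup>2 \<partial>M) = (1 / (real n)\<^sup>2) * (real n * (\<integral>x. (norm (g x))\<^sup>2 \<partial>\<mu>))"
    unfolding eq integral_mult_right_zero by (subst iid_sum_second_moment(2)) (auto intro: ig g0)
  also have "\<dots> = (\<integral>x. (norm (g x))\<^sup>2 \<partial>\<mu>) / real n" using n by (simp add: power2_eq_square)
  also have "\<dots> \<le> (\<integral>x. (norm (f x))\<^sup>2 \<partial>\<mu>) / real n" using le by (rule divide_right_mono) simp
  finally show "(\<integral>\<omega>. (norm ((1 / real n) *\<^sub>R (\<Sum>i<n. f (Xs i \<omega>)) - (\<integral>x. f x \<partial>\<mu>)))\<^sup>2 \<partial>M) \<le> (\<integral>x. (norm (f x))\<^sup>2 \<partial>\<mu>) / real n"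
    by (simp only: m_def)
qed

text \<open>The central limit theorem normalizes by the standard deviation \<open>\<sigma>\<close>;
  evaluating its characteristic functions at \<open>\<sigma>\<close> undoes this. For variance 0 the
  sums vanish almost surely.\<close>

lemma iid_real_char_tendsto:
  fixes f :: "'a \<Rightarrow> real"
  assumes f [measurable]: "f \<in> borel_measurable borel" and sq: "integrable \<mu> (\<lambda>x. (f x)\<^sup>2)" and mean: "(\<integral>x. f x \<partial>\<mu>) = 0"
  shows "(\<lambda>n. CLINT \<omega>|M. iexp ((\<Sum>i<n. f (Xs i \<omega>)) / sqrt (real n))) \<longlonglongrightarrow> exp (- (\<integral>x. (f x)\<^sup>2 \<partial>\<mu>) / 2)"
proof (cases "(\<integral>x. (f x)\<^sup>2 \<partial>\<mu>) = 0")
  case True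
  then have "AE x in \<mu>. (f x)\<^sup>2 = 0" using sq by (subst (asm) integral_nonneg_eq_0_iff_AE) auto
  then have "AE x in \<mu>. f x = 0" by simp
  then have "AE \<omega> in M. \<forall>i. f (Xs i \<omega>) = 0" unfolding AE_all_countable using iid_AE by blast
  then have "(CLINT \<omega>|M. iexp ((\<Sum>i<n. f (Xs i \<omega>)) / sqrt (real n))) = (CLINT \<omega>|M. 1)" for n
    by (intro integral_cong_AE) auto
  then show ?thesis using True by (simp add: prob_space)
next
  case False
  define \<sigma> where "\<sigma> = sqrt (\<integral>x. (f x)\<^sup>2 \<partial>\<mu>)"
  have v0: "0 \<le> (\<integral>x. (f x)\<^sup>2 \<partial>\<mu>)" by simp
  then have \<sigma>: "\<sigma> > 0" "\<sigma>\<^sup>2 = (\<integral>x. (f x)\<^sup>2 \<partial>\<mu>)" using False by (auto simp: \<sigma>_def less_le)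
  let ?S = "\<lambda>n \<omega>. (\<Sum>i<n. f (Xs i \<omega>)) / sqrt (real n * \<sigma>\<^sup>2)"
  have mean': "expectation (\<lambda>\<omega>. f (Xs i \<omega>)) = 0" for i by (simp add: iid_integral[OF f] mean)
  have "weak_conv_m (\<lambda>n. distr M borel (?S n)) std_normal_distribution"
  proof (rule central_limit_theorem_zero_mean[where \<mu> = "distr \<mu> borel f"])
    show "indep_vars (\<lambda>i. borel) (\<lambda>i \<omega>. f (Xs i \<omega>)) UNIV" by (rule indep_vars_compose2[OF indep]) simp
    show "integrable M (\<lambda>\<omega>. (f (Xs n \<omega>))\<^sup>2)" for n by (rule iid_integrable[OF sq])
    show "variance (\<lambda>\<omega>. f (Xs n \<omega>)) = \<sigma>\<^sup>2" for n
      using iid_integral[of "\<lambda>x. (f x)\<^sup>2" n] by (simp add: mean' \<sigma>(2))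
    show "distr M borel (\<lambda>\<omega>. f (Xs n \<omega>)) = distr \<mu> borel f" for n
      unfolding ident[of n, symmetric] by (subst distr_distr) (auto simp: comp_def)
  qed (use mean' \<sigma> in auto)
  then have "(\<lambda>n. char (distr M borel (?S n)) \<sigma>) \<longlonglongrightarrow> char std_normal_distribution \<sigma>"
    by (intro levy_continuity1 real_dist_normal_dist real_distribution_distr) auto
  moreover have "char (distr M borel (?S n)) \<sigma> = (CLINT \<omega>|M. iexp ((\<Sum>i<n. f (Xs i \<omega>)) / sqrt (real n)))" for n
  proof -
    have "\<sigma> * ?S n \<omega> = (\<Sum>i<n. f (Xs i \<omega>)) / sqrt (real n)" for \<omega>
      using \<sigma>(1) by (simp add: real_sqrt_mult)
    then show ?thesis unfolding char_def by (subst integral_distr) auto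
  qed
  ultimately show ?thesis by (simp add: char_std_normal_distribution \<sigma>(2) exp_of_real)
qed

end

text \<open>Translates convergence of characteristic functions into the phase-shifted cosines asked
  for by \<open>converges_weakly_Hilbert\<close>.\<close>

lemma (in prob_space) expectation_cos_shift:
  fixes Y :: "'a \<Rightarrow> real"
  assumes [measurable]: "Y \<in> borel_measurable M"
  shows "expectation (\<lambda>\<omega>. cos (Y \<omega> + b)) = Re ((CLINT \<omega>|M. iexp (Y \<omega>)) * iexp b)"
proof -
  have int: "complex_integrable M (\<lambda>\<omega>. iexp (Y \<omega>))" by (rule integrable_iexp) auto
  have "expectation (\<lambda>\<omega>. cos (Y \<omega> + b)) = expectation (\<lambda>\<omega>. Re (iexp (Y \<omega>) * iexp b))"
    by (intro Bochner_Integration.integral_cong refl) (simp add: cos_add Re_exp Im_exp)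
  also have "\<dots> = Re (CLINT \<omega>|M. iexp (Y \<omega>) * iexp b)" using int by (intro integral_Re integrable_mult_left) auto
  also have "(CLINT \<omega>|M. iexp (Y \<omega>) * iexp b) = (CLINT \<omega>|M. iexp (Y \<omega>)) * iexp b" by (rule integral_mult_left_zero)
  finally show ?thesis .
qed

text \<open>The projection residual of a normalized sum is the normalized sum of the residuals, so
  its second moment is at most that of one summand. This gives the tail condition uniformly in
  \<open>n\<close>, and it tends to 0 by dominated convergence.\<close>

theorem (in iid) Hilbert_CLT:
  fixes W :: "'a \<Rightarrow> 'h::{real_inner, banach, second_countable_topology}"
  assumes W [measurable]: "W \<in> borel_measurable borel" and bdd: "\<And>x. norm (W x) \<le> C" and mean: "(\<integral>x. W x \<partial>\<mu>) = 0"
    and basis: "orthonormal_basis (\<phi> :: nat \<Rightarrow> 'h)"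
    and N: "prob_space N" "sets N = sets borel" "\<And>l. distr N borel (\<lambda>z. l \<bullet> z) = normal_law 0 (\<integral>x. (l \<bullet> W x)\<^sup>2 \<partial>\<mu>)"
  shows "converges_weakly M (\<lambda>n \<omega>. (1 / sqrt (real n)) *\<^sub>R (\<Sum>i<n. W (Xs i \<omega>))) N (\<lambda>z. z)"
proof (rule converges_weakly_Hilbert[OF basis prob_space_axioms N(1)])
  interpret \<mu>: prob_space \<mu> by (rule prob_space_\<mu>)
  interpret N: prob_space N by fact
  interpret onb \<phi> by unfold_locales fact
  note [measurable_cong] = N(2)
  let ?V = "\<lambda>n \<omega>. (1 / sqrt (real n)) *\<^sub>R (\<Sum>i<n. W (Xs i \<omega>))"
  show "?V n \<in> borel_measurable M" for n by measurable
  show "(\<lambda>z. z) \<in> borel_measurable N" by measurable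
  have bsq: "(norm (W x))\<^sup>2 \<le> C\<^sup>2" for x using bdd[of x] by (intro power_mono) auto
  have iWsq: "integrable \<mu> (\<lambda>x. (norm (W x))\<^sup>2)"
    by (rule \<mu>.integrable_const_bound[of _ "C\<^sup>2"]) (use bsq in auto)
  have iW: "integrable \<mu> W" by (rule \<mu>.integrable_const_bound[of _ C]) (use bdd in auto)
  note sm = iid_normalized_sum_second_moment[OF W iWsq mean]
  show "integrable M (\<lambda>\<omega>. (norm (?V n \<omega>))\<^sup>2)" for n by (rule sm)
  show "(\<integral>\<omega>. (norm (?V n \<omega>))\<^sup>2 \<partial>M) \<le> (\<integral>x. (norm (W x))\<^sup>2 \<partial>\<mu>)" for n by (rule sm)
  show "(\<integral>\<omega>. (norm (?V n \<omega> - \<pi> k (?V n \<omega>)))\<^sup>2 \<partial>M) \<le> (\<integral>x. (norm (W x - \<pi> k (W x)))\<^sup>2 \<partial>\<mu>)" for n k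
  proof -
    have eq: "?V n \<omega> - \<pi> k (?V n \<omega>) = (1 / sqrt (real n)) *\<^sub>R (\<Sum>i<n. W (Xs i \<omega>) - \<pi> k (W (Xs i \<omega>)))" for \<omega>
      by (simp add: proj_linear_simps linear_sum[OF bounded_linear.linear[OF bounded_linear_coord_proj]] sum_subtractf scaleR_diff_right)
    have m0: "(\<integral>x. W x - \<pi> k (W x) \<partial>\<mu>) = 0"
      using iW by (simp add: mean integral_bounded_linear[OF bounded_linear_coord_proj iW]
          integrable_bounded_linear[OF bounded_linear_coord_proj iW] proj_linear_simps)
    have isq: "integrable \<mu> (\<lambda>x. (norm (W x - \<pi> k (W x)))\<^sup>2)"
      by (rule Bochner_Integration.integrable_bound[OF iWsq]) (auto intro!: AE_I2 power_mono norm_residual_le)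
    show ?thesis unfolding eq by (rule iid_normalized_sum_second_moment(2)[OF _ isq m0]) measurable
  qed
  have "(\<lambda>k. \<integral>x. (norm (W x - \<pi> k (W x)))\<^sup>2 \<partial>\<mu>) \<longlonglongrightarrow> (\<integral>x. 0 \<partial>\<mu>)"
  proof (rule integral_dominated_convergence[where w = "\<lambda>_. C\<^sup>2"])
    show "AE x in \<mu>. (\<lambda>k. (norm (W x - \<pi> k (W x)))\<^sup>2) \<longlonglongrightarrow> 0"
    proof (intro AE_I2)
      fix x
      have "(\<lambda>k. (norm (W x - \<pi> k (W x)))\<^sup>2) \<longlonglongrightarrow> (norm (W x - W x))\<^sup>2" by (intro tendsto_intros proj_tendsto)
      then show "(\<lambda>k. (norm (W x - \<pi> k (W x)))\<^sup>2) \<longlonglongrightarrow> 0" by simp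
    qed
    show "AE x in \<mu>. norm ((norm (W x - \<pi> k (W x)))\<^sup>2) \<le> C\<^sup>2" for k
      using norm_residual_le bsq by (intro AE_I2) (simp, meson norm_ge_zero order_trans power_mono)
  qed auto
  then show "(\<lambda>k. \<integral>x. (norm (W x - \<pi> k (W x)))\<^sup>2 \<partial>\<mu>) \<longlonglongrightarrow> 0" by simp
  fix l b
  define v where "v = (\<integral>x. (l \<bullet> W x)\<^sup>2 \<partial>\<mu>)"
  have v0: "0 \<le> v" by (simp add: v_def)
  have isq: "integrable \<mu> (\<lambda>x. (l \<bullet> W x)\<^sup>2)"
  proof (rule \<mu>.integrable_const_bound[of _ "(norm l * C)\<^sup>2"])
    have "\<bar>l \<bullet> W x\<bar> \<le> norm l * C" for x
      using Cauchy_Schwarz_ineq2[of l "W x"] mult_left_mono[OF bdd[of x], of "norm l"] by simp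
    then have "\<bar>l \<bullet> W x\<bar>\<^sup>2 \<le> (norm l * C)\<^sup>2" for x by (intro power_mono) auto
    then show "AE x in \<mu>. norm ((l \<bullet> W x)\<^sup>2) \<le> (norm l * C)\<^sup>2" by (intro AE_I2) simp
  qed measurable
  have "(\<integral>x. l \<bullet> W x \<partial>\<mu>) = 0" using iW by (simp add: mean)
  then have "(\<lambda>n. CLINT \<omega>|M. iexp ((\<Sum>i<n. l \<bullet> W (Xs i \<omega>)) / sqrt (real n))) \<longlonglongrightarrow> exp (- v / 2)"
    using iid_real_char_tendsto[OF _ isq] by (simp add: v_def)
  moreover have "(\<Sum>i<n. l \<bullet> W (Xs i \<omega>)) / sqrt (real n) = l \<bullet> ?V n \<omega>" for n \<omega>
    by (simp add: inner_sum_right)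
  ultimately have "(\<lambda>n. CLINT \<omega>|M. iexp (l \<bullet> ?V n \<omega>)) \<longlonglongrightarrow> exp (- v / 2)" by simp
  moreover have "(CLINT z|N. iexp (l \<bullet> z)) = exp (- v / 2)"
  proof -
    have "(CLINT z|N. iexp (l \<bullet> z)) = char (distr N borel (\<lambda>z. l \<bullet> z)) 1"
      unfolding char_def by (subst integral_distr) auto
    then show ?thesis using char_normal_law[OF v0, of 1] by (simp add: N(3) v_def)
  qed
  ultimately have "(\<lambda>n. Re ((CLINT \<omega>|M. iexp (l \<bullet> ?V n \<omega>)) * iexp b)) \<longlonglongrightarrow> Re ((CLINT z|N. iexp (l \<bullet> z)) * iexp b)"
    by (intro tendsto_intros) simp
  then show "(\<lambda>n. \<integral>\<omega>. cos (l \<bullet> ?V n \<omega> + b) \<partial>M) \<longlonglongrightarrow> (\<integral>z. cos (l \<bullet> z + b) \<partial>N)"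
    by (subst expectation_cos_shift, measurable) (subst N.expectation_cos_shift, auto)
qed

section \<open>Linearization of the sample quantile\<close>

context onb
begin

text \<open>On the range of the projection the linear forms given by \<open>sgn z\<close> and \<open>sgn (\<pi> d z)\<close> agree up to
  the factor \<open>norm (\<pi> d z) / norm z\<close>, so the coefficients may be taken at \<open>z\<close> itself.\<close>

lemma norm_proj_second_order:
  assumes z: "\<pi> d z \<noteq> 0" and h: "h \<in> basis_span \<phi> d"
  defines "s \<equiv> norm (z - \<pi> d z) / norm z" and "r \<equiv> norm (\<pi> d z)"
  shows "\<bar>norm (\<pi> d z + h) - norm (\<pi> d z) - sgn z \<bullet> h - ((norm h)\<^sup>2 - (sgn z \<bullet> h)\<^sup>2) / (2 * norm z)\<bar>
    \<le> norm h * s + 3 / 2 * (norm h)\<^sup>2 * (s / r) + 9 * norm h ^ 3 / r\<^sup>2"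
proof -
  define R a y \<rho> where "R = norm z" and "a = norm h" and "y = z \<bullet> h" and "\<rho> = r / R"
  have r: "r > 0" using z by (simp add: r_def)
  have rR: "r \<le> R" unfolding r_def R_def by (rule norm_proj_le)
  then have R: "R > 0" using r by linarith
  have \<rho>: "0 < \<rho>" "\<rho> \<le> 1" using r R rR by (auto simp: \<rho>_def)
  have a: "0 \<le> a" by (simp add: a_def)
  have "R - r \<le> norm (z - \<pi> d z)" unfolding R_def r_def by (rule norm_triangle_ineq2)
  then have "(R - r) / R \<le> s" unfolding s_def R_def by (intro divide_right_mono) auto
  \<comment> \<open>\<open>1 - \<rho>\<close> is the relative loss of length under projection, at
    most the relative length of the removed part.\<close>
  then have ts: "1 - \<rho> \<le> s" using R by (simp add: \<rho>_def diff_divide_distrib)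
  have y: "\<pi> d z \<bullet> h = y" unfolding y_def by (rule inner_proj_span[OF h])
  have ya: "\<bar>y\<bar> \<le> r * a" using Cauchy_Schwarz_ineq2[of "\<pi> d z" h] by (simp add: y r_def a_def)
  define c where "c = y / r"
  have c: "\<bar>c\<bar> \<le> a" using ya r by (simp add: c_def field_simps)
  have c2: "c\<^sup>2 \<le> a\<^sup>2" using power_mono[OF c, of 2] by simp
  have sz: "sgn z \<bullet> h = c * \<rho>" using r R by (simp add: sgn_div_norm inverse_eq_divide c_def \<rho>_def y_def R_def)
  have sp: "sgn (\<pi> d z) \<bullet> h = c" using y by (simp add: sgn_div_norm c_def r_def field_simps)
  have first: "\<bar>norm (\<pi> d z + h) - r - c - (a\<^sup>2 - c\<^sup>2) / (2 * r)\<bar> \<le> 9 * a ^ 3 / r\<^sup>2"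
    using norm_second_order[OF z, of h] by (simp add: sp r_def a_def)
  have lin: "\<bar>c - c * \<rho>\<bar> \<le> a * s"
  proof -
    have "\<bar>c - c * \<rho>\<bar> = \<bar>c\<bar> * (1 - \<rho>)" using \<rho> by (simp add: abs_mult flip: right_diff_distrib[of c 1 \<rho>, simplified])
    also have "\<dots> \<le> a * s" using c ts \<rho> a by (intro mult_mono) auto
    finally show ?thesis .
  qed
  have quad: "\<bar>(a\<^sup>2 - c\<^sup>2) / (2 * r) - (a\<^sup>2 - (c * \<rho>)\<^sup>2) / (2 * R)\<bar> \<le> 3 / 2 * a\<^sup>2 * (s / r)"
  proof -
    \<comment> \<open>As \<open>1 / R = \<rho> / r\<close>, both curvature terms get the denominator
      \<open>2 * r\<close>, and their difference is governed by \<open>1 - \<rho>\<close> and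
      \<open>1 - \<rho> ^ 3\<close>.\<close>
    have "(a\<^sup>2 - (c * \<rho>)\<^sup>2) / (2 * R) = (a\<^sup>2 - c\<^sup>2 * \<rho>\<^sup>2) * \<rho> / (2 * r)"
      using r R by (simp add: \<rho>_def power_mult_distrib power_divide field_simps)
    then have "(a\<^sup>2 - c\<^sup>2) / (2 * r) - (a\<^sup>2 - (c * \<rho>)\<^sup>2) / (2 * R) = (a\<^sup>2 * (1 - \<rho>) - c\<^sup>2 * (1 - \<rho> ^ 3)) / (2 * r)"
      using r by (simp add: diff_divide_distrib[symmetric] algebra_simps power2_eq_square power3_eq_cube)
    moreover have "\<bar>a\<^sup>2 * (1 - \<rho>) - c\<^sup>2 * (1 - \<rho> ^ 3)\<bar> \<le> 3 * (a\<^sup>2 * (1 - \<rho>))"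
    proof -
      have cube: "1 - \<rho> ^ 3 \<le> 3 * (1 - \<rho>)"
      proof -
        have "1 - \<rho> ^ 3 = (1 - \<rho>) * (1 + \<rho> + \<rho>\<^sup>2)" by (simp add: algebra_simps power2_eq_square power3_eq_cube)
        also have "\<dots> \<le> (1 - \<rho>) * 3"
          using \<rho> power_le_one[of \<rho> 2] by (intro mult_left_mono) auto
        finally show ?thesis by simp
      qed
      have "0 \<le> 1 - \<rho> ^ 3" using power_le_one[of \<rho> 3] \<rho> by simp
      then have "0 \<le> c\<^sup>2 * (1 - \<rho> ^ 3)" by simp
      moreover have "c\<^sup>2 * (1 - \<rho> ^ 3) \<le> a\<^sup>2 * (3 * (1 - \<rho>))"
        using c2 cube \<open>0 \<le> 1 - \<rho> ^ 3\<close> by (intro mult_mono) auto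
      then have "c\<^sup>2 * (1 - \<rho> ^ 3) \<le> 3 * (a\<^sup>2 * (1 - \<rho>))" by (simp only: mult.left_commute)
      moreover have "0 \<le> a\<^sup>2 * (1 - \<rho>)" using \<rho> by simp
      ultimately show ?thesis by linarith
    qed
    ultimately have "\<bar>(a\<^sup>2 - c\<^sup>2) / (2 * r) - (a\<^sup>2 - (c * \<rho>)\<^sup>2) / (2 * R)\<bar> \<le> 3 * (a\<^sup>2 * (1 - \<rho>)) / (2 * r)"
      using r by (simp add: divide_right_mono)
    also have "\<dots> \<le> 3 * (a\<^sup>2 * s) / (2 * r)" using ts r by (intro divide_right_mono mult_left_mono) auto
    finally show ?thesis by simp
  qed
  show ?thesis
    using first lin quad unfolding sz a_def[symmetric] R_def[symmetric] r_def[symmetric] by linarith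
qed

text \<open>Cauchy-Schwarz in coordinates: the Hilbert-Schmidt norm dominates the operator norm on
  the subspace. Its square is a plain sum over basis vectors, so its expectation can be computed
  term by term.\<close>

lemma norm_linear_coord_le:
  fixes D :: "'a \<Rightarrow> 'b::real_normed_vector"
  assumes D: "linear D" and h: "h \<in> basis_span \<phi> d"
  shows "norm (D h) \<le> norm h * sqrt (\<Sum>k<d. (norm (D (\<phi> k)))\<^sup>2)"
proof -
  have "h = (\<Sum>k<d. (h \<bullet> \<phi> k) *\<^sub>R \<phi> k)" using proj_of_span[OF h] by (simp add: coord_proj_def)
  then have "D h = (\<Sum>k<d. (h \<bullet> \<phi> k) *\<^sub>R D (\<phi> k))" using linear_sum[OF D] linear_scale[OF D] by (metis (no_types, lifting) sum.cong)
  then have "norm (D h) \<le> (\<Sum>k<d. \<bar>h \<bullet> \<phi> k\<bar> * \<bar>norm (D (\<phi> k))\<bar>)"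
    using norm_sum[of "\<lambda>k. (h \<bullet> \<phi> k) *\<^sub>R D (\<phi> k)" "{..<d}"] by simp
  also have "\<dots> \<le> L2_set (\<lambda>k. h \<bullet> \<phi> k) {..<d} * L2_set (\<lambda>k. norm (D (\<phi> k))) {..<d}"
    by (rule L2_set_mult_ineq)
  also have "L2_set (\<lambda>k. h \<bullet> \<phi> k) {..<d} = norm h"
    using norm_proj_sum[of d h] by (simp add: L2_set_def proj_of_span[OF h] real_sqrt_unique flip: norm_proj_sum)
  finally show ?thesis by (simp add: L2_set_def)
qed

end

text \<open>Collects what the linearization at the fixed point \<open>Q\<close> consumes, with one
  moment bound \<open>B\<close> for all late \<open>n\<close>. The rate for \<open>u\<close> enters
  through \<open>Q_approx\<close> and \<open>residual\<close>, which
  \<open>approximation_rates\<close> derives from it.\<close>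

locale quantile_clt =
  spatial \<mu> + sample: iid M \<mu> Xs + onb \<phi>
  for \<mu> :: "'a::{real_inner, banach, second_countable_topology} measure"
    and M :: "'c measure" and Xs :: "nat \<Rightarrow> 'c \<Rightarrow> 'a" and \<phi> :: "nat \<Rightarrow> 'a" +
  fixes u Q :: 'a and d :: "nat \<Rightarrow> nat" and B :: real
  assumes u: "norm u < 1"
    and gradient: "(\<integral>x. sgn (Q - x) - u \<partial>\<mu>) = 0"
    and dim: "(\<lambda>n. real (d n) / real n) \<longlonglongrightarrow> 0"
    and u_approx: "(\<lambda>n. norm (u - coord_proj \<phi> (d n) u)) \<longlonglongrightarrow> 0"
    and Q_approx: "(\<lambda>n. sqrt (real n) * norm (Q - coord_proj \<phi> (d n) Q)) \<longlonglongrightarrow> 0"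
    and proj_moment: "\<forall>\<^sub>F n in sequentially. (AE x in \<mu>. coord_proj \<phi> (d n) (Q - x) \<noteq> 0) \<and>
        integrable \<mu> (\<lambda>x. 1 / (norm (coord_proj \<phi> (d n) (Q - x)))\<^sup>2) \<and>
        (\<integral>x. 1 / (norm (coord_proj \<phi> (d n) (Q - x)))\<^sup>2 \<partial>\<mu>) \<le> B"
    and residual: "(\<lambda>n. sqrt (real n) *
        (\<integral>x. norm ((Q - x) - coord_proj \<phi> (d n) (Q - x)) / norm (Q - x) \<partial>\<mu>)) \<longlonglongrightarrow> 0"
begin

abbreviation "T \<equiv> hess Q"
abbreviation "Tinv \<equiv> inv (hess Q)"
abbreviation "W x \<equiv> sgn (Q - x) - u"

definition V :: "nat \<Rightarrow> 'c \<Rightarrow> 'a" where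
  "V n \<omega> = (1 / sqrt (real n)) *\<^sub>R (\<Sum>i<n. W (Xs i \<omega>))"

text \<open>The sine of the angle between \<open>Q - x\<close> and the subspace, equivalently the
  length of the part of \<open>sgn (Q - x)\<close> outside of it.\<close>

definition rel_res :: "nat \<Rightarrow> 'a \<Rightarrow> real" where
  "rel_res n x = norm ((Q - x) - \<pi> (d n) (Q - x)) / norm (Q - x)"

definition proj_dist :: "nat \<Rightarrow> 'a \<Rightarrow> real" where
  "proj_dist n x = norm (\<pi> (d n) (Q - x))"

lemma rel_res_measurable [measurable]: "rel_res n \<in> borel_measurable borel"
  unfolding rel_res_def by measurable

lemma proj_dist_measurable [measurable]: "proj_dist n \<in> borel_measurable borel"
  unfolding proj_dist_def by measurable

lemma rel_res_bounds: "0 \<le> rel_res n x" "rel_res n x \<le> 1"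
  unfolding rel_res_def using norm_residual_le[of "Q - x" "d n"] by (auto simp: divide_le_eq_1)

lemma proj_dist_le: "proj_dist n x \<le> norm (Q - x)"
  unfolding proj_dist_def by (rule norm_proj_le)

lemma Tinv_T: "T (Tinv x) = x" "Tinv (T x) = x"
  using bij_hess[of Q] by (simp_all add: bij_def surj_f_inv_f)

lemma V_measurable [measurable]: "V n \<in> borel_measurable M"
  unfolding V_def by measurable

lemma bounded_linear_measurable: "bounded_linear f \<Longrightarrow> f \<in> borel_measurable borel"
  for f :: "'a \<Rightarrow> 'b::real_normed_vector"
  by (intro borel_measurable_continuous_onI linear_continuous_on)

lemmas Tinv_measurable [measurable] = bounded_linear_measurable[OF bounded_linear_inv_hess[of Q]]

definition K where "K = onorm Tinv"

lemma K: "0 \<le> K" "norm (Tinv x) \<le> K * norm x"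
  unfolding K_def using onorm_pos_le[OF bounded_linear_inv_hess] onorm[OF bounded_linear_inv_hess] by auto

lemma norm_W: "norm (W x) \<le> 2"
proof -
  have "norm (W x) \<le> norm (sgn (Q - x)) + norm u" by (rule norm_triangle_ineq4)
  also have "\<dots> \<le> 1 + 1" using u norm_sgn_le[of "Q - x"] by linarith
  finally show ?thesis by simp
qed

text \<open>The summands account for projecting the gradient, projecting the curvature, the cubic Taylor
  term, the fluctuation of the empirical Hessian on \<open>basis_span \<phi> (d n)\<close> (in Hilbert-Schmidt norm),
  and the part of the linearized quantile outside of that subspace.\<close>

definition remainder :: "nat \<Rightarrow> 'c \<Rightarrow> real" where
  "remainder n \<omega> = (1 / sqrt (real n)) * (\<Sum>i<n. rel_res n (Xs i \<omega>))
     + (1 / real n) * (\<Sum>i<n. rel_res n (Xs i \<omega>) / proj_dist n (Xs i \<omega>))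
     + (1 / (real n * sqrt (real n))) * (\<Sum>i<n. 1 / (proj_dist n (Xs i \<omega>))\<^sup>2)
     + sqrt (\<Sum>k<d n. (norm ((1 / real n) *\<^sub>R (\<Sum>i<n. curv Q (Xs i \<omega>) (\<phi> k)) - T (\<phi> k)))\<^sup>2)
     + norm (Tinv (V n \<omega>) - \<pi> (d n) (Tinv (V n \<omega>)))"

lemma remainder_measurable [measurable]: "remainder n \<in> borel_measurable M"
proof -
  have [measurable]: "(\<lambda>x. curv Q x (\<phi> k)) \<in> borel_measurable borel" for k by (rule curv_measurable)
  show ?thesis unfolding remainder_def by measurable
qed

text \<open>\<open>n\<close> times the increment of the sample objective from
  \<open>\<pi> (d n) Q\<close>, in the rescaled variable. On the subspace \<open>u\<close> may stand
  for its own projection.\<close>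

definition local_obj :: "nat \<Rightarrow> 'c \<Rightarrow> 'a \<Rightarrow> real" where
  "local_obj n \<omega> h = (\<Sum>i<n. norm (\<pi> (d n) (Q - Xs i \<omega>) + (1 / sqrt (real n)) *\<^sub>R h) - norm (\<pi> (d n) (Q - Xs i \<omega>)))
     - sqrt (real n) * (u \<bullet> h)"

lemma remainder_nonneg: "0 \<le> remainder n \<omega>"
  unfolding remainder_def
  by (intro add_nonneg_nonneg mult_nonneg_nonneg sum_nonneg divide_nonneg_nonneg rel_res_bounds real_sqrt_ge_zero) (auto simp: proj_dist_def)

text \<open>\<open>norm_proj_second_order\<close> is summed over the sample with increment
  \<open>h / sqrt n\<close>; the powers of \<open>sqrt n\<close> become the weights in
  \<open>remainder\<close>. The quadratic part is the empirical Hessian, exchanged for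
  \<open>T\<close> at the cost of its fluctuation.\<close>

lemma local_obj_expansion:
  assumes n: "n > 0" and pos: "\<And>i. i < n \<Longrightarrow> \<pi> (d n) (Q - Xs i \<omega>) \<noteq> 0" and h: "h \<in> basis_span \<phi> (d n)"
  shows "\<bar>local_obj n \<omega> h - (T h \<bullet> h / 2 + V n \<omega> \<bullet> h)\<bar>
    \<le> (norm h + 2 * (norm h)\<^sup>2 + 9 * norm h ^ 3) * remainder n \<omega>"
proof -
  define N where "N = real n"
  define q where "q = sqrt N"
  have N: "N > 0" "q > 0" "q * q = N" using n by (auto simp: N_def q_def)
  define k where "k = (1 / q) *\<^sub>R h"
  have k: "k \<in> basis_span \<phi> (d n)" unfolding k_def by (rule subspace_scale[OF subspace_basis_span h])
  have nk: "norm k = norm h / q" "(norm k)\<^sup>2 = (norm h)\<^sup>2 / N" "norm k ^ 3 = norm h ^ 3 / (N * q)"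
    using N by (auto simp: k_def power2_eq_square power3_eq_cube)
  define x where "x i = Xs i \<omega>" for i
  define z where "z i = Q - x i" for i
  define s where "s i = rel_res n (x i)" for i
  define r where "r i = proj_dist n (x i)" for i
  define t where "t i = norm (\<pi> (d n) (z i) + k) - norm (\<pi> (d n) (z i)) - sgn (z i) \<bullet> k - (curv Q (x i) k \<bullet> k) / 2" for i
  have ti: "\<bar>t i\<bar> \<le> norm k * s i + 3 / 2 * (norm k)\<^sup>2 * (s i / r i) + 9 * norm k ^ 3 * (1 / (r i)\<^sup>2)" if "i < n" for i
    using norm_proj_second_order[OF pos[OF that] k]
    by (simp add: t_def z_def x_def s_def r_def rel_res_def proj_dist_def curv_inner_self)
  have "\<bar>\<Sum>i<n. t i\<bar> \<le> (\<Sum>i<n. norm k * s i + 3 / 2 * (norm k)\<^sup>2 * (s i / r i) + 9 * norm k ^ 3 * (1 / (r i)\<^sup>2))"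
    by (rule order_trans[OF sum_abs sum_mono]) (use ti in auto)
  also have "\<dots> = norm k * (\<Sum>i<n. s i) + 3 / 2 * (norm k)\<^sup>2 * (\<Sum>i<n. s i / r i) + 9 * norm k ^ 3 * (\<Sum>i<n. 1 / (r i)\<^sup>2)"
    unfolding sum.distrib sum_distrib_left ..
  finally have sum_t: "\<bar>\<Sum>i<n. t i\<bar> \<le> norm k * (\<Sum>i<n. s i) + 3 / 2 * (norm k)\<^sup>2 * (\<Sum>i<n. s i / r i)
      + 9 * norm k ^ 3 * (\<Sum>i<n. 1 / (r i)\<^sup>2)" .
  \<comment> \<open>The fluctuation of the empirical Hessian; being linear, it is controlled on the
    subspace by its values at the basis vectors.\<close>
  define D where "D h = (1 / N) *\<^sub>R (\<Sum>i<n. curv Q (x i) h) - T h" for h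
  interpret T: bounded_linear T by (rule bounded_linear_hess)
  have linD: "linear D"
    by (rule linearI) (simp_all add: D_def curv_linear sum.distrib T.add T.scaleR scaleR_right_distrib
        scaleR_sum_right[symmetric] algebra_simps)
  define e where "e = sqrt (\<Sum>k<d n. (norm (D (\<phi> k)))\<^sup>2)"
  have De: "\<bar>D h \<bullet> h\<bar> \<le> (norm h)\<^sup>2 * e"
  proof -
    have "\<bar>D h \<bullet> h\<bar> \<le> norm (D h) * norm h" by (rule Cauchy_Schwarz_ineq2)
    also have "\<dots> \<le> (norm h * e) * norm h"
      unfolding e_def by (intro mult_right_mono norm_linear_coord_le[OF linD h]) auto
    finally show ?thesis by (simp add: power2_eq_square mult_ac)
  qed
  have Vh: "V n \<omega> \<bullet> h = (\<Sum>i<n. sgn (z i) \<bullet> k) - q * (u \<bullet> h)"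
  proof -
    have "V n \<omega> \<bullet> h = (1 / q) * ((\<Sum>i<n. sgn (z i) \<bullet> h) - N * (u \<bullet> h))"
      by (simp add: V_def inner_sum_left inner_diff_left sum_subtractf N_def q_def z_def x_def)
    also have "\<dots> = (\<Sum>i<n. sgn (z i) \<bullet> k) - q * (u \<bullet> h)"
      using N by (simp add: k_def right_diff_distrib sum_divide_distrib[symmetric] field_simps)
    finally show ?thesis .
  qed
  have ch: "(\<Sum>i<n. (curv Q (x i) k \<bullet> k) / 2) = (D h \<bullet> h) / 2 + (T h \<bullet> h) / 2"
  proof -
    have "curv Q (x i) k \<bullet> k = (1 / N) * (curv Q (x i) h \<bullet> h)" for i
      using N by (simp add: k_def curv_linear)
    then have "(\<Sum>i<n. (curv Q (x i) k \<bullet> k) / 2) = ((1 / N) *\<^sub>R (\<Sum>i<n. curv Q (x i) h)) \<bullet> h / 2"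
      by (simp add: inner_sum_left sum_divide_distrib)
    also have "(1 / N) *\<^sub>R (\<Sum>i<n. curv Q (x i) h) = D h + T h" by (simp add: D_def)
    finally show ?thesis by (simp add: inner_add_left add_divide_distrib)
  qed
  have A: "local_obj n \<omega> h = (\<Sum>i<n. norm (\<pi> (d n) (z i) + k) - norm (\<pi> (d n) (z i))) - q * (u \<bullet> h)"
    by (simp add: local_obj_def k_def q_def N_def z_def x_def)
  have "(\<Sum>i<n. t i) = (\<Sum>i<n. norm (\<pi> (d n) (z i) + k) - norm (\<pi> (d n) (z i))) - (\<Sum>i<n. sgn (z i) \<bullet> k)
      - (\<Sum>i<n. (curv Q (x i) k \<bullet> k) / 2)"
    unfolding t_def sum_subtractf ..
  then have main: "local_obj n \<omega> h - (T h \<bullet> h / 2 + V n \<omega> \<bullet> h) = (\<Sum>i<n. t i) + (D h \<bullet> h) / 2"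
    using A Vh ch by linarith
  \<comment> \<open>One coefficient dominating all four that occur: \<open>norm h\<close>,
    \<open>3 / 2\<close> and \<open>1 / 2\<close> times its square, and 9 times its cube.\<close>
  define b where "b = norm h + 2 * (norm h)\<^sup>2 + 9 * norm h ^ 3"
  have b: "norm h \<le> b" "3 / 2 * (norm h)\<^sup>2 \<le> b" "9 * norm h ^ 3 \<le> b" "(norm h)\<^sup>2 / 2 \<le> b" "0 \<le> b"
    unfolding b_def by (auto simp: add_nonneg_nonneg)
  define e1 e2 e3 where "e1 = (1 / q) * (\<Sum>i<n. s i)" and "e2 = (1 / N) * (\<Sum>i<n. s i / r i)"
    and "e3 = (1 / (N * q)) * (\<Sum>i<n. 1 / (r i)\<^sup>2)"
  have s0: "0 \<le> s i" "0 \<le> r i" for i by (simp_all add: s_def r_def rel_res_bounds proj_dist_def)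
  have e0: "0 \<le> e1" "0 \<le> e2" "0 \<le> e3" "0 \<le> e"
    unfolding e1_def e2_def e3_def e_def using s0 N
    by (auto intro!: mult_nonneg_nonneg sum_nonneg divide_nonneg_nonneg)
  have rem: "e1 + e2 + e3 + e \<le> remainder n \<omega>"
    unfolding remainder_def e1_def e2_def e3_def e_def D_def s_def r_def x_def q_def N_def by simp
  have "\<bar>(\<Sum>i<n. t i) + (D h \<bullet> h) / 2\<bar> \<le> norm h * e1 + 3 / 2 * (norm h)\<^sup>2 * e2 + 9 * norm h ^ 3 * e3 + (norm h)\<^sup>2 / 2 * e"
  proof -
    have "norm k * (\<Sum>i<n. s i) = norm h * e1" by (simp add: nk(1) e1_def)
    moreover have "3 / 2 * (norm k)\<^sup>2 * (\<Sum>i<n. s i / r i) = 3 / 2 * (norm h)\<^sup>2 * e2"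
      unfolding nk(2) e2_def by simp
    moreover have "9 * norm k ^ 3 * (\<Sum>i<n. 1 / (r i)\<^sup>2) = 9 * norm h ^ 3 * e3"
      unfolding nk(3) e3_def by simp
    ultimately show ?thesis using sum_t De by linarith
  qed
  also have "\<dots> \<le> b * e1 + b * e2 + b * e3 + b * e"
    using b e0 by (intro add_mono mult_right_mono) auto
  also have "\<dots> = b * (e1 + e2 + e3 + e)" by (simp add: distrib_left)
  also have "\<dots> \<le> b * remainder n \<omega>" using rem b by (intro mult_left_mono) auto
  finally show ?thesis unfolding main b_def .
qed

lemma sample_objective_local_obj:
  assumes n: "n > 0" and h: "h \<in> basis_span \<phi> (d n)"
  shows "real n * (sample_objective (basis_span \<phi> (d n)) n (\<lambda>i. Xs i \<omega>) u (\<pi> (d n) Q + (1 / sqrt (real n)) *\<^sub>R h)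
      - sample_objective (basis_span \<phi> (d n)) n (\<lambda>i. Xs i \<omega>) u (\<pi> (d n) Q)) = local_obj n \<omega> h"
proof -
  let ?p = "\<pi> (d n)" and ?q = "sqrt (real n)"
  have *: "real n * sample_objective (basis_span \<phi> (d n)) n (\<lambda>i. Xs i \<omega>) u R
      = (\<Sum>i<n. norm (R - ?p (Xs i \<omega>)) - norm (?p (Xs i \<omega>))) - real n * (u \<bullet> R)" if "R \<in> basis_span \<phi> (d n)" for R
    using n inner_proj_span[OF that, of u] by (simp add: sample_objective_def orth_proj_basis_span right_diff_distrib)
  have in1: "?p Q \<in> basis_span \<phi> (d n)" by (rule proj_in_span)
  have in2: "?p Q + (1 / ?q) *\<^sub>R h \<in> basis_span \<phi> (d n)"
    using in1 h subspace_basis_span by (intro subspace_add subspace_scale)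
  have "real n * (u \<bullet> h) / ?q = (u \<bullet> h) * ?q"
  proof -
    have "real n * (u \<bullet> h) / ?q = (real n / ?q) * (u \<bullet> h)" by simp
    then show ?thesis by (simp only: real_div_sqrt of_nat_0_le_iff mult.commute)
  qed
  then show ?thesis
    unfolding right_diff_distrib *[OF in1] *[OF in2] local_obj_def
    by (simp add: proj_linear_simps sum_subtractf inner_add_right algebra_simps)
qed

lemma convex_local_obj: "convex_on S (local_obj n \<omega>)" if "convex S"
proof (rule convex_onI[OF _ that])
  fix t :: real and x y :: 'a assume t: "0 < t" "t < 1"
  let ?c = "1 / sqrt (real n)"
  have comb: "z + c *\<^sub>R ((1 - t) *\<^sub>R x + t *\<^sub>R y) = (1 - t) *\<^sub>R (z + c *\<^sub>R x) + t *\<^sub>R (z + c *\<^sub>R y)"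
    for z :: 'a and c by (simp add: algebra_simps)
  have le: "norm (z + ?c *\<^sub>R ((1 - t) *\<^sub>R x + t *\<^sub>R y)) - norm z
      \<le> (1 - t) * (norm (z + ?c *\<^sub>R x) - norm z) + t * (norm (z + ?c *\<^sub>R y) - norm z)" for z :: 'a
  proof -
    have "norm (z + ?c *\<^sub>R ((1 - t) *\<^sub>R x + t *\<^sub>R y)) \<le> (1 - t) * norm (z + ?c *\<^sub>R x) + t * norm (z + ?c *\<^sub>R y)"
      using t norm_triangle_ineq[of "(1 - t) *\<^sub>R (z + ?c *\<^sub>R x)" "t *\<^sub>R (z + ?c *\<^sub>R y)"] unfolding comb by simp
    then show ?thesis by (simp add: algebra_simps)
  qed
  let ?z = "\<lambda>i. \<pi> (d n) (Q - Xs i \<omega>)"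
  have "(\<Sum>i<n. norm (?z i + ?c *\<^sub>R ((1 - t) *\<^sub>R x + t *\<^sub>R y)) - norm (?z i))
      \<le> (\<Sum>i<n. (1 - t) * (norm (?z i + ?c *\<^sub>R x) - norm (?z i)) + t * (norm (?z i + ?c *\<^sub>R y) - norm (?z i)))"
    by (intro sum_mono le)
  also have "\<dots> = (1 - t) * (\<Sum>i<n. norm (?z i + ?c *\<^sub>R x) - norm (?z i)) + t * (\<Sum>i<n. norm (?z i + ?c *\<^sub>R y) - norm (?z i))"
    by (simp only: sum.distrib sum_distrib_left)
  finally show "local_obj n \<omega> ((1 - t) *\<^sub>R x + t *\<^sub>R y) \<le> (1 - t) * local_obj n \<omega> x + t * local_obj n \<omega> y"
    unfolding local_obj_def by (simp add: inner_add_right algebra_simps)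
qed

text \<open>The deterministic core, for one sample. \<open>hs\<close> minimizes the quadratic over
  the whole space and \<open>p\<close> is its projection to the subspace. Convexity puts the
  rescaled minimizer within \<open>\<delta>\<close> of \<open>p\<close>; the distance from
  \<open>p\<close> to \<open>hs\<close> and the rescaled distance from \<open>Q\<close> to its
  projection contribute at most \<open>\<delta>\<close> each, hence
  \<open>3 * \<delta>\<close>.\<close>

lemma quantile_close:
  assumes n: "n > 0" and pos: "\<And>i. i < n \<Longrightarrow> \<pi> (d n) (Q - Xs i \<omega>) \<noteq> 0"
    and min: "is_sample_quantile (basis_span \<phi> (d n)) n (\<lambda>i. Xs i \<omega>) u R"
    and C: "norm (Tinv (V n \<omega>)) \<le> C" and \<delta>: "0 < \<delta>"
    and rem: "remainder n \<omega> \<le> \<tau>" "\<tau> \<le> \<delta>"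
    and small: "inv_moment Q * \<tau>\<^sup>2 + 4 * (((C + \<delta>) + 2 * (C + \<delta>)\<^sup>2 + 9 * (C + \<delta>) ^ 3) * \<tau>) < coerc Q * (\<delta> - \<tau>)\<^sup>2"
    and bias: "sqrt (real n) * norm (Q - \<pi> (d n) Q) \<le> \<delta>"
  shows "norm (sqrt (real n) *\<^sub>R (R - Q) + Tinv (V n \<omega>)) \<le> 3 * \<delta>"
proof -
  let ?S = "basis_span \<phi> (d n)" and ?q = "sqrt (real n)"
  define hs where "hs = - Tinv (V n \<omega>)"
  define p where "p = \<pi> (d n) hs"
  define \<Delta> where "\<Delta> = ?q *\<^sub>R (R - \<pi> (d n) Q)"
  interpret T: bounded_linear T by (rule bounded_linear_hess)
  have q: "?q > 0" using n by simp
  have Ths: "T hs = - V n \<omega>" by (simp add: hs_def linear_neg[OF bounded_linear.linear[OF bounded_linear_hess]] Tinv_T)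
  have R: "R \<in> ?S" "\<And>R'. R' \<in> ?S \<Longrightarrow> sample_objective ?S n (\<lambda>i. Xs i \<omega>) u R \<le> sample_objective ?S n (\<lambda>i. Xs i \<omega>) u R'"
    using min by (auto simp: is_sample_quantile_def is_arg_min_def not_less)
  have \<Delta>S: "\<Delta> \<in> ?S" unfolding \<Delta>_def using R(1) proj_in_span subspace_basis_span
    by (intro subspace_scale subspace_diff)
  have R\<Delta>: "R = \<pi> (d n) Q + (1 / ?q) *\<^sub>R \<Delta>" using q by (simp add: \<Delta>_def)
  have ps: "norm (p - hs) \<le> \<tau>"
  proof -
    have "norm (p - hs) = norm (Tinv (V n \<omega>) - \<pi> (d n) (Tinv (V n \<omega>)))"
      unfolding p_def hs_def by (simp add: linear_neg[OF bounded_linear.linear[OF bounded_linear_coord_proj]])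
    also have "\<dots> \<le> remainder n \<omega>" unfolding remainder_def
      by (simp, intro add_nonneg_nonneg mult_nonneg_nonneg sum_nonneg divide_nonneg_nonneg rel_res_bounds real_sqrt_ge_zero) (auto simp: proj_dist_def sum_nonneg)
    finally show ?thesis using rem by linarith
  qed
  have \<tau>0: "0 \<le> \<tau>" using rem(1) remainder_nonneg[of n \<omega>] by linarith
  have pC: "norm p \<le> C" using norm_proj_le[of "d n" hs] C by (simp add: p_def hs_def)
  have C0: "0 \<le> C" using pC norm_ge_zero order_trans by blast
  have "norm (\<Delta> - p) \<le> \<delta>"
  proof (rule convex_argmin_close[OF bounded_linear_hess[of Q] hess_sym hess_coercive hess_le subspace_basis_span])
    show "convex_on ?S (local_obj n \<omega>)" by (intro convex_local_obj subspace_imp_convex subspace_basis_span)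
    show "\<Delta> \<in> ?S" by fact
    show "p \<in> ?S" unfolding p_def by (rule proj_in_span)
    show "local_obj n \<omega> \<Delta> \<le> local_obj n \<omega> h" if "h \<in> ?S" for h
    proof -
      have "\<pi> (d n) Q + (1 / ?q) *\<^sub>R h \<in> ?S"
        using that proj_in_span subspace_basis_span by (intro subspace_add subspace_scale)
      from R(2)[OF this] show ?thesis
        unfolding sample_objective_local_obj[OF n \<Delta>S, symmetric] sample_objective_local_obj[OF n that, symmetric] R\<Delta>[symmetric]
        by (intro mult_left_mono) auto
    qed
    show "\<bar>local_obj n \<omega> h - (T h \<bullet> h / 2 - T hs \<bullet> h)\<bar> \<le> ((C + \<delta>) + 2 * (C + \<delta>)\<^sup>2 + 9 * (C + \<delta>) ^ 3) * \<tau>"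
      if "h \<in> ?S" "norm (h - p) \<le> \<delta>" for h
    proof -
      have nh: "norm h \<le> C + \<delta>" using that(2) pC norm_triangle_sub[of h p] by linarith
      have "\<bar>local_obj n \<omega> h - (T h \<bullet> h / 2 - T hs \<bullet> h)\<bar> \<le> (norm h + 2 * (norm h)\<^sup>2 + 9 * norm h ^ 3) * remainder n \<omega>"
        using local_obj_expansion[OF n pos that(1)] by (simp add: Ths)
      also have "\<dots> \<le> ((C + \<delta>) + 2 * (C + \<delta>)\<^sup>2 + 9 * (C + \<delta>) ^ 3) * \<tau>"
        using nh rem(1) remainder_nonneg C0 \<delta> by (intro mult_mono add_mono mult_left_mono power_mono add_nonneg_nonneg) auto
      finally show ?thesis .
    qed
    show "norm (p - hs) \<le> \<tau>" by (rule ps)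
    show "inv_moment Q * \<tau>\<^sup>2 + 4 * (((C + \<delta>) + 2 * (C + \<delta>)\<^sup>2 + 9 * (C + \<delta>) ^ 3) * \<tau>) < coerc Q * (\<delta> - \<tau>)\<^sup>2" by (rule small)
  qed (use \<delta> rem(2) coerc_pos[of Q] inv_moment_pos[of Q] in \<open>auto intro: less_imp_le\<close>)
  moreover have eq: "?q *\<^sub>R (R - Q) + Tinv (V n \<omega>) = (\<Delta> - p) + (p - hs) - ?q *\<^sub>R (Q - \<pi> (d n) Q)"
    by (simp add: \<Delta>_def hs_def algebra_simps)
  moreover have "norm (?q *\<^sub>R (Q - \<pi> (d n) Q)) \<le> \<delta>" using bias by simp
  moreover have "norm ((\<Delta> - p) + (p - hs) - ?q *\<^sub>R (Q - \<pi> (d n) Q))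
      \<le> norm (\<Delta> - p) + norm (p - hs) + norm (?q *\<^sub>R (Q - \<pi> (d n) Q))"
    by (meson norm_triangle_ineq norm_triangle_ineq4 order_trans add_right_mono)
  ultimately show ?thesis using ps rem(2) unfolding eq by linarith
qed

end

section \<open>Expected size of the remainder and the linearization in probability\<close>

context quantile_clt
begin

definition mean_res :: "nat \<Rightarrow> real" where
  "mean_res n = (\<integral>x. rel_res n x \<partial>\<mu>)"

definition mean_ratio :: "nat \<Rightarrow> real" where
  "mean_ratio n = (\<integral>x. rel_res n x / proj_dist n x \<partial>\<mu>)"

text \<open>The indices where the moment bound is available. At others \<open>1 / proj_dist\<close>
  might fail to be integrable, and the integrals below would be 0 by convention.\<close>

definition good :: "nat \<Rightarrow> bool" where
  "good n \<longleftrightarrow> 0 < n \<and> (AE x in \<mu>. proj_dist n x \<noteq> 0) \<and>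
     integrable \<mu> (\<lambda>x. 1 / (proj_dist n x)\<^sup>2) \<and> (\<integral>x. 1 / (proj_dist n x)\<^sup>2 \<partial>\<mu>) \<le> B"

lemma eventually_good: "\<forall>\<^sub>F n in sequentially. good n"
  using proj_moment eventually_gt_at_top[of "0::nat"]
  by eventually_elim (auto simp: good_def proj_dist_def)

lemma integrable_rel_res: "integrable \<mu> (rel_res n)"
  by (rule integrable_const_bound[of _ 1]) (use rel_res_bounds in auto)

lemma mean_res_nonneg: "0 \<le> mean_res n"
  unfolding mean_res_def by (intro Bochner_Integration.integral_nonneg rel_res_bounds)

lemma mean_res_tendsto: "(\<lambda>n. sqrt (real n) * mean_res n) \<longlonglongrightarrow> 0"
  using residual unfolding mean_res_def rel_res_def .

text \<open>AM-GM with weight \<open>sqrt n\<close>: \<open>s / r \<le> (sqrt n * s\<^sup>2 + r\<^sup>-\<^sup>2 / sqrt n) / 2\<close>, and \<open>s\<^sup>2 \<le> s\<close>.\<close>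

lemma mean_ratio_bound:
  assumes "good n"
  shows "integrable \<mu> (\<lambda>x. rel_res n x / proj_dist n x)"
    "mean_ratio n \<le> (sqrt (real n) * mean_res n + B / sqrt (real n)) / 2"
proof -
  define q where "q = sqrt (real n)"
  have q: "q > 0" using assms by (simp add: q_def good_def)
  have iq: "integrable \<mu> (\<lambda>x. 1 / (proj_dist n x)\<^sup>2)" and B: "(\<integral>x. 1 / (proj_dist n x)\<^sup>2 \<partial>\<mu>) \<le> B"
    using assms by (auto simp: good_def)
  have pt: "rel_res n x / proj_dist n x \<le> (q * rel_res n x + (1 / q) * (1 / (proj_dist n x)\<^sup>2)) / 2" for x
  proof -
    let ?s = "rel_res n x" and ?t = "1 / proj_dist n x"
    have "0 \<le> (sqrt q * ?s - ?t / sqrt q)\<^sup>2" by simp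
    also have "\<dots> = q * ?s\<^sup>2 - 2 * (?s * ?t) + ?t\<^sup>2 / q"
      using q by (simp add: power2_diff power_mult_distrib power_divide field_simps)
    also have "\<dots> \<le> q * ?s - 2 * (?s * ?t) + ?t\<^sup>2 / q"
      using q rel_res_bounds[of n x] mult_left_mono[of ?s 1 ?s]
      by (intro add_right_mono diff_right_mono mult_left_mono) (auto simp: power2_eq_square)
    finally have "2 * (?s * ?t) \<le> q * ?s + ?t\<^sup>2 / q" by linarith
    moreover have t: "(1 / q) * (1 / (proj_dist n x)\<^sup>2) = ?t\<^sup>2 / q" by (simp add: power_divide)
    moreover have st: "rel_res n x / proj_dist n x = ?s * ?t" by simp
    moreover have half: "b \<le> w / 2" if "2 * b \<le> w" for b w :: real using that by simp
    ultimately show ?thesis unfolding t st by (intro half)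
  qed
  have ib: "integrable \<mu> (\<lambda>x. (q * rel_res n x + (1 / q) * (1 / (proj_dist n x)\<^sup>2)) / 2)"
    by (intro integrable_divide Bochner_Integration.integrable_add integrable_mult_right iq integrable_rel_res)
  show int: "integrable \<mu> (\<lambda>x. rel_res n x / proj_dist n x)"
  proof (rule Bochner_Integration.integrable_bound[OF ib])
    show "AE x in \<mu>. norm (rel_res n x / proj_dist n x) \<le> norm ((q * rel_res n x + (1 / q) * (1 / (proj_dist n x)\<^sup>2)) / 2)"
    proof (intro AE_I2)
      fix x
      have "0 \<le> rel_res n x / proj_dist n x"
        by (intro divide_nonneg_nonneg rel_res_bounds) (simp add: proj_dist_def)
      then show "norm (rel_res n x / proj_dist n x) \<le> norm ((q * rel_res n x + (1 / q) * (1 / (proj_dist n x)\<^sup>2)) / 2)"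
        using pt[of x] unfolding real_norm_def by linarith
    qed
  qed measurable
  have "mean_ratio n \<le> (\<integral>x. (q * rel_res n x + (1 / q) * (1 / (proj_dist n x)\<^sup>2)) / 2 \<partial>\<mu>)"
    unfolding mean_ratio_def by (intro integral_mono int ib pt)
  also have "\<dots> = (q * mean_res n + (1 / q) * (\<integral>x. 1 / (proj_dist n x)\<^sup>2 \<partial>\<mu>)) / 2"
  proof -
    have "(\<integral>x. q * rel_res n x + (1 / q) * (1 / (proj_dist n x)\<^sup>2) \<partial>\<mu>)
        = (\<integral>x. q * rel_res n x \<partial>\<mu>) + (\<integral>x. (1 / q) * (1 / (proj_dist n x)\<^sup>2) \<partial>\<mu>)"
      by (intro Bochner_Integration.integral_add integrable_mult_right iq integrable_rel_res)
    then show ?thesis unfolding integral_divide_zero integral_mult_right_zero mean_res_def by simp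
  qed
  also have "\<dots> \<le> (q * mean_res n + (1 / q) * B) / 2"
    using q B by (intro divide_right_mono add_left_mono mult_left_mono) auto
  finally show "mean_ratio n \<le> (sqrt (real n) * mean_res n + B / sqrt (real n)) / 2" by (simp add: q_def)
qed

lemma sqrt_n_at_top: "(\<lambda>n. c / sqrt (real n)) \<longlonglongrightarrow> 0"
  by real_asymp

lemma mean_ratio_nonneg: "0 \<le> mean_ratio n"
  unfolding mean_ratio_def
  by (intro Bochner_Integration.integral_nonneg divide_nonneg_nonneg rel_res_bounds) (simp add: proj_dist_def)

lemma mean_ratio_tendsto: "mean_ratio \<longlonglongrightarrow> 0"
proof (rule tendsto_sandwich[OF _ _ tendsto_const])
  show "\<forall>\<^sub>F n in sequentially. 0 \<le> mean_ratio n" by (simp add: mean_ratio_nonneg)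
  show "\<forall>\<^sub>F n in sequentially. mean_ratio n \<le> (sqrt (real n) * mean_res n + B / sqrt (real n)) / 2"
    using eventually_good by eventually_elim (rule mean_ratio_bound(2))
  have "(\<lambda>n. (sqrt (real n) * mean_res n + B / sqrt (real n)) / 2) \<longlonglongrightarrow> (0 + 0) / 2"
    by (intro tendsto_intros mean_res_tendsto sqrt_n_at_top) simp
  then show "(\<lambda>n. (sqrt (real n) * mean_res n + B / sqrt (real n)) / 2) \<longlonglongrightarrow> 0" by simp
qed

definition Res :: "nat \<Rightarrow> 'a \<Rightarrow> 'a" where
  "Res n z = z - \<pi> (d n) z"

lemma bounded_linear_Res: "bounded_linear (Res n)"
  unfolding Res_def by (intro bounded_linear_sub bounded_linear_ident bounded_linear_coord_proj)

lemmas Res_measurable [measurable] = bounded_linear_measurable[OF bounded_linear_Res]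

lemma norm_Res_sgn: "norm (Res n (sgn (Q - x))) = rel_res n x"
proof -
  interpret bounded_linear "Res n" by (rule bounded_linear_Res)
  have "Res n (sgn (Q - x)) = inverse (norm (Q - x)) *\<^sub>R Res n (Q - x)" by (simp add: sgn_div_norm scaleR)
  then show ?thesis by (simp add: rel_res_def Res_def divide_inverse mult.commute)
qed

text \<open>Up to a term controlled by the residuals of the data, \<open>T\<close> acts on residuals as multiplication by
  the inverse moment, so that \<open>T\<^sup>-\<^sup>1\<close> preserves smallness of residuals even if the spaces do not
  exhaust the whole space.\<close>

lemma norm_Res_hess:
  assumes "good n"
  shows "inv_moment Q * norm (Res n y) \<le> norm (Res n (T y)) + norm y * mean_ratio n"
proof -
  interpret R: bounded_linear "Res n" by (rule bounded_linear_Res)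
  \<comment> \<open>The curvature is a scalar multiple of the identity minus a rank one term along
    \<open>sgn (Q - x)\<close>. Taking residuals commutes with the scalar; \<open>G\<close> is the
    rank one term, whose residual direction has length \<open>rel_res n x\<close>.\<close>
  define G where "G x = ((sgn (Q - x) \<bullet> y) / norm (Q - x)) *\<^sub>R Res n (sgn (Q - x))" for x
  have [measurable]: "G \<in> borel_measurable borel" unfolding G_def by measurable
  have ae: "AE x in \<mu>. norm (G x) \<le> norm y * (rel_res n x / proj_dist n x)"
    using assms[unfolded good_def, THEN conjunct2, THEN conjunct1]
  proof eventually_elim
    case (elim x)
    then have r: "0 < proj_dist n x" by (simp add: proj_dist_def)
    have "\<bar>sgn (Q - x) \<bullet> y\<bar> \<le> norm (sgn (Q - x)) * norm y" by (rule Cauchy_Schwarz_ineq2)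
    also have "\<dots> \<le> 1 * norm y" by (intro mult_right_mono norm_sgn_le) simp
    finally have "\<bar>sgn (Q - x) \<bullet> y\<bar> / norm (Q - x) \<le> norm y / proj_dist n x"
      using proj_dist_le[of n x] r by (intro frac_le) auto
    then have "\<bar>sgn (Q - x) \<bullet> y\<bar> / norm (Q - x) * rel_res n x \<le> norm y / proj_dist n x * rel_res n x"
      by (intro mult_right_mono rel_res_bounds)
    then show ?case by (simp add: G_def norm_Res_sgn)
  qed
  have ibound: "integrable \<mu> (\<lambda>x. norm y * (rel_res n x / proj_dist n x))"
    by (intro integrable_mult_right mean_ratio_bound assms)
  have iG: "integrable \<mu> G"
  proof (rule Bochner_Integration.integrable_bound[OF ibound])
    show "AE x in \<mu>. norm (G x) \<le> norm (norm y * (rel_res n x / proj_dist n x))"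
      using ae by eventually_elim (unfold real_norm_def, rule order_trans[OF _ abs_ge_self])
  qed measurable
  have "Res n (T y) = (\<integral>x. Res n (curv Q x y) \<partial>\<mu>)"
    unfolding hess_def by (rule integral_bounded_linear[OF bounded_linear_Res integrable_curv, symmetric])
  also have "\<dots> = (\<integral>x. (1 / norm (Q - x)) *\<^sub>R Res n y - G x \<partial>\<mu>)"
    by (simp add: curv_def G_def R.scaleR R.diff scaleR_diff_right)
  also have "\<dots> = (\<integral>x. (1 / norm (Q - x)) *\<^sub>R Res n y \<partial>\<mu>) - (\<integral>x. G x \<partial>\<mu>)"
    by (intro Bochner_Integration.integral_diff iG integrable_scaleR_left integrable_inv)
  also have "(\<integral>x. (1 / norm (Q - x)) *\<^sub>R Res n y \<partial>\<mu>) = inv_moment Q *\<^sub>R Res n y"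
    unfolding inv_moment_def by (rule integral_scaleR_left) (rule integrable_inv)
  finally have "inv_moment Q *\<^sub>R Res n y = Res n (T y) + (\<integral>x. G x \<partial>\<mu>)" by simp
  then have "norm (inv_moment Q *\<^sub>R Res n y) \<le> norm (Res n (T y)) + norm (\<integral>x. G x \<partial>\<mu>)"
    by (simp only: norm_triangle_ineq)
  moreover have "norm (\<integral>x. G x \<partial>\<mu>) \<le> norm y * mean_ratio n"
  proof -
    have "norm (\<integral>x. G x \<partial>\<mu>) \<le> (\<integral>x. norm (G x) \<partial>\<mu>)" by (rule integral_norm_bound)
    also have "\<dots> \<le> (\<integral>x. norm y * (rel_res n x / proj_dist n x) \<partial>\<mu>)"
      by (intro integral_mono_AE ibound integrable_norm iG ae)
    finally show ?thesis unfolding mean_ratio_def integral_mult_right_zero .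
  qed
  ultimately show ?thesis using inv_moment_pos[of Q] by simp
qed

text \<open>The part of the residual of the influence \<open>Tinv (W x)\<close> that does not depend
  on \<open>x\<close>; \<open>K * 2\<close> bounds the length of the influence.\<close>

definition infl_bias :: "nat \<Rightarrow> real" where
  "infl_bias n = norm (Res n u) + K * 2 * mean_ratio n"

lemma infl_bias_tendsto: "infl_bias \<longlonglongrightarrow> 0"
proof -
  have "(\<lambda>n. norm (Res n u)) \<longlonglongrightarrow> 0" using u_approx by (simp add: Res_def)
  then have "infl_bias \<longlonglongrightarrow> 0 + K * 2 * 0" unfolding infl_bias_def by (intro tendsto_intros mean_ratio_tendsto)
  then show ?thesis by simp
qed

text \<open>\<open>norm_Res_hess\<close> at \<open>y = Tinv (W x)\<close>, where
  \<open>T y = W x\<close>. As \<open>rel_res\<close> is at most 1, its square is bounded by itself,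
  so the mean of the squared residual is controlled by \<open>mean_res\<close>.\<close>

lemma norm_Res_influence:
  assumes "good n"
  shows "(norm (Res n (Tinv (W x))))\<^sup>2 \<le> 2 / (inv_moment Q)\<^sup>2 * (rel_res n x + (infl_bias n)\<^sup>2)"
proof -
  interpret R: bounded_linear "Res n" by (rule bounded_linear_Res)
  define \<zeta> where "\<zeta> = inv_moment Q"
  have \<zeta>: "\<zeta> > 0" using inv_moment_pos by (simp add: \<zeta>_def)
  define y where "y = Tinv (W x)"
  have y: "norm y \<le> K * 2"
    using K(2)[of "W x"] mult_left_mono[OF norm_W[of x] K(1)] by (simp add: y_def)
  have "norm (Res n (W x)) \<le> norm (Res n (sgn (Q - x))) + norm (Res n u)"
    by (simp add: R.diff norm_triangle_ineq4)
  then have "\<zeta> * norm (Res n y) \<le> (rel_res n x + norm (Res n u)) + norm y * mean_ratio n"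
    using norm_Res_hess[OF assms, of y] by (simp add: y_def Tinv_T norm_Res_sgn \<zeta>_def)
  also have "\<dots> \<le> rel_res n x + infl_bias n"
    using mult_right_mono[OF y mean_ratio_nonneg[of n]] by (simp add: infl_bias_def)
  finally have "(\<zeta> * norm (Res n y))\<^sup>2 \<le> (rel_res n x + infl_bias n)\<^sup>2"
    using \<zeta> by (intro power_mono) auto
  also have "\<dots> \<le> 2 * (rel_res n x)\<^sup>2 + 2 * (infl_bias n)\<^sup>2"
    using sum_squares_bound[of "rel_res n x" "infl_bias n"] by (simp add: power2_sum)
  also have "\<dots> \<le> 2 * rel_res n x + 2 * (infl_bias n)\<^sup>2"
    using rel_res_bounds[of n x] mult_left_mono[of "rel_res n x" 1 "rel_res n x"] by (simp add: power2_eq_square)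
  finally show ?thesis using \<zeta> by (simp add: power_mult_distrib y_def \<zeta>_def field_simps)
qed

lemma Tinv_V: "Tinv (V n \<omega>) = (1 / sqrt (real n)) *\<^sub>R (\<Sum>i<n. Tinv (W (Xs i \<omega>)))"
proof -
  have lin: "linear Tinv" by (rule bounded_linear.linear[OF bounded_linear_inv_hess])
  show ?thesis unfolding V_def by (simp only: linear_scale[OF lin] linear_sum[OF lin])
qed

lemma bounded_linear_image_mean_zero:
  assumes "bounded_linear f" shows "(\<integral>x. f (W x) \<partial>\<mu>) = 0"
  using integral_bounded_linear[OF assms integrable_sgn[of Q u]] linear_0[OF bounded_linear.linear[OF assms]] by (simp add: gradient)

lemma norm_Tinv_W: "norm (Tinv (W x)) \<le> K * 2"
  using K(2)[of "W x"] mult_left_mono[OF norm_W[of x] K(1)] by simp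

lemma integrable_Tinv_W_sq: "integrable \<mu> (\<lambda>x. (norm (Tinv (W x)))\<^sup>2)"
proof (rule integrable_const_bound[of _ "(K * 2)\<^sup>2"])
  show "AE x in \<mu>. norm ((norm (Tinv (W x)))\<^sup>2) \<le> (K * 2)\<^sup>2"
    using power_mono[OF norm_Tinv_W norm_ge_zero, of _ 2] by (intro AE_I2) simp
qed measurable

lemma Tinv_V_second_moment:
  "integrable M (\<lambda>\<omega>. (norm (Tinv (V n \<omega>)))\<^sup>2)"
  "(\<integral>\<omega>. (norm (Tinv (V n \<omega>)))\<^sup>2 \<partial>M) \<le> (K * 2)\<^sup>2"
proof -
  have meas: "(\<lambda>x. Tinv (W x)) \<in> borel_measurable borel" by measurable
  note sm = sample.iid_normalized_sum_second_moment[OF meas integrable_Tinv_W_sq bounded_linear_image_mean_zero[OF bounded_linear_inv_hess]]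
  show "integrable M (\<lambda>\<omega>. (norm (Tinv (V n \<omega>)))\<^sup>2)" unfolding Tinv_V by (rule sm(1))
  have "(\<integral>x. (norm (Tinv (W x)))\<^sup>2 \<partial>\<mu>) \<le> (\<integral>x. (K * 2)\<^sup>2 \<partial>\<mu>)"
    by (intro integral_mono integrable_Tinv_W_sq power_mono norm_Tinv_W) auto
  also have "\<dots> = (K * 2)\<^sup>2" using prob_space by simp
  finally show "(\<integral>\<omega>. (norm (Tinv (V n \<omega>)))\<^sup>2 \<partial>M) \<le> (K * 2)\<^sup>2"
    unfolding Tinv_V using sm(2)[of n] by linarith
qed

definition rem_bound :: "nat \<Rightarrow> real" where
  "rem_bound n = sqrt (real n) * mean_res n + mean_ratio n + B / sqrt (real n)
     + sqrt (real (d n) / real n * inv_sq_moment Q)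
     + sqrt (2 / (inv_moment Q)\<^sup>2 * (mean_res n + (infl_bias n)\<^sup>2))"

lemma mean_res_tendsto_0: "mean_res \<longlonglongrightarrow> 0"
proof (rule tendsto_sandwich[OF _ _ tendsto_const mean_res_tendsto])
  show "\<forall>\<^sub>F n in sequentially. 0 \<le> mean_res n" by (simp add: mean_res_nonneg)
  show "\<forall>\<^sub>F n in sequentially. mean_res n \<le> sqrt (real n) * mean_res n"
    using eventually_gt_at_top[of "0::nat"]
  proof eventually_elim
    case (elim n)
    then have "1 * mean_res n \<le> sqrt (real n) * mean_res n" by (intro mult_right_mono mean_res_nonneg) simp
    then show ?case by simp
  qed
qed

lemma rem_bound_tendsto: "rem_bound \<longlonglongrightarrow> 0"
proof -
  have "rem_bound \<longlonglongrightarrow> 0 + 0 + 0 + sqrt (0 * inv_sq_moment Q) + sqrt (2 / (inv_moment Q)\<^sup>2 * (0 + 0\<^sup>2))"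
    unfolding rem_bound_def
    by (intro tendsto_intros mean_res_tendsto mean_ratio_tendsto sqrt_n_at_top dim mean_res_tendsto_0 infl_bias_tendsto)
  then show ?thesis by simp
qed

text \<open>The first three summands are averages and pass to their means; the last two go through
  second moments and Jensen, whence the square roots in \<open>rem_bound\<close>. Each of the
  \<open>d n\<close> columns of the empirical Hessian has mean squared deviation at most
  \<open>inv_sq_moment Q / n\<close>, which produces \<open>d n / n\<close>.\<close>

lemma remainder_expectation:
  assumes g: "good n"
  shows "integrable M (remainder n)" "(\<integral>\<omega>. remainder n \<omega> \<partial>M) \<le> rem_bound n"
proof -
  have n: "n > 0" using g by (simp add: good_def)
  let ?q = "sqrt (real n)"
  define e1 where "e1 = (\<lambda>\<omega>. (1 / ?q) * (\<Sum>i<n. rel_res n (Xs i \<omega>)))"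
  define e2 where "e2 = (\<lambda>\<omega>. (1 / real n) * (\<Sum>i<n. rel_res n (Xs i \<omega>) / proj_dist n (Xs i \<omega>)))"
  define e3 where "e3 = (\<lambda>\<omega>. (1 / (real n * ?q)) * (\<Sum>i<n. 1 / (proj_dist n (Xs i \<omega>))\<^sup>2))"
  define S where "S = (\<lambda>\<omega>. \<Sum>k<d n. (norm ((1 / real n) *\<^sub>R (\<Sum>i<n. curv Q (Xs i \<omega>) (\<phi> k)) - T (\<phi> k)))\<^sup>2)"
  define e6 where "e6 = (\<lambda>\<omega>. norm (Tinv (V n \<omega>) - \<pi> (d n) (Tinv (V n \<omega>))))"
  have rem: "remainder n \<omega> = e1 \<omega> + e2 \<omega> + e3 \<omega> + sqrt (S \<omega>) + e6 \<omega>" for \<omega>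
    by (simp only: remainder_def e1_def e2_def e3_def S_def e6_def)
  note iratio = mean_ratio_bound(1)[OF g]
  have iq: "integrable \<mu> (\<lambda>x. 1 / (proj_dist n x)\<^sup>2)" and B: "(\<integral>x. 1 / (proj_dist n x)\<^sup>2 \<partial>\<mu>) \<le> B"
    using g by (auto simp: good_def)
  have i1: "integrable M e1" unfolding e1_def
    by (intro integrable_mult_right Bochner_Integration.integrable_sum sample.iid_integrable integrable_rel_res)
  have i2: "integrable M e2" unfolding e2_def
    by (intro integrable_mult_right Bochner_Integration.integrable_sum sample.iid_integrable[OF iratio])
  have i3: "integrable M e3" unfolding e3_def
    by (intro integrable_mult_right Bochner_Integration.integrable_sum sample.iid_integrable[OF iq])
  have E1: "(\<integral>\<omega>. e1 \<omega> \<partial>M) = ?q * mean_res n"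
  proof -
    have "(\<integral>\<omega>. e1 \<omega> \<partial>M) = (1 / ?q) * (real n *\<^sub>R mean_res n)"
      unfolding e1_def integral_mult_right_zero mean_res_def
      by (subst sample.iid_sum_integral) (auto intro: integrable_rel_res)
    also have "\<dots> = (real n / ?q) * mean_res n" by simp
    finally show ?thesis by (simp only: real_div_sqrt of_nat_0_le_iff)
  qed
  have E2: "(\<integral>\<omega>. e2 \<omega> \<partial>M) = mean_ratio n"
    unfolding e2_def integral_mult_right_zero mean_ratio_def
    by (subst sample.iid_sum_integral[OF _ iratio]) (use n in auto)
  have E3: "(\<integral>\<omega>. e3 \<omega> \<partial>M) \<le> B / ?q"
  proof -
    have "(\<integral>\<omega>. e3 \<omega> \<partial>M) = (1 / (real n * ?q)) * (real n *\<^sub>R (\<integral>x. 1 / (proj_dist n x)\<^sup>2 \<partial>\<mu>))"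
      unfolding e3_def integral_mult_right_zero by (subst sample.iid_sum_integral[OF _ iq]) auto
    also have "\<dots> = (\<integral>x. 1 / (proj_dist n x)\<^sup>2 \<partial>\<mu>) / ?q" using n by simp
    also have "\<dots> \<le> B / ?q" using B by (intro divide_right_mono) auto
    finally show ?thesis .
  qed
  have S0: "0 \<le> S \<omega>" for \<omega> unfolding S_def by (intro sum_nonneg) simp
  have curvsq: "integrable \<mu> (\<lambda>x. (norm (curv Q x (\<phi> k)))\<^sup>2)" "(\<integral>x. (norm (curv Q x (\<phi> k)))\<^sup>2 \<partial>\<mu>) \<le> inv_sq_moment Q" for k
  proof -
    have le: "(norm (curv Q x (\<phi> k)))\<^sup>2 \<le> 1 / (norm (Q - x))\<^sup>2" for x
      using power_mono[OF norm_curv_le[of Q x "\<phi> k"] norm_ge_zero, of 2] by (simp add: power_divide)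
    show int: "integrable \<mu> (\<lambda>x. (norm (curv Q x (\<phi> k)))\<^sup>2)"
      by (rule Bochner_Integration.integrable_bound[OF integrable_inv_sq[of Q]]) (use le in auto)
    show "(\<integral>x. (norm (curv Q x (\<phi> k)))\<^sup>2 \<partial>\<mu>) \<le> inv_sq_moment Q"
      unfolding inv_sq_moment_def by (intro integral_mono int integrable_inv_sq le)
  qed
  have [measurable]: "(\<lambda>x. curv Q x (\<phi> k)) \<in> borel_measurable borel" for k by (rule curv_measurable)
  have [measurable]: "S \<in> borel_measurable M" unfolding S_def by measurable
  note dev = sample.iid_mean_deviation[OF curv_measurable curvsq(1) n, folded hess_def]
  have iS: "integrable M S" unfolding S_def by (intro Bochner_Integration.integrable_sum dev(1))
  have ES: "(\<integral>\<omega>. S \<omega> \<partial>M) \<le> real (d n) / real n * inv_sq_moment Q"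
  proof -
    have "(\<integral>\<omega>. S \<omega> \<partial>M) = (\<Sum>k<d n. \<integral>\<omega>. (norm ((1 / real n) *\<^sub>R (\<Sum>i<n. curv Q (Xs i \<omega>) (\<phi> k)) - T (\<phi> k)))\<^sup>2 \<partial>M)"
      unfolding S_def by (rule Bochner_Integration.integral_sum) (rule dev(1))
    also have "\<dots> \<le> (\<Sum>k<d n. inv_sq_moment Q / real n)"
    proof (rule sum_mono)
      fix k
      have "(\<integral>\<omega>. (norm ((1 / real n) *\<^sub>R (\<Sum>i<n. curv Q (Xs i \<omega>) (\<phi> k)) - T (\<phi> k)))\<^sup>2 \<partial>M)
          \<le> (\<integral>x. (norm (curv Q x (\<phi> k)))\<^sup>2 \<partial>\<mu>) / real n" by (rule dev(2))
      also have "\<dots> \<le> inv_sq_moment Q / real n" by (intro divide_right_mono curvsq) simp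
      finally show "(\<integral>\<omega>. (norm ((1 / real n) *\<^sub>R (\<Sum>i<n. curv Q (Xs i \<omega>) (\<phi> k)) - T (\<phi> k)))\<^sup>2 \<partial>M) \<le> inv_sq_moment Q / real n" .
    qed
    finally show ?thesis by simp
  qed
  have isS: "integrable M (\<lambda>\<omega>. sqrt (S \<omega>))"
  proof (rule sample.square_integrable_imp_integrable)
    show "integrable M (\<lambda>\<omega>. (sqrt (S \<omega>))\<^sup>2)" using iS S0 by simp
  qed measurable
  have E5: "(\<integral>\<omega>. sqrt (S \<omega>) \<partial>M) \<le> sqrt (real (d n) / real n * inv_sq_moment Q)"
    by (rule sample.expectation_le_sqrt) (use iS S0 ES in auto)
  \<comment> \<open>The part of the linearized quantile outside of the subspace is again a
    normalized sum of centred terms, so the second moment of one influence residual bounds its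
    own.\<close>
  have e6: "e6 \<omega> = norm ((1 / ?q) *\<^sub>R (\<Sum>i<n. Res n (Tinv (W (Xs i \<omega>)))))" for \<omega>
  proof -
    have lin: "linear (Res n)" by (rule bounded_linear.linear[OF bounded_linear_Res])
    have "e6 \<omega> = norm (Res n (Tinv (V n \<omega>)))" by (simp add: e6_def Res_def)
    then show ?thesis unfolding Tinv_V by (simp only: linear_scale[OF lin] linear_sum[OF lin])
  qed
  have [measurable]: "e6 \<in> borel_measurable M" unfolding e6_def by measurable
  have bl: "bounded_linear (\<lambda>z. Res n (Tinv z))"
    by (rule bounded_linear_compose[OF bounded_linear_Res bounded_linear_inv_hess])
  have isq: "integrable \<mu> (\<lambda>x. (norm (Res n (Tinv (W x))))\<^sup>2)"
    by (rule Bochner_Integration.integrable_bound[OF integrable_Tinv_W_sq])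
       (auto intro!: AE_I2 power_mono simp: Res_def norm_residual_le)
  have meas: "(\<lambda>x. Res n (Tinv (W x))) \<in> borel_measurable borel" by measurable
  note sm = sample.iid_normalized_sum_second_moment[OF meas isq bounded_linear_image_mean_zero[OF bl], of n, folded e6]
  have "(\<integral>x. (norm (Res n (Tinv (W x))))\<^sup>2 \<partial>\<mu>) \<le> (\<integral>x. 2 / (inv_moment Q)\<^sup>2 * (rel_res n x + (infl_bias n)\<^sup>2) \<partial>\<mu>)"
    by (intro integral_mono isq norm_Res_influence g integrable_mult_right Bochner_Integration.integrable_add integrable_rel_res) simp
  also have "\<dots> = 2 / (inv_moment Q)\<^sup>2 * (mean_res n + (infl_bias n)\<^sup>2)"
    unfolding integral_mult_right_zero mean_res_def using integrable_rel_res prob_space by simp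
  finally have E6sq: "(\<integral>\<omega>. (e6 \<omega>)\<^sup>2 \<partial>M) \<le> 2 / (inv_moment Q)\<^sup>2 * (mean_res n + (infl_bias n)\<^sup>2)"
    using sm(2) by linarith
  have i6: "integrable M e6" by (rule sample.square_integrable_imp_integrable[OF _ sm(1)]) measurable
  have E6: "(\<integral>\<omega>. e6 \<omega> \<partial>M) \<le> sqrt (2 / (inv_moment Q)\<^sup>2 * (mean_res n + (infl_bias n)\<^sup>2))"
    by (rule sample.expectation_le_sqrt[OF sm(1) _ E6sq]) measurable
  show "integrable M (remainder n)"
    unfolding rem[abs_def] by (intro Bochner_Integration.integrable_add i1 i2 i3 isS i6)
  have "(\<integral>\<omega>. remainder n \<omega> \<partial>M) = (\<integral>\<omega>. e1 \<omega> \<partial>M) + (\<integral>\<omega>. e2 \<omega> \<partial>M) + (\<integral>\<omega>. e3 \<omega> \<partial>M) + (\<integral>\<omega>. sqrt (S \<omega>) \<partial>M) + (\<integral>\<omega>. e6 \<omega> \<partial>M)"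
    unfolding rem by (simp add: i1 i2 i3 isS i6)
  then show "(\<integral>\<omega>. remainder n \<omega> \<partial>M) \<le> rem_bound n"
    unfolding rem_bound_def using E1 E2 E3 E5 E6 by linarith
qed

text \<open>Up to a null set, \<open>quantile_close\<close> fails only if the linearized quantile is
  longer than \<open>C\<close> or the remainder reaches \<open>\<tau>\<close>; the second moment and
  the first moment, respectively, make both events improbable.\<close>

lemma quantile_linearization:
  fixes Qhat :: "nat \<Rightarrow> 'c \<Rightarrow> 'a"
  assumes meas: "\<And>n. 1 \<le> n \<Longrightarrow> Qhat n \<in> borel_measurable M"
    and min: "\<And>n \<omega>. 1 \<le> n \<Longrightarrow> \<omega> \<in> space M \<Longrightarrow> is_sample_quantile (basis_span \<phi> (d n)) n (\<lambda>i. Xs i \<omega>) u (Qhat n \<omega>)"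
    and \<epsilon>: "0 < \<epsilon>"
  shows "(\<lambda>n. measure M {\<omega> \<in> space M. \<epsilon> < norm (sqrt (real n) *\<^sub>R (Qhat n \<omega> - Q) - (- Tinv (V n \<omega>)))}) \<longlonglongrightarrow> 0"
proof (rule LIMSEQ_I)
  fix \<rho> :: real assume \<rho>: "0 < \<rho>"
  define \<delta> where "\<delta> = \<epsilon> / 3"
  have \<delta>: "\<delta> > 0" using \<epsilon> by (simp add: \<delta>_def)
  \<comment> \<open>Chosen so that Markov's inequality for second moments leaves less than
    \<open>\<rho> / 2\<close> for lengths above \<open>C\<close>.\<close>
  define C where "C = sqrt (2 * ((K * 2)\<^sup>2 + 1) / \<rho>)"
  have C: "C > 0" "(K * 2)\<^sup>2 / C\<^sup>2 < \<rho> / 2"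
  proof -
    have "0 < (K * 2)\<^sup>2 + 1" by (intro add_nonneg_pos) auto
    then show "C > 0" using \<rho> by (simp add: C_def)
    have C2: "C\<^sup>2 = 2 * ((K * 2)\<^sup>2 + 1) / \<rho>" using \<rho> by (simp add: C_def)
    have "a / (2 * (a + 1) / \<rho>) = (a / (a + 1)) * (\<rho> / 2)" for a by (simp add: mult.commute)
    then have "(K * 2)\<^sup>2 / C\<^sup>2 = ((K * 2)\<^sup>2 / ((K * 2)\<^sup>2 + 1)) * (\<rho> / 2)" unfolding C2 .
    also have "\<dots> < 1 * (\<rho> / 2)"
      using \<rho> \<open>0 < (K * 2)\<^sup>2 + 1\<close> by (intro mult_strict_right_mono) (auto simp: divide_less_eq)
    finally show "(K * 2)\<^sup>2 / C\<^sup>2 < \<rho> / 2" by simp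
  qed
  define P where "P = (C + \<delta>) + 2 * (C + \<delta>)\<^sup>2 + 9 * (C + \<delta>) ^ 3"
  \<comment> \<open>\<open>\<tau>\<close> comes after \<open>\<delta>\<close> and \<open>C\<close>:
    at \<open>\<tau> = 0\<close> the inequality reads \<open>0 < coerc Q * \<delta>\<^sup>2\<close>,
    and it persists nearby by continuity.\<close>
  obtain \<tau> where \<tau>: "0 < \<tau>" "\<tau> \<le> \<delta>" "inv_moment Q * \<tau>\<^sup>2 + 4 * (P * \<tau>) < coerc Q * (\<delta> - \<tau>)\<^sup>2"
  proof -
    have "((\<lambda>\<tau>. coerc Q * (\<delta> - \<tau>)\<^sup>2 - (inv_moment Q * \<tau>\<^sup>2 + 4 * (P * \<tau>))) \<longlongrightarrow>
        coerc Q * (\<delta> - 0)\<^sup>2 - (inv_moment Q * 0\<^sup>2 + 4 * (P * 0))) (at_right 0)"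
      by (intro tendsto_intros)
    moreover have "0 < coerc Q * (\<delta> - 0)\<^sup>2 - (inv_moment Q * 0\<^sup>2 + 4 * (P * 0))"
      using coerc_pos[of Q] \<delta> by simp
    ultimately have "\<forall>\<^sub>F \<tau> in at_right 0. 0 < coerc Q * (\<delta> - \<tau>)\<^sup>2 - (inv_moment Q * \<tau>\<^sup>2 + 4 * (P * \<tau>))"
      by (rule order_tendstoD)
    moreover have "\<forall>\<^sub>F \<tau> in at_right 0. \<tau> \<in> {0<..<\<delta>}" using \<delta> by (rule eventually_at_right_real)
    ultimately have "\<forall>\<^sub>F \<tau> in at_right 0. 0 < coerc Q * (\<delta> - \<tau>)\<^sup>2 - (inv_moment Q * \<tau>\<^sup>2 + 4 * (P * \<tau>)) \<and> \<tau> \<in> {0<..<\<delta>}"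
      by (rule eventually_conj)
    then obtain \<tau> where "0 < coerc Q * (\<delta> - \<tau>)\<^sup>2 - (inv_moment Q * \<tau>\<^sup>2 + 4 * (P * \<tau>)) \<and> \<tau> \<in> {0<..<\<delta>}"
      using eventually_happens by (metis (no_types, lifting) trivial_limit_at_right_real)
    then show ?thesis by (intro that[of \<tau>]) auto
  qed
  let ?bad = "\<lambda>n. {\<omega> \<in> space M. \<epsilon> < norm (sqrt (real n) *\<^sub>R (Qhat n \<omega> - Q) - (- Tinv (V n \<omega>)))}"
  have "\<forall>\<^sub>F n in sequentially. rem_bound n < \<rho> / 2 * \<tau>"
    by (rule order_tendstoD[OF rem_bound_tendsto]) (use \<rho> \<tau> in auto)
  moreover have "\<forall>\<^sub>F n in sequentially. sqrt (real n) * norm (Q - \<pi> (d n) Q) < \<delta>"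
    by (rule order_tendstoD[OF Q_approx]) (use \<delta> in auto)
  ultimately have "\<forall>\<^sub>F n in sequentially. measure M (?bad n) < \<rho>"
    using eventually_good
  proof eventually_elim
    case (elim n)
    have n: "n > 0" "1 \<le> n" using elim(3) by (auto simp: good_def)
    note [measurable] = meas[OF n(2)] and bias = elim(2)
    have "AE x in \<mu>. \<pi> (d n) (Q - x) \<noteq> 0" using elim(3) by (auto simp: good_def proj_dist_def)
    \<comment> \<open>The norm has no expansion where a projected observation hits the projection of
      \<open>Q\<close>; this is discarded as a null event.\<close>
    then have ae: "AE \<omega> in M. \<forall>i. \<pi> (d n) (Q - Xs i \<omega>) \<noteq> 0"
      unfolding AE_all_countable using sample.iid_AE[of "\<lambda>x. \<pi> (d n) (Q - x) \<noteq> 0"] by blast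
    have "measure M (?bad n) \<le> measure M ({\<omega> \<in> space M. C < norm (Tinv (V n \<omega>))} \<union> {\<omega> \<in> space M. \<tau> \<le> remainder n \<omega>})"
    proof (rule sample.finite_measure_mono_AE)
      show "AE \<omega> in M. \<omega> \<in> ?bad n \<longrightarrow> \<omega> \<in> {\<omega> \<in> space M. C < norm (Tinv (V n \<omega>))} \<union> {\<omega> \<in> space M. \<tau> \<le> remainder n \<omega>}"
        using ae
      proof eventually_elim
        case (elim \<omega>)
        note pos = elim
        show ?case
        proof (intro impI, rule ccontr)
          assume bad: "\<omega> \<in> ?bad n"
            and not: "\<omega> \<notin> {\<omega> \<in> space M. C < norm (Tinv (V n \<omega>))} \<union> {\<omega> \<in> space M. \<tau> \<le> remainder n \<omega>}"
          have \<omega>: "\<omega> \<in> space M" using bad by simp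
          have "norm (sqrt (real n) *\<^sub>R (Qhat n \<omega> - Q) + Tinv (V n \<omega>)) \<le> 3 * \<delta>"
            by (rule quantile_close[OF n(1) _ min[OF n(2) \<omega>], of C \<delta> \<tau>])
               (use pos not \<omega> \<delta> \<tau> bias in \<open>auto simp: P_def\<close>)
          then show False using bad by (simp add: \<delta>_def)
        qed
      qed
    qed measurable
    also have "\<dots> \<le> measure M {\<omega> \<in> space M. C < norm (Tinv (V n \<omega>))} + measure M {\<omega> \<in> space M. \<tau> \<le> remainder n \<omega>}"
      by (intro measure_Un_le) measurable
    also have "measure M {\<omega> \<in> space M. C < norm (Tinv (V n \<omega>))} \<le> (K * 2)\<^sup>2 / C\<^sup>2"
      by (rule sample.Markov_second_moment) (use Tinv_V_second_moment C in auto)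
    also have "measure M {\<omega> \<in> space M. \<tau> \<le> remainder n \<omega>} \<le> (\<integral>\<omega>. remainder n \<omega> \<partial>M) / \<tau>"
      by (rule integral_Markov_inequality_measure[OF remainder_expectation(1)[OF elim(3)], of "{}"])
         (use \<tau> remainder_nonneg in auto)
    also have "\<dots> \<le> rem_bound n / \<tau>" using \<tau> remainder_expectation(2)[OF elim(3)] by (intro divide_right_mono) auto
    also have "\<dots> < \<rho> / 2" using elim(1) \<tau> by (simp add: divide_less_eq)
    finally show ?case using C(2) by simp
  qed
  then show "\<exists>n0. \<forall>n\<ge>n0. norm (measure M (?bad n) - 0) < \<rho>"
    by (simp add: eventually_sequentially)
qed

end

section \<open>Moment and rate conditions\<close>

text \<open>The extended inverse is infinite at 0, so finiteness forces \<open>F\<close> to be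
  nonzero almost everywhere. Only then does it say the same as the real
  \<open>1 / (F x)\<^sup>2\<close>, whose value at 0 is 0.\<close>

lemma inverse_square_integrable:
  fixes F :: "'a \<Rightarrow> real"
  assumes [measurable]: "F \<in> borel_measurable M" and nn: "\<And>x. 0 \<le> F x"
    and fin: "(\<integral>\<^sup>+x. (inverse (ennreal (F x)))\<^sup>2 \<partial>M) \<le> S" "S < \<infinity>"
  shows "AE x in M. F x \<noteq> 0" "integrable M (\<lambda>x. 1 / (F x)\<^sup>2)" "(\<integral>x. 1 / (F x)\<^sup>2 \<partial>M) \<le> enn2real S"
proof -
  have "AE x in M. (inverse (ennreal (F x)))\<^sup>2 \<noteq> \<infinity>"
    by (rule nn_integral_PInf_AE) (use fin in auto)
  then show "AE x in M. F x \<noteq> 0" by eventually_elim (auto simp: power2_eq_square)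
  have pt: "ennreal (1 / (F x)\<^sup>2) \<le> (inverse (ennreal (F x)))\<^sup>2" for x
    using nn[of x] by (cases "F x = 0") (auto simp: inverse_ennreal ennreal_power divide_inverse power_inverse)
  have le: "(\<integral>\<^sup>+x. ennreal (1 / (F x)\<^sup>2) \<partial>M) \<le> S"
    by (rule order_trans[OF nn_integral_mono fin(1)]) (rule pt)
  show "integrable M (\<lambda>x. 1 / (F x)\<^sup>2)"
    by (rule integrableI_nonneg) (use le fin(2) in auto)
  show "(\<integral>x. 1 / (F x)\<^sup>2 \<partial>M) \<le> enn2real S"
    using le fin(2) by (subst integral_eq_nn_integral) (auto intro: enn2real_mono)
qed

text \<open>Applied to projections of increasing dimension and to the full norm: a finite inverse
  moment at one dimension bounds all of these.\<close>

lemma inverse_square_integrable_mono: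
  fixes F G :: "'a \<Rightarrow> real"
  assumes [measurable]: "G \<in> borel_measurable M" and FG: "\<And>x. 0 \<le> F x" "\<And>x. F x \<le> G x"
    and F: "AE x in M. F x \<noteq> 0" "integrable M (\<lambda>x. 1 / (F x)\<^sup>2)"
  shows "AE x in M. G x \<noteq> 0" "integrable M (\<lambda>x. 1 / (G x)\<^sup>2)" "(\<integral>x. 1 / (G x)\<^sup>2 \<partial>M) \<le> (\<integral>x. 1 / (F x)\<^sup>2 \<partial>M)"
proof -
  show "AE x in M. G x \<noteq> 0" using F(1)
  proof eventually_elim
    case (elim x)
    then show ?case using FG[of x] by linarith
  qed
  have pt: "AE x in M. 1 / (G x)\<^sup>2 \<le> 1 / (F x)\<^sup>2"
    using F(1)
  proof eventually_elim
    case (elim x)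
    then have "0 < F x" using FG(1)[of x] by simp
    then show ?case using FG(2)[of x] by (intro divide_left_mono power_mono) auto
  qed
  show int: "integrable M (\<lambda>x. 1 / (G x)\<^sup>2)"
    by (rule Bochner_Integration.integrable_bound[OF F(2)]) (use pt in auto)
  show "(\<integral>x. 1 / (G x)\<^sup>2 \<partial>M) \<le> (\<integral>x. 1 / (F x)\<^sup>2 \<partial>M)"
    by (intro integral_mono_AE int F(2) pt)
qed

text \<open>The coordinates of \<open>X - m\<close> are \<open>lam k * Y k\<close> with
  \<open>Y k\<close> of unit variance, so Parseval and Tonelli give the mean squared residual of
  \<open>X - m\<close> as the tail sum. Restoring \<open>m\<close> costs the factors 2.\<close>

lemma karhunen_loeve_residual:
  fixes X :: "'b \<Rightarrow> 'a::{real_inner, banach, second_countable_topology}"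
  assumes KL: "karhunen_loeve P X m lam Y \<phi>"
  shows "integrable (distr P borel X) (\<lambda>x. (norm (x - coord_proj \<phi> D x))\<^sup>2)"
    "(\<integral>x. (norm (x - coord_proj \<phi> D x))\<^sup>2 \<partial>distr P borel X)
      \<le> 2 * (norm (m - coord_proj \<phi> D m))\<^sup>2 + 2 * (\<Sum>k. (lam (D + k))\<^sup>2)"
proof -
  interpret P: prob_space P using KL by (simp add: karhunen_loeve_def)
  interpret onb \<phi> using KL by unfold_locales (simp add: karhunen_loeve_def)
  have X [measurable]: "X \<in> borel_measurable P" and X2: "integrable P (\<lambda>\<omega>. (norm (X \<omega>))\<^sup>2)"
    and Ym [measurable]: "\<And>k. Y k \<in> borel_measurable P" and Y2: "\<And>k. integrable P (\<lambda>\<omega>. (Y k \<omega>)\<^sup>2)"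
    and Y0: "\<And>k. P.expectation (Y k) = 0" and Y1: "\<And>k. P.variance (Y k) = 1"
    and exp: "AE \<omega> in P. (\<lambda>k. (lam k * Y k \<omega>) *\<^sub>R \<phi> k) sums (X \<omega> - m)"
    using KL unfolding karhunen_loeve_def by blast+
  let ?R = "\<lambda>z. z - \<pi> D z"
  have [measurable]: "(\<lambda>\<omega>. X \<omega> - m) \<in> borel_measurable P" by measurable
  have EY: "P.expectation (\<lambda>\<omega>. (Y k \<omega>)\<^sup>2) = 1" for k using Y1[of k] by (simp add: Y0)
  have coord: "AE \<omega> in P. \<forall>k. (X \<omega> - m) \<bullet> \<phi> k = lam k * Y k \<omega>"
    using exp
  proof (eventually_elim, intro allI)
    fix \<omega> k assume "(\<lambda>k. (lam k * Y k \<omega>) *\<^sub>R \<phi> k) sums (X \<omega> - m)"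
    then have "(\<lambda>j. ((lam j * Y j \<omega>) *\<^sub>R \<phi> j) \<bullet> \<phi> k) sums ((X \<omega> - m) \<bullet> \<phi> k)"
      by (rule bounded_linear.sums[OF bounded_linear_inner_left])
    moreover have "(\<lambda>j. ((lam j * Y j \<omega>) *\<^sub>R \<phi> j) \<bullet> \<phi> k) sums (\<Sum>j\<in>{k}. ((lam j * Y j \<omega>) *\<^sub>R \<phi> j) \<bullet> \<phi> k)"
      by (rule sums_finite) (auto simp: inner_basis)
    ultimately show "(X \<omega> - m) \<bullet> \<phi> k = lam k * Y k \<omega>" by (simp add: sums_iff inner_basis)
  qed
  have "integrable P (\<lambda>\<omega>. 2 * (norm (X \<omega>))\<^sup>2 + 2 * (norm m)\<^sup>2)" using X2 by simp
  then have Xm2: "integrable P (\<lambda>\<omega>. (norm (X \<omega> - m))\<^sup>2)"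
  proof (rule Bochner_Integration.integrable_bound)
    show "AE \<omega> in P. norm ((norm (X \<omega> - m))\<^sup>2) \<le> norm (2 * (norm (X \<omega>))\<^sup>2 + 2 * (norm m)\<^sup>2)"
    proof (intro AE_I2)
      fix \<omega>
      have "(norm (X \<omega> - m))\<^sup>2 \<le> (norm (X \<omega>) + norm m)\<^sup>2" by (intro power_mono norm_triangle_ineq4) auto
      also have "\<dots> \<le> 2 * (norm (X \<omega>))\<^sup>2 + 2 * (norm m)\<^sup>2"
        using sum_squares_bound[of "norm (X \<omega>)" "norm m"] by (simp add: power2_sum)
      finally show "norm ((norm (X \<omega> - m))\<^sup>2) \<le> norm (2 * (norm (X \<omega>))\<^sup>2 + 2 * (norm m)\<^sup>2)" by simp
    qed
  qed measurable
  have RXm2: "integrable P (\<lambda>\<omega>. (norm (?R (X \<omega> - m)))\<^sup>2)"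
    by (rule Bochner_Integration.integrable_bound[OF Xm2]) (auto intro!: AE_I2 power_mono norm_residual_le)
  have "ennreal (P.expectation (\<lambda>\<omega>. (norm (?R (X \<omega> - m)))\<^sup>2)) = (\<integral>\<^sup>+\<omega>. ennreal ((norm (?R (X \<omega> - m)))\<^sup>2) \<partial>P)"
    using RXm2 by (subst nn_integral_eq_integral) auto
  also have "\<dots> = (\<integral>\<^sup>+\<omega>. (\<Sum>k. ennreal (((X \<omega> - m) \<bullet> \<phi> (D + k))\<^sup>2)) \<partial>P)"
    by (intro nn_integral_cong suminf_ennreal_eq[symmetric] residual_sums) simp
  also have "\<dots> = (\<Sum>k. \<integral>\<^sup>+\<omega>. ennreal (((X \<omega> - m) \<bullet> \<phi> (D + k))\<^sup>2) \<partial>P)"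
    by (rule nn_integral_suminf) measurable
  also have "\<dots> = (\<Sum>k. ennreal ((lam (D + k))\<^sup>2))"
  proof (intro suminf_cong)
    fix k
    have "(\<integral>\<^sup>+\<omega>. ennreal (((X \<omega> - m) \<bullet> \<phi> (D + k))\<^sup>2) \<partial>P) = (\<integral>\<^sup>+\<omega>. ennreal ((lam (D + k))\<^sup>2 * (Y (D + k) \<omega>)\<^sup>2) \<partial>P)"
      by (rule nn_integral_cong_AE) (use coord in eventually_elim, simp add: power_mult_distrib)
    also have "\<dots> = ennreal (P.expectation (\<lambda>\<omega>. (lam (D + k))\<^sup>2 * (Y (D + k) \<omega>)\<^sup>2))"
      using Y2 by (intro nn_integral_eq_integral) auto
    finally show "(\<integral>\<^sup>+\<omega>. ennreal (((X \<omega> - m) \<bullet> \<phi> (D + k))\<^sup>2) \<partial>P) = ennreal ((lam (D + k))\<^sup>2)"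
      by (simp add: EY)
  qed
  finally have sum: "ennreal (P.expectation (\<lambda>\<omega>. (norm (?R (X \<omega> - m)))\<^sup>2)) = (\<Sum>k. ennreal ((lam (D + k))\<^sup>2))" .
  \<comment> \<open>The sum equals a real expectation, hence is finite; summability of the squared
    \<open>lam\<close> is a consequence here.\<close>
  have fin: "(\<Sum>k. ennreal ((lam (D + k))\<^sup>2)) \<noteq> top" unfolding sum[symmetric] by (rule ennreal_neq_top)
  have "(\<Sum>k. ennreal ((lam (D + k))\<^sup>2)) = ennreal (\<Sum>k. (lam (D + k))\<^sup>2)"
    by (rule suminf_ennreal[OF _ fin]) simp
  moreover have "summable (\<lambda>k. (lam (D + k))\<^sup>2)"
    by (rule summable_suminf_not_top[OF _ fin]) simp
  moreover have "0 \<le> P.expectation (\<lambda>\<omega>. (norm (?R (X \<omega> - m)))\<^sup>2)"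
    by (intro Bochner_Integration.integral_nonneg) simp
  ultimately have E: "P.expectation (\<lambda>\<omega>. (norm (?R (X \<omega> - m)))\<^sup>2) = (\<Sum>k. (lam (D + k))\<^sup>2)"
    using sum by (simp only: ennreal_inj suminf_nonneg zero_le_power2)
  have pt: "(norm (?R (X \<omega>)))\<^sup>2 \<le> 2 * (norm (?R m))\<^sup>2 + 2 * (norm (?R (X \<omega> - m)))\<^sup>2" for \<omega>
  proof -
    have "?R (X \<omega>) = ?R m + ?R (X \<omega> - m)" by (simp add: proj_linear_simps)
    then have "(norm (?R (X \<omega>)))\<^sup>2 \<le> (norm (?R m) + norm (?R (X \<omega> - m)))\<^sup>2"
      by (metis norm_ge_zero norm_triangle_ineq power_mono)
    also have "\<dots> \<le> 2 * (norm (?R m))\<^sup>2 + 2 * (norm (?R (X \<omega> - m)))\<^sup>2"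
      using sum_squares_bound[of "norm (?R m)" "norm (?R (X \<omega> - m))"] by (simp add: power2_sum)
    finally show ?thesis .
  qed
  have ib: "integrable P (\<lambda>\<omega>. 2 * (norm (?R m))\<^sup>2 + 2 * (norm (?R (X \<omega> - m)))\<^sup>2)" using RXm2 by simp
  have iRX: "integrable P (\<lambda>\<omega>. (norm (?R (X \<omega>)))\<^sup>2)"
    by (rule Bochner_Integration.integrable_bound[OF ib]) (use pt in \<open>auto intro!: AE_I2 order_trans[OF _ abs_ge_self]\<close>)
  show "integrable (distr P borel X) (\<lambda>x. (norm (?R x))\<^sup>2)" using iRX by (subst integrable_distr_eq) auto
  have "(\<integral>x. (norm (?R x))\<^sup>2 \<partial>distr P borel X) = P.expectation (\<lambda>\<omega>. (norm (?R (X \<omega>)))\<^sup>2)"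
    by (rule integral_distr) measurable
  also have "\<dots> \<le> P.expectation (\<lambda>\<omega>. 2 * (norm (?R m))\<^sup>2 + 2 * (norm (?R (X \<omega> - m)))\<^sup>2)"
    by (intro integral_mono iRX ib pt)
  also have "\<dots> = 2 * (norm (?R m))\<^sup>2 + 2 * (\<Sum>k. (lam (D + k))\<^sup>2)"
    using RXm2 E P.prob_space by simp
  finally show "(\<integral>x. (norm (?R x))\<^sup>2 \<partial>distr P borel X) \<le> 2 * (norm (?R m))\<^sup>2 + 2 * (\<Sum>k. (lam (D + k))\<^sup>2)" .
qed

text \<open>The weight \<open>k\<close> is fixed first, to make \<open>I / k\<close> small, and only
  then \<open>n\<close> grows.\<close>

lemma tendsto_zero_weighted_bound:
  fixes a p :: "nat \<Rightarrow> real"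
  assumes nn: "\<And>n. 0 \<le> a n" and p: "p \<longlonglongrightarrow> 0" and I: "0 \<le> I"
    and le: "\<And>k n. 0 < k \<Longrightarrow> 0 < n \<Longrightarrow> a n \<le> k * p n + I / k"
  shows "a \<longlonglongrightarrow> 0"
proof (rule LIMSEQ_I)
  fix e :: real assume e: "0 < e"
  define k where "k = (2 * I + 1) / e"
  have k: "0 < k" "I / k < e / 2" using e I by (auto simp: k_def field_simps add_nonneg_pos)
  have "(\<lambda>n. k * p n + I / k) \<longlonglongrightarrow> k * 0 + I / k" by (intro tendsto_intros p)
  then have "\<forall>\<^sub>F n in sequentially. k * p n + I / k < e" by (rule order_tendstoD) (use k e in linarith)
  then have "\<forall>\<^sub>F n in sequentially. norm (a n - 0) < e"
    using eventually_gt_at_top[of "0::nat"]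
  proof eventually_elim
    case (elim n)
    then show ?case using le[OF k(1) elim(2)] nn[of n] by simp
  qed
  then show "\<exists>n0. \<forall>n\<ge>n0. norm (a n - 0) < e" by (simp add: eventually_sequentially)
qed

text \<open>Weighted AM-GM against the inverse square moment gives \<open>sqrt n * a n\<close> the
  limit 0. The gradient equation outside of the subspace passes this rate and that of
  \<open>u\<close> on to \<open>Q\<close>; finally the residual of \<open>Q - x\<close> is split
  into those of \<open>Q\<close> and \<open>x\<close>.\<close>

lemma (in spatial) approximation_rates:
  fixes \<phi> :: "nat \<Rightarrow> 'a" and d :: "nat \<Rightarrow> nat"
  assumes basis: "orthonormal_basis \<phi>"
    and grad: "(\<integral>x. sgn (Q - x) - u \<partial>\<mu>) = 0"
    and urate: "(\<lambda>n. sqrt (real n) * norm (u - coord_proj \<phi> (d n) u)) \<longlonglongrightarrow> 0"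
    and sq: "\<And>n. integrable \<mu> (\<lambda>x. (norm (x - coord_proj \<phi> (d n) x))\<^sup>2)"
    and xrate: "(\<lambda>n. real n * (\<integral>x. (norm (x - coord_proj \<phi> (d n) x))\<^sup>2 \<partial>\<mu>)) \<longlonglongrightarrow> 0"
  shows "(\<lambda>n. sqrt (real n) * norm (Q - coord_proj \<phi> (d n) Q)) \<longlonglongrightarrow> 0"
    "(\<lambda>n. sqrt (real n) * (\<integral>x. norm ((Q - x) - coord_proj \<phi> (d n) (Q - x)) / norm (Q - x) \<partial>\<mu>)) \<longlonglongrightarrow> 0"
proof -
  interpret onb \<phi> by unfold_locales fact
  define R where "R n z = z - \<pi> (d n) z" for n z
  have blR: "bounded_linear (R n)" for n
    unfolding R_def by (intro bounded_linear_sub bounded_linear_ident bounded_linear_coord_proj)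
  have [measurable]: "R n \<in> borel_measurable borel" for n unfolding R_def by measurable
  note sq' = sq[folded R_def] and xrate' = xrate[folded R_def]
  define \<zeta> where "\<zeta> = inv_moment Q"
  have \<zeta>: "\<zeta> > 0" using inv_moment_pos by (simp add: \<zeta>_def)
  define a where "a n = (\<integral>x. norm (R n x) / norm (Q - x) \<partial>\<mu>)" for n
  have I: "0 \<le> inv_sq_moment Q" unfolding inv_sq_moment_def by (intro Bochner_Integration.integral_nonneg) simp
  have pt: "norm (R n x) / norm (Q - x) \<le> k * (norm (R n x))\<^sup>2 + (1 / k) * (1 / (norm (Q - x))\<^sup>2)" if k: "k > 0" for k n x
  proof -
    let ?v = "norm (R n x)" and ?w = "1 / norm (Q - x)"
    have "0 \<le> (sqrt k * ?v - ?w / sqrt k)\<^sup>2" by simp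
    also have "\<dots> = k * ?v\<^sup>2 - 2 * (?v * ?w) + ?w\<^sup>2 / k"
      using k by (simp add: power2_diff power_mult_distrib power_divide field_simps)
    finally have "2 * (?v * ?w) \<le> k * ?v\<^sup>2 + ?w\<^sup>2 / k" by linarith
    moreover have "0 \<le> ?v * ?w" by simp
    ultimately have "?v * ?w \<le> k * ?v\<^sup>2 + ?w\<^sup>2 / k" by linarith
    moreover have "?w\<^sup>2 / k = (1 / k) * (1 / (norm (Q - x))\<^sup>2)" by (simp add: power_divide)
    ultimately show ?thesis by simp
  qed
  have ib: "integrable \<mu> (\<lambda>x. k * (norm (R n x))\<^sup>2 + (1 / k) * (1 / (norm (Q - x))\<^sup>2))" for k n
    by (intro Bochner_Integration.integrable_add integrable_mult_right sq' integrable_inv_sq)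
  have ia: "integrable \<mu> (\<lambda>x. norm (R n x) / norm (Q - x))" for n
  proof (rule Bochner_Integration.integrable_bound[OF ib[of 1 n]])
    show "AE x in \<mu>. norm (norm (R n x) / norm (Q - x)) \<le> norm (1 * (norm (R n x))\<^sup>2 + (1 / 1) * (1 / (norm (Q - x))\<^sup>2))"
      using pt[of 1 n] by (intro AE_I2) auto
  qed measurable
  have a0: "0 \<le> a n" for n unfolding a_def by (intro Bochner_Integration.integral_nonneg) simp
  have a_le: "a n \<le> k * (\<integral>x. (norm (R n x))\<^sup>2 \<partial>\<mu>) + (1 / k) * inv_sq_moment Q" if "k > 0" for k n
  proof -
    have "a n \<le> (\<integral>x. k * (norm (R n x))\<^sup>2 + (1 / k) * (1 / (norm (Q - x))\<^sup>2) \<partial>\<mu>)"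
      unfolding a_def by (intro integral_mono ia ib pt that)
    also have "\<dots> = (\<integral>x. k * (norm (R n x))\<^sup>2 \<partial>\<mu>) + (\<integral>x. (1 / k) * (1 / (norm (Q - x))\<^sup>2) \<partial>\<mu>)"
      by (intro Bochner_Integration.integral_add integrable_mult_right sq' integrable_inv_sq)
    finally show ?thesis unfolding integral_mult_right_zero inv_sq_moment_def .
  qed
  have arate: "(\<lambda>n. sqrt (real n) * a n) \<longlonglongrightarrow> 0"
  proof (rule tendsto_zero_weighted_bound[OF _ xrate' I])
    show "0 \<le> sqrt (real n) * a n" for n using a0 by simp
    show "sqrt (real n) * a n \<le> k * (real n * (\<integral>x. (norm (R n x))\<^sup>2 \<partial>\<mu>)) + inv_sq_moment Q / k"
      if "0 < k" "0 < n" for k n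
    proof -
      define q where "q = sqrt (real n)"
      have q: "q > 0" "q * q = real n" using that by (auto simp: q_def)
      \<comment> \<open>The weight \<open>q * k\<close> with \<open>q = sqrt n\<close> turns the
        first term into \<open>n\<close> times the mean squared residual and leaves
        \<open>1 / k\<close> at the second.\<close>
      have "q * a n \<le> q * ((q * k) * (\<integral>x. (norm (R n x))\<^sup>2 \<partial>\<mu>) + (1 / (q * k)) * inv_sq_moment Q)"
        using q that by (intro mult_left_mono a_le) auto
      also have "\<dots> = k * ((q * q) * (\<integral>x. (norm (R n x))\<^sup>2 \<partial>\<mu>)) + inv_sq_moment Q / k"
        using q(1) that by (simp add: distrib_left mult_ac)
      finally show ?thesis unfolding q(2) by (simp add: q_def)
    qed
  qed
  have RQ: "\<zeta> * norm (R n Q) \<le> norm (R n u) + a n" for n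
  proof -
    interpret R: bounded_linear "R n" by (rule blR)
    define G where "G x = (1 / norm (Q - x)) *\<^sub>R R n x" for x
    have [measurable]: "G \<in> borel_measurable borel" unfolding G_def by measurable
    have iG: "integrable \<mu> G"
      by (rule Bochner_Integration.integrable_bound[OF ia[of n]]) (auto simp: G_def)
    have "R n (\<integral>x. sgn (Q - x) - u \<partial>\<mu>) = (\<integral>x. R n (sgn (Q - x) - u) \<partial>\<mu>)"
      by (rule integral_bounded_linear[OF blR integrable_sgn, symmetric])
    also have "\<dots> = (\<integral>x. ((1 / norm (Q - x)) *\<^sub>R R n Q - G x) - R n u \<partial>\<mu>)"
      by (simp add: G_def sgn_div_norm R.diff R.scaleR inverse_eq_divide scaleR_diff_right)
    also have "\<dots> = (\<integral>x. (1 / norm (Q - x)) *\<^sub>R R n Q - G x \<partial>\<mu>) - (\<integral>x. R n u \<partial>\<mu>)"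
      by (intro Bochner_Integration.integral_diff Bochner_Integration.integrable_diff iG integrable_scaleR_left integrable_inv) simp
    also have "(\<integral>x. (1 / norm (Q - x)) *\<^sub>R R n Q - G x \<partial>\<mu>) = (\<integral>x. (1 / norm (Q - x)) *\<^sub>R R n Q \<partial>\<mu>) - (\<integral>x. G x \<partial>\<mu>)"
      by (intro Bochner_Integration.integral_diff iG integrable_scaleR_left integrable_inv)
    also have "(\<integral>x. (1 / norm (Q - x)) *\<^sub>R R n Q \<partial>\<mu>) = \<zeta> *\<^sub>R R n Q"
      unfolding \<zeta>_def inv_moment_def by (rule integral_scaleR_left) (rule integrable_inv)
    also have "(\<integral>x. R n u \<partial>\<mu>) = R n u" using prob_space by simp
    \<comment> \<open>The scalar \<open>1 / norm (Q - x)\<close> averages to \<open>\<zeta>\<close>,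
      so the residual of \<open>Q\<close> is expressed through those of \<open>u\<close> and of the
      data.\<close>
    finally have "\<zeta> *\<^sub>R R n Q = R n u + (\<integral>x. G x \<partial>\<mu>)" by (simp add: grad R.zero algebra_simps)
    then have "norm (\<zeta> *\<^sub>R R n Q) \<le> norm (R n u) + norm (\<integral>x. G x \<partial>\<mu>)" by (simp only: norm_triangle_ineq)
    moreover have "norm (\<integral>x. G x \<partial>\<mu>) \<le> a n"
    proof -
      have eq: "(\<lambda>x. norm (G x)) = (\<lambda>x. norm (R n x) / norm (Q - x))" by (auto simp: G_def)
      show ?thesis using integral_norm_bound[of \<mu> G] unfolding eq a_def .
    qed
    ultimately show ?thesis using \<zeta> by simp
  qed
  have Qrate: "(\<lambda>n. \<zeta> * (sqrt (real n) * norm (R n Q))) \<longlonglongrightarrow> 0"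
  proof (rule tendsto_sandwich[OF _ _ tendsto_const])
    show "\<forall>\<^sub>F n in sequentially. 0 \<le> \<zeta> * (sqrt (real n) * norm (R n Q))" using \<zeta> by simp
    show "\<forall>\<^sub>F n in sequentially. \<zeta> * (sqrt (real n) * norm (R n Q)) \<le> sqrt (real n) * norm (R n u) + sqrt (real n) * a n"
    proof (intro always_eventually allI)
      fix n
      have "sqrt (real n) * (\<zeta> * norm (R n Q)) \<le> sqrt (real n) * (norm (R n u) + a n)" by (intro mult_left_mono RQ) simp
      then show "\<zeta> * (sqrt (real n) * norm (R n Q)) \<le> sqrt (real n) * norm (R n u) + sqrt (real n) * a n"
        by (simp add: distrib_left mult_ac)
    qed
    have "(\<lambda>n. sqrt (real n) * norm (R n u) + sqrt (real n) * a n) \<longlonglongrightarrow> 0 + 0"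
      using urate unfolding R_def by (intro tendsto_add arate[unfolded R_def])
    then show "(\<lambda>n. sqrt (real n) * norm (R n u) + sqrt (real n) * a n) \<longlonglongrightarrow> 0" by simp
  qed
  have "(\<lambda>n. (1 / \<zeta>) * (\<zeta> * (sqrt (real n) * norm (R n Q)))) \<longlonglongrightarrow> (1 / \<zeta>) * 0" by (intro tendsto_intros Qrate)
  then show "(\<lambda>n. sqrt (real n) * norm (Q - \<pi> (d n) Q)) \<longlonglongrightarrow> 0" using \<zeta> by (simp add: R_def)
  show "(\<lambda>n. sqrt (real n) * (\<integral>x. norm ((Q - x) - \<pi> (d n) (Q - x)) / norm (Q - x) \<partial>\<mu>)) \<longlonglongrightarrow> 0"
    unfolding R_def[symmetric]
  proof (rule tendsto_sandwich[OF _ _ tendsto_const])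
    show "\<forall>\<^sub>F n in sequentially. 0 \<le> sqrt (real n) * (\<integral>x. norm (R n (Q - x)) / norm (Q - x) \<partial>\<mu>)"
      by (intro always_eventually allI mult_nonneg_nonneg Bochner_Integration.integral_nonneg) auto
    have pt': "norm (R n (Q - x)) / norm (Q - x) \<le> norm (R n Q) * (1 / norm (Q - x)) + norm (R n x) / norm (Q - x)" for n x
    proof -
      interpret R: bounded_linear "R n" by (rule blR)
      have "norm (R n (Q - x)) / norm (Q - x) \<le> (norm (R n Q) + norm (R n x)) / norm (Q - x)"
        unfolding R.diff by (intro divide_right_mono norm_triangle_ineq4) simp
      then show ?thesis by (simp add: add_divide_distrib)
    qed
    have ib': "integrable \<mu> (\<lambda>x. norm (R n Q) * (1 / norm (Q - x)) + norm (R n x) / norm (Q - x))" for n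
      by (intro Bochner_Integration.integrable_add integrable_mult_right integrable_inv ia)
    have int: "(\<integral>x. norm (R n (Q - x)) / norm (Q - x) \<partial>\<mu>) \<le> norm (R n Q) * \<zeta> + a n" for n
    proof -
      have "integrable \<mu> (\<lambda>x. norm (R n (Q - x)) / norm (Q - x))"
        by (rule Bochner_Integration.integrable_bound[OF ib'[of n]])
           (use pt'[of n] in \<open>auto intro!: AE_I2 order_trans[OF _ abs_ge_self]\<close>)
      then have "(\<integral>x. norm (R n (Q - x)) / norm (Q - x) \<partial>\<mu>)
          \<le> (\<integral>x. norm (R n Q) * (1 / norm (Q - x)) + norm (R n x) / norm (Q - x) \<partial>\<mu>)"
        by (intro integral_mono ib' pt')
      also have "\<dots> = (\<integral>x. norm (R n Q) * (1 / norm (Q - x)) \<partial>\<mu>) + (\<integral>x. norm (R n x) / norm (Q - x) \<partial>\<mu>)"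
        by (intro Bochner_Integration.integral_add integrable_mult_right integrable_inv ia)
      finally show ?thesis unfolding integral_mult_right_zero \<zeta>_def inv_moment_def a_def .
    qed
    show "\<forall>\<^sub>F n in sequentially. sqrt (real n) * (\<integral>x. norm (R n (Q - x)) / norm (Q - x) \<partial>\<mu>)
        \<le> \<zeta> * (sqrt (real n) * norm (R n Q)) + sqrt (real n) * a n"
    proof (intro always_eventually allI)
      fix n
      have "sqrt (real n) * (\<integral>x. norm (R n (Q - x)) / norm (Q - x) \<partial>\<mu>) \<le> sqrt (real n) * (norm (R n Q) * \<zeta> + a n)"
        by (intro mult_left_mono int) simp
      then show "sqrt (real n) * (\<integral>x. norm (R n (Q - x)) / norm (Q - x) \<partial>\<mu>)
        \<le> \<zeta> * (sqrt (real n) * norm (R n Q)) + sqrt (real n) * a n" by (simp add: distrib_left mult_ac)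
    qed
    show "(\<lambda>n. \<zeta> * (sqrt (real n) * norm (R n Q)) + sqrt (real n) * a n) \<longlonglongrightarrow> 0"
      using tendsto_add[OF Qrate arate] by simp
  qed
qed

text \<open>For \<open>\<alpha> = 1 / 2\<close> the dimensions are eventually constant; otherwise they diverge.\<close>

lemma dimension_rate:
  fixes d :: "nat \<Rightarrow> nat"
  assumes c: "c > 0" and lim: "(\<lambda>n. real (d n) / real n powr (1 - 2 * \<alpha>)) \<longlonglongrightarrow> c"
    and \<alpha>: "0 < \<alpha>" "\<alpha> \<le> 1 / 2"
  shows "(\<lambda>n. real (d n) / real n) \<longlonglongrightarrow> 0" "\<exists>N. \<forall>k\<ge>N. \<forall>\<^sub>F n in sequentially. d k \<le> d n"
proof -
  have top: "filterlim real at_top sequentially" by (rule filterlim_real_sequentially)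
  have "(\<lambda>n. real (d n) / real n powr (1 - 2 * \<alpha>) * real n powr (- 2 * \<alpha>)) \<longlonglongrightarrow> c * 0"
    using \<alpha> by (intro tendsto_mult lim tendsto_neg_powr[OF _ top]) auto
  then have "(\<lambda>n. real (d n) / real n powr (1 - 2 * \<alpha>) * real n powr (- 2 * \<alpha>)) \<longlonglongrightarrow> 0" by simp
  moreover have "\<forall>\<^sub>F n in sequentially. real (d n) / real n powr (1 - 2 * \<alpha>) * real n powr (- 2 * \<alpha>) = real (d n) / real n"
    using eventually_gt_at_top[of "0::nat"]
  proof eventually_elim
    case (elim n)
    have "real n powr (1 - 2 * \<alpha>) = real n powr 1 * real n powr (- 2 * \<alpha>)"
      unfolding powr_add[symmetric] by simp
    then show ?case using elim by simp
  qed
  ultimately show "(\<lambda>n. real (d n) / real n) \<longlonglongrightarrow> 0" by (rule Lim_transform_eventually)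
  show "\<exists>N. \<forall>k\<ge>N. \<forall>\<^sub>F n in sequentially. d k \<le> d n"
  proof (cases "\<alpha> = 1 / 2")
    case True
    have "\<forall>\<^sub>F n in sequentially. dist (real (d n) / real n powr (1 - 2 * \<alpha>)) c < 1 / 2"
      by (rule tendstoD[OF lim]) simp
    then have "\<forall>\<^sub>F n in sequentially. \<bar>real (d n) - c\<bar> < 1 / 2"
      using eventually_gt_at_top[of "0::nat"] by eventually_elim (simp add: True dist_real_def)
    then obtain N where N: "\<And>n. n \<ge> N \<Longrightarrow> \<bar>real (d n) - c\<bar> < 1 / 2" unfolding eventually_sequentially by blast
    have "d k \<le> d n" if "k \<ge> N" "n \<ge> N" for k n
    proof -
      \<comment> \<open>Both dimensions lie within \<open>1 / 2\<close> of \<open>c\<close>, so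
        these integers differ by less than 1.\<close>
      have "real (d k) < real (d n) + 1" using N[OF that(1)] N[OF that(2)] by linarith
      then show ?thesis by linarith
    qed
    then show ?thesis unfolding eventually_sequentially by blast
  next
    case False
    have "filterlim (\<lambda>n. real n powr (1 - 2 * \<alpha>)) at_top sequentially"
      using False \<alpha> by (intro filterlim_compose[OF _ top] real_powr_at_top) auto
    then have "filterlim (\<lambda>n. real (d n) / real n powr (1 - 2 * \<alpha>) * real n powr (1 - 2 * \<alpha>)) at_top sequentially"
      by (rule filterlim_tendsto_pos_mult_at_top[OF lim c])
    then have "\<forall>\<^sub>F n in sequentially. real (d k) \<le> real (d n) / real n powr (1 - 2 * \<alpha>) * real n powr (1 - 2 * \<alpha>)" for k
      by (simp add: filterlim_at_top)
    then have "\<forall>\<^sub>F n in sequentially. d k \<le> d n" for k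
      by (rule eventually_elim2[OF _ eventually_gt_at_top[of "0::nat"]]) auto
    then show ?thesis by blast
  qed
qed

text \<open>The existential objects are pinned down by their clauses: \<open>Q\<close> is the only
  minimizer, \<open>J\<close> is unique by polarization, and inner products determine
  \<open>T\<close> and \<open>\<Lambda>\<close>. \<open>Qhat\<close> is an arbitrary measurable
  choice of sample minimizers. The expansion on \<open>P\<close> and the sample on \<open>M\<close>
  are linked only through the law \<open>\<mu>\<close>.\<close>

theorem theorem3p4:
  fixes \<mu> :: "'a::{real_inner, banach, second_countable_topology} measure"
    and P :: "'b measure" and X :: "'b \<Rightarrow> 'a"
    and m :: 'a and lam :: "nat \<Rightarrow> real" and Y :: "nat \<Rightarrow> 'b \<Rightarrow> real" and \<phi> :: "nat \<Rightarrow> 'a"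
    and M :: "'c measure" and Xs :: "nat \<Rightarrow> 'c \<Rightarrow> 'a"
    and u :: 'a and d :: "nat \<Rightarrow> nat" and \<alpha> :: real
    and Qhat :: "nat \<Rightarrow> 'c \<Rightarrow> 'a"
  assumes KL: "karhunen_loeve P X m lam Y \<phi>"
    and law: "distr P borel X = \<mu>"
    and M: "prob_space M"
    and indep: "prob_space.indep_vars M (\<lambda>_. borel) Xs UNIV"
    and ident: "\<And>i. distr M borel (Xs i) = \<mu>"
    and u: "norm u < 1"
    and d_pos: "\<And>n. 0 < d n"
    and nonatomic: "\<And>x. emeasure \<mu> {x} = 0"
    and not_line: "\<not> (\<exists>x y. AE z in \<mu>. z \<in> line_through x y)"
    and inverse_moment: "\<And>C. 0 < C \<Longrightarrow> \<forall>\<^sub>F n in sequentially.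
          (SUP Q \<in> {Q \<in> basis_span \<phi> (d n). norm Q \<le> C}.
             \<integral>\<^sup>+ x. (inverse (ennreal (norm (Q - orth_proj (basis_span \<phi> (d n)) x))))\<^sup>2 \<partial>\<mu>) < \<infinity>"
    and alpha: "1 / 4 < \<alpha>" "\<alpha> \<le> 1 / 2"
    and d_rate: "\<exists>c>0. (\<lambda>n. real (d n) / real n powr (1 - 2 * \<alpha>)) \<longlonglongrightarrow> c"
    and u_rate: "(\<lambda>n. sqrt (real n) * norm (u - orth_proj (basis_span \<phi> (d n)) u)) \<longlonglongrightarrow> 0"
    and m_rate: "(\<lambda>n. sqrt (real n) * norm (m - orth_proj (basis_span \<phi> (d n)) m)) \<longlonglongrightarrow> 0"
    and tail: "(\<lambda>n. real n * (\<Sum>k. (lam (d n + k))\<^sup>2)) \<longlonglongrightarrow> 0"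
    and Qhat_meas: "\<And>n. 1 \<le> n \<Longrightarrow> Qhat n \<in> borel_measurable M"
    and Qhat_min: "\<And>n \<omega>. 1 \<le> n \<Longrightarrow> \<omega> \<in> space M \<Longrightarrow>
          is_sample_quantile (basis_span \<phi> (d n)) n (\<lambda>i. Xs i \<omega>) u (Qhat n \<omega>)"
  shows "\<exists>Q J T \<Lambda>.
    (\<forall>R. is_spatial_quantile \<mu> u R \<longleftrightarrow> R = Q) \<and>
    is_spatial_hessian \<mu> u Q J \<and> represents_form T J \<and> bij T \<and> bounded_linear (inv T) \<and>
    bounded_linear \<Lambda> \<and>
    (\<forall>z w. \<Lambda> z \<bullet> w = (\<integral>x. ((sgn (Q - x) - u) \<bullet> z) * ((sgn (Q - x) - u) \<bullet> w) \<partial>\<mu>)) \<and>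
    (\<exists>(N :: 'a measure) (Z :: 'a \<Rightarrow> 'a).
       gaussian_element N Z 0 (inv T \<circ> \<Lambda> \<circ> inv T) \<and>
       converges_weakly M (\<lambda>n \<omega>. sqrt (real n) *\<^sub>R (Qhat n \<omega> - Q)) N Z)"
proof -
  interpret P: prob_space P using KL by (simp add: karhunen_loeve_def)
  have basis: "orthonormal_basis \<phi>" and X [measurable]: "X \<in> borel_measurable P"
    and X2: "integrable P (\<lambda>\<omega>. (norm (X \<omega>))\<^sup>2)"
    using KL unfolding karhunen_loeve_def by blast+
  interpret onb \<phi> by unfold_locales fact
  interpret \<mu>: prob_space \<mu> unfolding law[symmetric] by (rule P.prob_space_distr) measurable
  interpret M: prob_space M by fact
  have sets_mu [measurable_cong, simp]: "sets \<mu> = sets borel" by (simp add: law[symmetric])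
  obtain c where c: "c > 0" "(\<lambda>n. real (d n) / real n powr (1 - 2 * \<alpha>)) \<longlonglongrightarrow> c" using d_rate by blast
  obtain N0 where N0: "\<And>k. k \<ge> N0 \<Longrightarrow> \<forall>\<^sub>F n in sequentially. d k \<le> d n"
    using dimension_rate(2)[OF c] alpha by auto
  \<comment> \<open>The supremum is tested at the projection of \<open>R\<close>, admissible for the
    radius \<open>norm R + 1\<close>, which is positive even for \<open>R = 0\<close>. The index
    \<open>k\<close> may depend on \<open>R\<close>.\<close>
  have moment: "\<exists>k\<ge>N0. (AE x in \<mu>. norm (\<pi> (d k) (R - x)) \<noteq> 0) \<and> integrable \<mu> (\<lambda>x. 1 / (norm (\<pi> (d k) (R - x)))\<^sup>2)" for R
  proof -
    have "0 < norm R + 1" using norm_ge_zero[of R] by linarith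
    from inverse_moment[OF this] have "\<forall>\<^sub>F n in sequentially. N0 \<le> n \<and>
        (SUP Q \<in> {Q \<in> basis_span \<phi> (d n). norm Q \<le> norm R + 1}.
          \<integral>\<^sup>+ x. (inverse (ennreal (norm (Q - orth_proj (basis_span \<phi> (d n)) x))))\<^sup>2 \<partial>\<mu>) < \<infinity>"
      using eventually_ge_at_top[of N0] by eventually_elim auto
    then obtain k where k: "N0 \<le> k" "(SUP Q \<in> {Q \<in> basis_span \<phi> (d k). norm Q \<le> norm R + 1}.
          \<integral>\<^sup>+ x. (inverse (ennreal (norm (Q - orth_proj (basis_span \<phi> (d k)) x))))\<^sup>2 \<partial>\<mu>) < \<infinity>" (is "?S < \<infinity>")
      unfolding eventually_sequentially by blast
    have "\<pi> (d k) R \<in> {Q \<in> basis_span \<phi> (d k). norm Q \<le> norm R + 1}"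
      using proj_in_span[of "d k" R] norm_proj_le[of "d k" R] by auto
    then have "(\<integral>\<^sup>+ x. (inverse (ennreal (norm (\<pi> (d k) R - orth_proj (basis_span \<phi> (d k)) x))))\<^sup>2 \<partial>\<mu>) \<le> ?S"
      by (rule SUP_upper)
    then have le: "(\<integral>\<^sup>+ x. (inverse (ennreal (norm (\<pi> (d k) (R - x)))))\<^sup>2 \<partial>\<mu>) \<le> ?S"
      by (simp only: orth_proj_basis_span proj_linear_simps)
    have "(\<lambda>x. norm (\<pi> (d k) (R - x))) \<in> borel_measurable \<mu>" by measurable
    from inverse_square_integrable[OF this norm_ge_zero le k(2)] show ?thesis using k(1) by blast
  qed
  have int_inv_sq: "integrable \<mu> (\<lambda>x. 1 / (norm (R - x))\<^sup>2)" for R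
  proof -
    obtain k where "AE x in \<mu>. norm (\<pi> (d k) (R - x)) \<noteq> 0" "integrable \<mu> (\<lambda>x. 1 / (norm (\<pi> (d k) (R - x)))\<^sup>2)"
      using moment by blast
    from inverse_square_integrable_mono(2)[OF _ norm_ge_zero norm_proj_le this] show ?thesis by measurable
  qed
  have "integrable P (\<lambda>\<omega>. norm (X \<omega>))" by (rule P.square_integrable_imp_integrable[OF _ X2]) measurable
  then have "integrable \<mu> norm" unfolding law[symmetric] by (subst integrable_distr_eq) auto
  then interpret spatial \<mu>
    by unfold_locales (use nonatomic not_line int_inv_sq in auto)
  obtain Q where Q: "\<And>R. spatial_objective \<mu> u Q \<le> spatial_objective \<mu> u R"
    using spatial_quantile_exists[OF u] by blast
  have quantile: "is_spatial_quantile \<mu> u R \<longleftrightarrow> R = Q" for R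
    using Q spatial_quantile_unique[OF Q, of R]
    unfolding is_spatial_quantile_def is_arg_min_def by (auto simp: not_less)
  have grad: "(\<integral>x. sgn (Q - x) - u \<partial>\<mu>) = 0" by (rule spatial_quantile_gradient_zero[OF Q])
  \<comment> \<open>One index is enough: eventually \<open>d k \<le> d n\<close>, and projections to
    larger subspaces have smaller inverse moments, so the moment at \<open>k\<close> serves as the
    uniform bound \<open>B\<close>.\<close>
  obtain k where k: "k \<ge> N0" "AE x in \<mu>. norm (\<pi> (d k) (Q - x)) \<noteq> 0" "integrable \<mu> (\<lambda>x. 1 / (norm (\<pi> (d k) (Q - x)))\<^sup>2)"
    using moment by blast
  define B where "B = (\<integral>x. 1 / (norm (\<pi> (d k) (Q - x)))\<^sup>2 \<partial>\<mu>)"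
  have sq: "integrable \<mu> (\<lambda>x. (norm (x - \<pi> (d n) x))\<^sup>2)"
    and sq_le: "(\<integral>x. (norm (x - \<pi> (d n) x))\<^sup>2 \<partial>\<mu>) \<le> 2 * (norm (m - \<pi> (d n) m))\<^sup>2 + 2 * (\<Sum>k. (lam (d n + k))\<^sup>2)" for n
    using karhunen_loeve_residual[OF KL, of "d n"] unfolding law by auto
  have xrate: "(\<lambda>n. real n * (\<integral>x. (norm (x - \<pi> (d n) x))\<^sup>2 \<partial>\<mu>)) \<longlonglongrightarrow> 0"
  proof (rule tendsto_sandwich[OF _ _ tendsto_const])
    show "\<forall>\<^sub>F n in sequentially. 0 \<le> real n * (\<integral>x. (norm (x - \<pi> (d n) x))\<^sup>2 \<partial>\<mu>)" by simp
    show "\<forall>\<^sub>F n in sequentially. real n * (\<integral>x. (norm (x - \<pi> (d n) x))\<^sup>2 \<partial>\<mu>)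
        \<le> 2 * (sqrt (real n) * norm (m - \<pi> (d n) m))\<^sup>2 + 2 * (real n * (\<Sum>k. (lam (d n + k))\<^sup>2))"
    proof (intro always_eventually allI)
      fix n
      have "real n * (\<integral>x. (norm (x - \<pi> (d n) x))\<^sup>2 \<partial>\<mu>)
          \<le> real n * (2 * (norm (m - \<pi> (d n) m))\<^sup>2 + 2 * (\<Sum>k. (lam (d n + k))\<^sup>2))"
        by (intro mult_left_mono sq_le) simp
      then show "real n * (\<integral>x. (norm (x - \<pi> (d n) x))\<^sup>2 \<partial>\<mu>)
        \<le> 2 * (sqrt (real n) * norm (m - \<pi> (d n) m))\<^sup>2 + 2 * (real n * (\<Sum>k. (lam (d n + k))\<^sup>2))"
        by (simp add: power_mult_distrib algebra_simps)
    qed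
    have "(\<lambda>n. 2 * (sqrt (real n) * norm (m - \<pi> (d n) m))\<^sup>2 + 2 * (real n * (\<Sum>k. (lam (d n + k))\<^sup>2))) \<longlonglongrightarrow> 2 * 0\<^sup>2 + 2 * 0"
      using m_rate unfolding orth_proj_basis_span by (intro tendsto_intros tail)
    then show "(\<lambda>n. 2 * (sqrt (real n) * norm (m - \<pi> (d n) m))\<^sup>2 + 2 * (real n * (\<Sum>k. (lam (d n + k))\<^sup>2))) \<longlonglongrightarrow> 0" by simp
  qed
  have urate: "(\<lambda>n. sqrt (real n) * norm (u - \<pi> (d n) u)) \<longlonglongrightarrow> 0"
    using u_rate unfolding orth_proj_basis_span .
  note rates = approximation_rates[OF basis grad urate sq xrate]
  interpret quantile_clt \<mu> M Xs \<phi> u Q d B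
  proof unfold_locales
    show "M.indep_vars (\<lambda>_. borel) Xs UNIV" by fact
    show "distr M borel (Xs i) = \<mu>" for i by fact
    show "(\<lambda>n. real (d n) / real n) \<longlonglongrightarrow> 0" using dimension_rate(1)[OF c] alpha by auto
    show "(\<lambda>n. norm (u - \<pi> (d n) u)) \<longlonglongrightarrow> 0"
    proof (rule tendsto_sandwich[OF _ _ tendsto_const urate])
      show "\<forall>\<^sub>F n in sequentially. norm (u - \<pi> (d n) u) \<le> sqrt (real n) * norm (u - \<pi> (d n) u)"
        using eventually_gt_at_top[of "0::nat"]
      proof eventually_elim
        case (elim n)
        then have "1 * norm (u - \<pi> (d n) u) \<le> sqrt (real n) * norm (u - \<pi> (d n) u)" by (intro mult_right_mono) auto
        then show ?case by simp
      qed
    qed simp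
    show "\<forall>\<^sub>F n in sequentially. (AE x in \<mu>. \<pi> (d n) (Q - x) \<noteq> 0) \<and>
        integrable \<mu> (\<lambda>x. 1 / (norm (\<pi> (d n) (Q - x)))\<^sup>2) \<and> (\<integral>x. 1 / (norm (\<pi> (d n) (Q - x)))\<^sup>2 \<partial>\<mu>) \<le> B"
      using N0[OF k(1)]
    proof eventually_elim
      case (elim n)
      have "(\<lambda>x. norm (\<pi> (d n) (Q - x))) \<in> borel_measurable \<mu>" by measurable
      from inverse_square_integrable_mono[OF this norm_ge_zero norm_proj_mono[OF elim] k(2,3)]
      show ?case unfolding B_def by simp
    qed
  qed (use u grad rates in auto)
  define \<Lambda> where "\<Lambda> z = (\<integral>x. (W x \<bullet> z) *\<^sub>R W x \<partial>\<mu>)" for z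
  have W_bound: "norm ((W x \<bullet> z) *\<^sub>R W x) \<le> norm z * 4" for x z
  proof -
    have "\<bar>W x \<bullet> z\<bar> * norm (W x) \<le> (norm (W x) * norm z) * norm (W x)" by (intro mult_right_mono Cauchy_Schwarz_ineq2) simp
    also have "\<dots> \<le> (2 * norm z) * 2" using norm_W by (intro mult_mono) auto
    finally show ?thesis by simp
  qed
  have int_\<Lambda>: "integrable \<mu> (\<lambda>x. (W x \<bullet> z) *\<^sub>R W x)" for z
    by (rule \<mu>.integrable_const_bound[of _ "norm z * 4"]) (use W_bound in auto)
  have \<Lambda>_inner: "\<Lambda> z \<bullet> w = (\<integral>x. (W x \<bullet> z) * (W x \<bullet> w) \<partial>\<mu>)" for z w
    unfolding \<Lambda>_def by (subst integral_inner_left[symmetric]) (auto intro: int_\<Lambda>)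
  have bl_\<Lambda>: "bounded_linear \<Lambda>"
  proof (rule bounded_linear_intro[where K = 4])
    fix x y :: 'a and r :: real
    show "\<Lambda> (x + y) = \<Lambda> x + \<Lambda> y" unfolding \<Lambda>_def inner_add_right scaleR_left_distrib
      by (intro Bochner_Integration.integral_add int_\<Lambda>)
    have "\<Lambda> (r *\<^sub>R x) = (\<integral>z. r *\<^sub>R ((W z \<bullet> x) *\<^sub>R W z) \<partial>\<mu>)"
      unfolding \<Lambda>_def by (intro Bochner_Integration.integral_cong refl) simp
    also have "\<dots> = r *\<^sub>R \<Lambda> x" unfolding \<Lambda>_def by (rule integral_scaleR_right)
    finally show "\<Lambda> (r *\<^sub>R x) = r *\<^sub>R \<Lambda> x" .
    have "norm (\<Lambda> x) \<le> (\<integral>z. norm ((W z \<bullet> x) *\<^sub>R W z) \<partial>\<mu>)" unfolding \<Lambda>_def by (rule integral_norm_bound)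
    also have "\<dots> \<le> (\<integral>z. norm x * 4 \<partial>\<mu>)"
      using W_bound by (intro integral_mono integrable_norm int_\<Lambda>) auto
    finally show "norm (\<Lambda> x) \<le> norm x * 4" using \<mu>.prob_space by simp
  qed
  have Tinv_sym: "Tinv x \<bullet> y = x \<bullet> Tinv y" for x y
    using hess_sym[of Q "Tinv x" "Tinv y"] by (simp add: Tinv_T)
  \<comment> \<open>The influence function with its sign: normalized sums of \<open>f\<close> are
    exactly the linearized quantile \<open>- Tinv (V n \<omega>)\<close>.\<close>
  define f where "f x = - Tinv (W x)" for x
  have f_meas [measurable]: "f \<in> borel_measurable borel" unfolding f_def by measurable
  have f_bd: "norm (f x) \<le> K * 2" for x using norm_Tinv_W[of x] by (simp add: f_def)
  have f_mean: "(\<integral>x. f x \<partial>\<mu>) = 0"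
    using bounded_linear_image_mean_zero[OF bounded_linear_minus[OF bounded_linear_inv_hess]] by (simp add: f_def)
  have f_sq: "(\<integral>x. (l \<bullet> f x)\<^sup>2 \<partial>\<mu>) = (Tinv \<circ> \<Lambda> \<circ> Tinv) l \<bullet> l" for l
  proof -
    have "(Tinv \<circ> \<Lambda> \<circ> Tinv) l \<bullet> l = \<Lambda> (Tinv l) \<bullet> Tinv l" by (simp add: Tinv_sym)
    also have "\<dots> = (\<integral>x. (l \<bullet> f x)\<^sup>2 \<partial>\<mu>)"
      unfolding \<Lambda>_inner f_def by (intro Bochner_Integration.integral_cong refl) (metis Tinv_sym inner_commute inner_minus_right power2_eq_square power2_minus)
    finally show ?thesis by simp
  qed
  have "f \<in> borel_measurable \<mu>" by measurable
  \<comment> \<open>The limit is realized as a law on the Hilbert space itself, with the identity as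
    random element.\<close>
  then obtain N :: "'a measure" where N: "prob_space N" "sets N = sets borel"
      "\<And>l. distr N borel (\<lambda>z. l \<bullet> z) = normal_law 0 (\<integral>x. (l \<bullet> f x)\<^sup>2 \<partial>\<mu>)"
    using gaussian_exists[where W = f, OF \<mu>.prob_space_axioms _ f_bd basis] by blast
  have gauss: "gaussian_element N (\<lambda>z. z) 0 (Tinv \<circ> \<Lambda> \<circ> Tinv)"
    unfolding gaussian_element_def
  proof (intro conjI allI)
    show "prob_space N" by fact
    show "(\<lambda>z. z) \<in> borel_measurable N" using measurable_ident_sets[OF N(2)] by simp
    show "0 \<le> (Tinv \<circ> \<Lambda> \<circ> Tinv) l \<bullet> l" for l unfolding f_sq[symmetric] by simp
    show "distr N borel (\<lambda>z. l \<bullet> z) = normal_law (l \<bullet> 0) ((Tinv \<circ> \<Lambda> \<circ> Tinv) l \<bullet> l)" for l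
      unfolding f_sq[symmetric] by (simp add: N(3))
  qed
  have clt: "converges_weakly M (\<lambda>n \<omega>. (1 / sqrt (real n)) *\<^sub>R (\<Sum>i<n. f (Xs i \<omega>))) N (\<lambda>z. z)"
    by (rule sample.Hilbert_CLT[OF f_meas f_bd f_mean basis N])
  have sum_f: "(1 / sqrt (real n)) *\<^sub>R (\<Sum>i<n. f (Xs i \<omega>)) = - Tinv (V n \<omega>)" for n \<omega>
    by (simp add: f_def Tinv_V sum_negf)
  have "converges_weakly M (\<lambda>n \<omega>. sqrt (real n) *\<^sub>R (Qhat n \<omega> - Q)) N (\<lambda>z. z)"
  proof (rule converges_weakly_Slutsky[OF M N(1) _ _ _ clt])
    show "(\<lambda>\<omega>. sqrt (real n) *\<^sub>R (Qhat n \<omega> - Q)) \<in> borel_measurable M" for n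
    \<comment> \<open>\<open>Qhat 0\<close> is unconstrained and possibly not measurable, but the
      factor \<open>sqrt 0\<close> makes the product 0.\<close>
    proof (cases "n = 0")
      case False
      then have [measurable]: "Qhat n \<in> borel_measurable M" by (intro Qhat_meas) simp
      show ?thesis by measurable
    qed simp
    show "(\<lambda>\<omega>. (1 / sqrt (real n)) *\<^sub>R (\<Sum>i<n. f (Xs i \<omega>))) \<in> borel_measurable M" for n by measurable
    show "(\<lambda>z. z) \<in> borel_measurable N" using measurable_ident_sets[OF N(2)] by simp
    show "(\<lambda>n. measure M {\<omega> \<in> space M. \<delta> < norm (sqrt (real n) *\<^sub>R (Qhat n \<omega> - Q)
        - (1 / sqrt (real n)) *\<^sub>R (\<Sum>i<n. f (Xs i \<omega>)))}) \<longlonglongrightarrow> 0" if "0 < \<delta>" for \<delta>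
      unfolding sum_f by (rule quantile_linearization[OF Qhat_meas Qhat_min that])
  qed
  with gauss have weak: "\<exists>(N :: 'a measure) (Z :: 'a \<Rightarrow> 'a). gaussian_element N Z 0 (Tinv \<circ> \<Lambda> \<circ> Tinv) \<and>
      converges_weakly M (\<lambda>n \<omega>. sqrt (real n) *\<^sub>R (Qhat n \<omega> - Q)) N Z" by blast
  show ?thesis
  proof (rule exI[of _ Q], rule exI[of _ "\<lambda>h v. T h \<bullet> v"], rule exI[of _ T], rule exI[of _ \<Lambda>], intro conjI)
    show "\<forall>R. is_spatial_quantile \<mu> u R \<longleftrightarrow> R = Q" using quantile by blast
    show "is_spatial_hessian \<mu> u Q (\<lambda>h v. T h \<bullet> v)" by (rule hessian_form)
    show "represents_form T (\<lambda>h v. T h \<bullet> v)" by (simp add: represents_form_def bounded_linear_hess)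
    show "bij T" by (rule bij_hess)
    show "bounded_linear Tinv" by (rule bounded_linear_inv_hess)
    show "bounded_linear \<Lambda>" by fact
    show "\<forall>z w. \<Lambda> z \<bullet> w = (\<integral>x. (W x \<bullet> z) * (W x \<bullet> w) \<partial>\<mu>)" by (simp add: \<Lambda>_inner)
  qed (rule weak)
qed

end
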